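(* Let $(u_n)_{n \geq 0}$ be a sequence of integers, not identically zero, satisfying $u_n = a_1 u_{n-1} + a_2 u_{n-2} + \cdots + a_k u_{n-k}$ for all integers $n \geq k$, where $k \geq 1$, $a_1, \ldots, a_k \in \mathbf{Z}$ and $a_k \neq 0$. Assume $(u_n)_{n \geq 0}$ is nondegenerate. Let $\mathcal{A}_u = \{n \in \mathbf{N} : \gcd(n, u_n) = 1\}$. Then the asymptotic density $\mathbf{d}(\mathcal{A}_u)$ exists. Moreover, if $(u_n/n)_{n \geq 1}$ is not a linear recurrence, then $\mathbf{d}(\mathcal{A}_u) > 0$; otherwise, $\mathcal{A}_u$ is finite (and so $\mathbf{d}(\mathcal{A}_u) = 0$).
   Context: $\mathbf{N}$ denotes the set of positive integers. The linear recurrence is nondegenerate if no ratio $\alpha_i/\alpha_j$ of two distinct roots of its characteristic polynomial $X^k - a_1X^{k-1} - \cdots - a_k$ is a root of unity. A sequence is a linear recurrence if it satisfies a linear recurrence relation of finite order with constant (complex) coefficients. For $\mathcal{S} \subseteq \mathbf{N}$, the asymptotic density $\mathbf{d}(\mathcal{S})$ is $\lim_{x \to +\infty} \#(\mathcal{S} \cap [1,x])/x$ when this limit exists. *)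

theory Defs
  imports "HOL-Analysis.Analysis" "HOL-Computational_Algebra.Polynomial"
begin

definition is_linear_recurrence :: "(nat \<Rightarrow> complex) \<Rightarrow> bool" where
  "is_linear_recurrence w \<longleftrightarrow>
     (\<exists>m::nat. \<exists>c::nat \<Rightarrow> complex.
        \<forall>n\<ge>m. w n = (\<Sum>i=1..m. c i * w (n - i)))"

definition char_poly :: "nat \<Rightarrow> (nat \<Rightarrow> complex) \<Rightarrow> complex poly" where
  "char_poly m c = monom 1 m - (\<Sum>i=1..m. monom (c i) (m - i))"

definition nondegenerate_rec :: "nat \<Rightarrow> (nat \<Rightarrow> complex) \<Rightarrow> bool" where
  "nondegenerate_rec m c \<longleftrightarrow>
     (\<forall>\<alpha> \<beta>. poly (char_poly m c) \<alpha> = 0 \<longrightarrow> poly (char_poly m c) \<beta> = 0 \<longrightarrow> \<alpha> \<noteq> \<beta> \<longrightarrow>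
        \<not> (\<exists>r::nat. r > 0 \<and> (\<alpha> / \<beta>) ^ r = 1))"

text \<open>A sequence is nondegenerate if it satisfies some nondegenerate linear recurrence
  (c m \<noteq> 0); equivalently, its minimal recurrence is nondegenerate.\<close>
definition nondegenerate_seq :: "(nat \<Rightarrow> complex) \<Rightarrow> bool" where
  "nondegenerate_seq w \<longleftrightarrow>
     (\<exists>m::nat. \<exists>c::nat \<Rightarrow> complex. m \<ge> 1 \<and> c m \<noteq> 0 \<and>
        (\<forall>n\<ge>m. w n = (\<Sum>i=1..m. c i * w (n - i))) \<and> nondegenerate_rec m c)"

definition has_density :: "nat set \<Rightarrow> real \<Rightarrow> bool" where
  "has_density S d \<longleftrightarrow>
     ((\<lambda>x::real. real (card (S \<inter> {1..nat \<lfloor>x\<rfloor>})) / x) \<longlongrightarrow> d) at_top"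

end

theory Submission
  imports Defs "Jordan_Normal_Form.Char_Poly" "HOL-Number_Theory.Totient"
begin

text \<open>Write \<open>u n\<close> as an exponential sum \<open>\<Sum>\<alpha>\<in>J. P \<alpha> n * \<alpha> ^ n\<close>. If every polynomial \<open>P \<alpha>\<close> has
  constant term \<open>0\<close>, then \<open>u n / n\<close> is again an exponential sum, \<open>n\<close> divides \<open>D * u n\<close> for a fixed
  \<open>D\<close>, and only divisors of \<open>D\<close> can be coprime to \<open>u n\<close>. Otherwise, for a prime \<open>p\<close>,
  \<open>u (p * m)\<close> is congruent to \<open>\<Sum>\<alpha>\<in>J. P \<alpha> 0 * (\<alpha> ^ p) ^ m\<close> modulo \<open>p\<close>, a nonzero power sum. As long as
  no \<open>\<alpha> ^ h - \<beta> ^ h\<close> with \<open>1 \<le> h \<le> L\<close> shares a factor with \<open>p\<close>, this power sum has only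
  \<open>O (L powr (1 - \<delta>))\<close> zeros modulo \<open>p\<close> in a window of length \<open>L\<close>. The integers \<open>N h\<close> controlling
  these differences are at most exponential in \<open>h\<close>, so the primes dividing some \<open>N h\<close> with \<open>h ^ 4 \<le> p\<close>
  are sparse. Hence the \<open>n\<close> having a common prime factor \<open>p > y\<close> with \<open>u n\<close> have upper density
  \<open>O (y powr - \<eta>)\<close>: letting \<open>y\<close> grow, the density exists, and it is positive because the integers
  free of primes up to \<open>y\<close> have density \<open>\<Prod>p\<le>y. 1 - 1 / p\<close>, which decays more slowly than any power
  of \<open>y\<close>.\<close>

section \<open>Algebraic integers\<close>

text \<open>The obstacle is that the arithmetic of \<open>u\<close> takes place in a number field.
  Prime ideals and norms are replaced as follows. Congruences are taken modulo the rational prime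
  \<open>p\<close> in the ring of all complex algebraic integers, and being nonzero modulo a prime
  ideal becomes being invertible modulo \<open>p\<close>. Bezout supplies this as soon as some
  integer multiple of the number is prime to \<open>p\<close>. Such a multiple is a coefficient of a
  monic integer polynomial, obtained as the characteristic polynomial of an integer matrix; tracking
  the size of its coefficients bounds \<open>N h\<close>. Frobenius then transfers invertibility
  from \<alpha>^h - \<beta>^h to the same expression in \<alpha>^p and \<beta>^p. The saving
  \<delta> is halved with every further exponent, because counting pairs bounds only the square of
  the number of zeros. The threshold \<open>h ^ 4 \<le> p\<close> is a compromise: windows of length
  about p^(1/4) still save a power of \<open>p\<close>, while \<open>N h\<close> has O(h) prime
  factors, each of weight at most h^(-3) times a power of \<open>y\<close>, and the sum over
  \<open>h\<close> converges. About the distribution of primes only \<open>prime_count n\<close> =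
  o(n) enters.\<close>

definition l1_norm :: "int poly \<Rightarrow> int" where
  "l1_norm p = (\<Sum>c\<leftarrow>coeffs p. \<bar>c\<bar>)"

lemma l1_norm_0 [simp]: "l1_norm 0 = 0"
  by (simp add: l1_norm_def)

lemma l1_norm_pCons [simp]: "l1_norm (pCons a p) = \<bar>a\<bar> + l1_norm p"
  by (auto simp: l1_norm_def cCons_def)

lemma l1_norm_1 [simp]: "l1_norm 1 = 1"
  by (simp add: one_pCons)

lemma l1_norm_nonneg: "0 \<le> l1_norm p"
  by (induction p) auto

lemma l1_norm_add: "l1_norm (p + q) \<le> l1_norm p + l1_norm q"
  by (induction p q rule: poly_induct2) auto

lemma l1_norm_smult: "l1_norm (Polynomial.smult a p) = \<bar>a\<bar> * l1_norm p"
  by (induction p) (auto simp: abs_mult algebra_simps)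

lemma l1_norm_mult: "l1_norm (p * q) \<le> l1_norm p * l1_norm q"
proof (induction p)
  case (pCons a p)
  have "l1_norm (pCons a p * q) \<le> l1_norm (Polynomial.smult a q) + l1_norm (pCons 0 (p * q))"
    by (simp only: mult_pCons_left l1_norm_add)
  with pCons show ?case by (simp add: l1_norm_smult algebra_simps)
qed auto

lemma l1_norm_sum: "l1_norm (sum f S) \<le> (\<Sum>i\<in>S. l1_norm (f i))"
proof (induction S rule: infinite_finite_induct)
  case (insert x F)
  then show ?case using l1_norm_add[of "f x" "sum f F"] by simp
qed auto

lemma l1_norm_prod: "l1_norm (prod f S) \<le> (\<Prod>i\<in>S. l1_norm (f i))"
proof (induction S rule: infinite_finite_induct)
  case (insert x F)
  have "l1_norm (f x * prod f F) \<le> l1_norm (f x) * (\<Prod>i\<in>F. l1_norm (f i))"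
    using l1_norm_mult[of "f x" "prod f F"] insert(3)
    by (meson l1_norm_nonneg mult_left_mono order_trans)
  with insert show ?case by simp
qed auto

text \<open>The characteristic polynomial is monic and vanishes at the eigenvalue. In its Leibniz
  expansion each of the n! terms is a product of \<open>n\<close> entries of XI - M, each of norm at
  most \<open>1 + B\<close>, and \<open>l1_norm\<close> is submultiplicative.\<close>

lemma int_matrix_eigenvalue_nat:
  fixes M :: "nat \<Rightarrow> nat \<Rightarrow> int" and v :: "nat \<Rightarrow> complex"
  assumes ev: "\<And>i. i < n \<Longrightarrow> (\<Sum>j<n. of_int (M i j) * v j) = x * v i"
    and b: "b < n" "v b \<noteq> 0"
    and bound: "\<And>i j. i < n \<Longrightarrow> j < n \<Longrightarrow> \<bar>M i j\<bar> \<le> B"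
  shows "\<exists>q. lead_coeff q = 1 \<and> poly (map_poly of_int q) x = 0 \<and> l1_norm q \<le> fact n * (1 + B) ^ n"
proof -
  define A where "A = mat n n (\<lambda>(i, j). M i j)"
  have A: "A \<in> carrier_mat n n" by (simp add: A_def)
  define A' :: "complex mat" where "A' = map_mat of_int A"
  have A': "A' \<in> carrier_mat n n" using A by (simp add: A'_def)
  define q where "q = Char_Poly.char_poly A"
  have B0: "0 \<le> B" using bound[OF b(1) b(1)] by linarith
  have lc: "lead_coeff q = 1"
    using degree_monic_char_poly[OF A] by (simp add: q_def)
  have "eigenvector A' (vec n v) x"
    unfolding eigenvector_def
  proof (intro conjI)
    show "vec n v \<noteq> 0\<^sub>v (dim_row A')"
    proof
      assume "vec n v = 0\<^sub>v (dim_row A')"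
      then have "vec_index (vec n v) b = vec_index (0\<^sub>v (dim_row A')) b" by simp
      with b A' show False by simp
    qed
    show "A' *\<^sub>v vec n v = x \<cdot>\<^sub>v vec n v"
    proof (rule eq_vecI)
      fix i assume "i < dim_vec (x \<cdot>\<^sub>v vec n v)"
      then have i: "i < n" by simp
      have "vec_index (A' *\<^sub>v vec n v) i = (\<Sum>j<n. of_int (M i j) * v j)"
        using i by (simp add: A'_def A_def scalar_prod_def lessThan_atLeast0)
      with ev[OF i] i show "vec_index (A' *\<^sub>v vec n v) i = vec_index (x \<cdot>\<^sub>v vec n v) i" by simp
    qed (use A' in auto)
  qed (use A' in auto)
  then have "eigenvalue A' x" unfolding eigenvalue_def by blast
  then have "poly (Char_Poly.char_poly A') x = 0"
    using eigenvalue_root_char_poly[OF A'] by blast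
  moreover have "Char_Poly.char_poly A' = map_poly of_int q"
    unfolding A'_def q_def by (rule of_int_hom.char_poly_hom[OF A])
  ultimately have root: "poly (map_poly of_int q) x = 0" by simp
  let ?P = "{p. p permutes {0..<n}}"
  have C: "char_poly_matrix A \<in> carrier_mat n n" using A by simp
  have entry: "l1_norm (char_poly_matrix A $$ (i, j)) \<le> 1 + B" if "i < n" "j < n" for i j
    using that bound[OF that] B0 A
    by (auto simp: char_poly_matrix_def A_def)
  have "l1_norm q \<le> (\<Sum>p\<in>?P. l1_norm (signof p * (\<Prod>i = 0..<n. char_poly_matrix A $$ (i, p i))))"
    unfolding q_def Char_Poly.char_poly_def det_def'[OF C] by (rule l1_norm_sum)
  also have "\<dots> \<le> (\<Sum>p\<in>?P. (1 + B) ^ n)"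
  proof (rule sum_mono)
    fix p assume p: "p \<in> ?P"
    have "l1_norm (signof p * r) = l1_norm r" for r
      using l1_norm_smult[of "-1" r] by (cases p rule: sign_cases) simp_all
    then have "l1_norm (signof p * (\<Prod>i = 0..<n. char_poly_matrix A $$ (i, p i)))
       \<le> (\<Prod>i = 0..<n. l1_norm (char_poly_matrix A $$ (i, p i)))"
      using l1_norm_prod by simp
    also have "\<dots> \<le> (\<Prod>i = 0..<n. 1 + B)"
      using p by (intro prod_mono conjI l1_norm_nonneg entry)
        (auto dest: permutes_in_image)
    finally show "l1_norm (signof p * (\<Prod>i = 0..<n. char_poly_matrix A $$ (i, p i))) \<le> (1 + B) ^ n"
      by simp
  qed
  also have "\<dots> = fact n * (1 + B) ^ n"
    by (simp add: card_permutations)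
  finally show ?thesis using lc root by blast
qed

text \<open>General finite index sets are wanted because the matrix built below is indexed by pairs
  of exponents.\<close>

lemma int_matrix_eigenvalue:
  fixes M :: "'i \<Rightarrow> 'i \<Rightarrow> int" and v :: "'i \<Rightarrow> complex"
  assumes I: "finite I"
    and ev: "\<And>i. i \<in> I \<Longrightarrow> (\<Sum>j\<in>I. of_int (M i j) * v j) = x * v i"
    and b: "b \<in> I" "v b \<noteq> 0"
    and bound: "\<And>i j. i \<in> I \<Longrightarrow> j \<in> I \<Longrightarrow> \<bar>M i j\<bar> \<le> B"
  shows "\<exists>q. lead_coeff q = 1 \<and> poly (map_poly of_int q) x = 0
           \<and> l1_norm q \<le> fact (card I) * (1 + B) ^ card I"
proof -
  obtain e where e: "bij_betw e {..<card I} I"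
    using ex_bij_betw_nat_finite[OF I] by (auto simp: lessThan_atLeast0)
  then obtain n0 where n0: "n0 < card I" "e n0 = b"
    using b by (metis bij_betw_imp_surj_on imageE lessThan_iff)
  have in_I: "e n \<in> I" if "n < card I" for n
    using e that by (auto simp: bij_betw_def)
  show ?thesis
  proof (rule int_matrix_eigenvalue_nat[where M = "\<lambda>i j. M (e i) (e j)" and v = "v \<circ> e" and b = n0])
    fix i :: nat assume i: "i < card I"
    show "(\<Sum>j<card I. of_int (M (e i) (e j)) * (v \<circ> e) j) = x * (v \<circ> e) i"
      using ev[OF in_I[OF i]] sum.reindex_bij_betw[OF e, of "\<lambda>j. of_int (M (e i) j) * v j"] by simp
  qed (use n0 b bound in_I in auto)
qed

text \<open>Multiplication by \<alpha> acts on 1, \<alpha>, ..., \<alpha>^(k-1) through a companion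
  matrix, and \<open>F\<close> is its \<open>h\<close>-th power. The base \<open>B\<close> does not
  depend on \<open>h\<close>; this is the source of the later bounds \<open>C ^ h\<close>.\<close>

lemma algebraic_int_powers_spanE:
  fixes \<alpha> :: complex
  assumes "algebraic_int \<alpha>"
  obtains k B where "k \<ge> 1" "B \<ge> 1" "\<And>h. \<exists>F :: nat \<Rightarrow> nat \<Rightarrow> int.
           (\<forall>i<k. \<alpha> ^ h * \<alpha> ^ i = (\<Sum>j<k. of_int (F i j) * \<alpha> ^ j)) \<and>
           (\<forall>i<k. \<forall>j<k. \<bar>F i j\<bar> \<le> B ^ h)"
proof -
  obtain f :: "int poly" where f: "poly (map_poly of_int f) \<alpha> = 0" "lead_coeff f = 1"
    using assms unfolding algebraic_int_altdef_ipoly by blast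
  define k where "k = degree f"
  have k: "k \<ge> 1"
  proof (rule ccontr)
    assume "\<not> k \<ge> 1"
    then have "degree f = 0" by (simp add: k_def)
    then obtain c where "f = [:c:]" by (rule degree_eq_zeroE)
    with f show False by simp
  qed
  have top: "\<alpha> ^ k = (\<Sum>j<k. of_int (- coeff f j) * \<alpha> ^ j)"
  proof -
    have "0 = (\<Sum>j\<le>k. of_int (coeff f j) * \<alpha> ^ j)"
      using f(1) by (simp add: poly_altdef k_def)
    also have "\<dots> = \<alpha> ^ k + (\<Sum>j<k. of_int (coeff f j) * \<alpha> ^ j)"
      using f(2) by (simp add: k_def flip: lessThan_Suc_atMost)
    finally show ?thesis by (simp add: sum_negf eq_neg_iff_add_eq_0)
  qed
  \<comment> \<open>Companion matrix: each basis vector moves up by one, and the last one falls back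
    by \<open>top\<close>.\<close>
  define G where "G i j = (if Suc i < k then (if j = Suc i then 1 else 0) else - coeff f j)" for i j
  have G: "\<alpha> * \<alpha> ^ i = (\<Sum>j<k. of_int (G i j) * \<alpha> ^ j)" if "i < k" for i
  proof (cases "Suc i < k")
    case True
    then have "(\<Sum>j<k. of_int (G i j) * \<alpha> ^ j) = (\<Sum>j<k. if j = Suc i then \<alpha> ^ j else 0)"
      by (intro sum.cong) (auto simp: G_def)
    then show ?thesis using True by simp
  next
    case False
    then have "Suc i = k" using that by simp
    then show ?thesis using top by (auto simp: G_def simp flip: power_Suc)
  qed
  define B0 where "B0 = 1 + l1_norm f"
  have coeff_le: "\<bar>coeff p j\<bar> \<le> l1_norm p" for p j
  proof (induction p arbitrary: j)
    case (pCons a p)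
    then show ?case using l1_norm_nonneg[of p]
      by (cases j) (simp_all add: add_increasing)
  qed auto
  have GB: "\<bar>G i j\<bar> \<le> B0" for i j
    using coeff_le[of f j] l1_norm_nonneg[of f] by (auto simp: G_def B0_def)
  \<comment> \<open>The factor \<open>k\<close> pays for the \<open>k\<close> summands in an entry
    of a matrix product.\<close>
  define B where "B = int k * B0"
  have B0: "B0 \<ge> 1" using l1_norm_nonneg[of f] by (simp add: B0_def)
  have B: "B \<ge> 1" using mult_mono'[of 1 "int k" 1 B0] k B0 by (simp add: B_def)
  have "\<exists>F :: nat \<Rightarrow> nat \<Rightarrow> int.
           (\<forall>i<k. \<alpha> ^ h * \<alpha> ^ i = (\<Sum>j<k. of_int (F i j) * \<alpha> ^ j)) \<and>
           (\<forall>i<k. \<forall>j<k. \<bar>F i j\<bar> \<le> B ^ h)" for h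
  proof (induction h)
    case 0
    show ?case
    proof (intro exI[of _ "\<lambda>i j. if i = j then 1 else 0"] conjI allI impI)
      fix i assume "i < k"
      have "(\<Sum>j<k. of_int (if i = j then 1 else 0) * \<alpha> ^ j) = (\<Sum>j<k. if i = j then \<alpha> ^ j else 0)"
        by (intro sum.cong) auto
      then show "\<alpha> ^ 0 * \<alpha> ^ i = (\<Sum>j<k. of_int (if i = j then 1 else 0) * \<alpha> ^ j)"
        using \<open>i < k\<close> by simp
    qed auto
  next
    case (Suc h)
    then obtain F where F: "\<And>i. i < k \<Longrightarrow> \<alpha> ^ h * \<alpha> ^ i = (\<Sum>j<k. of_int (F i j) * \<alpha> ^ j)"
      and FB: "\<And>i j. i < k \<Longrightarrow> j < k \<Longrightarrow> \<bar>F i j\<bar> \<le> B ^ h" by blast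
    show ?case
    proof (intro exI[of _ "\<lambda>i j. \<Sum>l<k. F i l * G l j"] conjI allI impI)
      fix i assume i: "i < k"
      have "\<alpha> ^ Suc h * \<alpha> ^ i = (\<Sum>l<k. of_int (F i l) * (\<alpha> * \<alpha> ^ l))"
        unfolding power_Suc mult.assoc F[OF i] sum_distrib_left
        by (intro sum.cong refl) (simp only: mult_ac)
      also have "\<dots> = (\<Sum>l<k. \<Sum>j<k. of_int (F i l * G l j) * \<alpha> ^ j)"
        by (intro sum.cong refl) (simp only: G lessThan_iff sum_distrib_left of_int_mult mult.assoc)
      also have "\<dots> = (\<Sum>j<k. of_int (\<Sum>l<k. F i l * G l j) * \<alpha> ^ j)"
        unfolding of_int_sum sum_distrib_right by (rule sum.swap)
      finally show "\<alpha> ^ Suc h * \<alpha> ^ i = (\<Sum>j<k. of_int (\<Sum>l<k. F i l * G l j) * \<alpha> ^ j)" .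
      fix j
      have "\<bar>\<Sum>l<k. F i l * G l j\<bar> \<le> (\<Sum>l<k. B ^ h * B0)"
      proof (rule order_trans[OF sum_abs], rule sum_mono)
        fix l assume "l \<in> {..<k}"
        with FB[OF i, of l] GB[of l j] show "\<bar>F i l * G l j\<bar> \<le> B ^ h * B0"
          unfolding abs_mult using B by (intro mult_mono) auto
      qed
      also have "\<dots> = B ^ Suc h" by (simp add: B_def)
      finally show "\<bar>\<Sum>l<k. F i l * G l j\<bar> \<le> B ^ Suc h" .
    qed
  qed
  with k B show ?thesis by (rule that)
qed

lemma sum_times_sum:
  fixes f :: "'a \<Rightarrow> 'c :: semiring_0"
  shows "sum f S * sum g T = (\<Sum>y\<in>S \<times> T. f (fst y) * g (snd y))"
  by (simp add: sum_product sum.cartesian_product case_prod_beta)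

text \<open>If \<open>F\<close> and \<open>G\<close> represent multiplication by \<alpha>^h and
  \<beta>^h, the vector of all products \<alpha>^i \<beta>^j is an eigenvector of the combination,
  with coefficients \<open>r\<close>, \<open>s\<close>, \<open>t\<close>, of the Kronecker products
  of \<open>F\<close> with 1, of 1 with \<open>G\<close> and of \<open>F\<close> with
  \<open>G\<close>. Closure under sums, products and differences follows at once, with size bounds
  uniform in \<open>h\<close>.\<close>

lemma two_algebraic_ints_combination:
  fixes \<alpha> \<beta> :: complex
  assumes "algebraic_int \<alpha>" "algebraic_int \<beta>"
  shows "\<exists>C\<ge>1. \<forall>h\<ge>1. \<forall>r\<in>{-1,0,1}. \<forall>s\<in>{-1,0,1}. \<forall>t\<in>{-1,0,1}. \<exists>q. lead_coeff q = 1 \<and>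
      poly (map_poly of_int q) (of_int r * \<alpha> ^ h + of_int s * \<beta> ^ h + of_int t * (\<alpha> ^ h * \<beta> ^ h)) = 0 \<and>
      l1_norm q \<le> C ^ h"
proof -
  obtain k B where k: "k \<ge> 1" "B \<ge> (1::int)" and F: "\<And>h. \<exists>F :: nat \<Rightarrow> nat \<Rightarrow> int.
           (\<forall>i<k. \<alpha> ^ h * \<alpha> ^ i = (\<Sum>j<k. of_int (F i j) * \<alpha> ^ j)) \<and>
           (\<forall>i<k. \<forall>j<k. \<bar>F i j\<bar> \<le> B ^ h)"
    by (rule algebraic_int_powers_spanE[OF assms(1)], rule that)
  obtain l D where l: "l \<ge> 1" "D \<ge> (1::int)" and G: "\<And>h. \<exists>F :: nat \<Rightarrow> nat \<Rightarrow> int.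
           (\<forall>i<l. \<beta> ^ h * \<beta> ^ i = (\<Sum>j<l. of_int (F i j) * \<beta> ^ j)) \<and>
           (\<forall>i<l. \<forall>j<l. \<bar>F i j\<bar> \<le> D ^ h)"
    by (rule algebraic_int_powers_spanE[OF assms(2)], rule that)
  let ?I = "{..<k} \<times> {..<l}"
  \<comment> \<open>For \<open>h \<ge> 1\<close> one has
    \<open>1 + 3 * (B * D) ^ h \<le> (4 * (B * D)) ^ h\<close>, where 3 counts the summands of an
    entry, and the factorial is at most its own \<open>h\<close>-th power.\<close>
  define C where "C = fact (k * l) * (4 * (B * D)) ^ (k * l)"
  have BD: "B * D \<ge> 1" using mult_mono'[of 1 B 1 D] k(2) l(2) by simp
  then have "1 * 1 \<le> fact (k * l) * (4 * (B * D)) ^ (k * l)"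
    by (intro mult_mono fact_ge_1 one_le_power) simp_all
  then have C: "C \<ge> 1" by (simp only: C_def mult_1)
  show ?thesis
  proof (intro exI[of _ C] conjI C allI impI ballI)
    fix h :: nat and r s t :: int
    assume h: "h \<ge> 1" and r: "r \<in> {-1,0,1}" and s: "s \<in> {-1,0,1}" and t: "t \<in> {-1,0,1}"
    obtain F where F: "\<And>i. i < k \<Longrightarrow> \<alpha> ^ h * \<alpha> ^ i = (\<Sum>j<k. of_int (F i j) * \<alpha> ^ j)"
      and FB: "\<And>i j. i < k \<Longrightarrow> j < k \<Longrightarrow> \<bar>F i j\<bar> \<le> B ^ h"
      using F[of h] by (elim exE conjE) blast
    obtain G where G: "\<And>i. i < l \<Longrightarrow> \<beta> ^ h * \<beta> ^ i = (\<Sum>j<l. of_int (G i j) * \<beta> ^ j)"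
      and GB: "\<And>i j. i < l \<Longrightarrow> j < l \<Longrightarrow> \<bar>G i j\<bar> \<le> D ^ h"
      using G[of h] by (elim exE conjE) blast
    define d where "d i j = (if i = j then 1 else 0 :: int)" for i j :: nat
    define M where "M x y = r * (F (fst x) (fst y) * d (snd x) (snd y))
       + s * (d (fst x) (fst y) * G (snd x) (snd y))
       + t * (F (fst x) (fst y) * G (snd x) (snd y))" for x y
    define v where "v x = \<alpha> ^ fst x * \<beta> ^ snd x" for x
    let ?x = "of_int r * \<alpha> ^ h + of_int s * \<beta> ^ h + of_int t * (\<alpha> ^ h * \<beta> ^ h)"
    have d: "(\<Sum>j<m. of_int (d i j) * (z::complex) ^ j) = z ^ i" if "i < m" for i m z
    proof -
      have "(\<Sum>j<m. of_int (d i j) * z ^ j) = (\<Sum>j<m. if i = j then z ^ j else 0)"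
        by (intro sum.cong) (auto simp: d_def)
      with that show ?thesis by simp
    qed
    have tensor: "(\<Sum>y\<in>?I. of_int (P (fst y) * Q (snd y)) * v y)
        = (\<Sum>j<k. of_int (P j) * \<alpha> ^ j) * (\<Sum>j<l. of_int (Q j) * \<beta> ^ j)" for P Q :: "nat \<Rightarrow> int"
      unfolding sum_times_sum by (intro sum.cong refl) (simp add: v_def mult_ac)
    \<comment> \<open>The vector \<open>v\<close> is nonzero because its entry at
      \<open>(0, 0)\<close> is 1, even when \<alpha> or \<beta> is 0.\<close>
    have "\<exists>q. lead_coeff q = 1 \<and> poly (map_poly of_int q) ?x = 0
           \<and> l1_norm q \<le> fact (card ?I) * (1 + 3 * (B * D) ^ h) ^ card ?I"
    proof (rule int_matrix_eigenvalue[where M = M and v = v and b = "(0, 0)"])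
      fix x assume "x \<in> ?I"
      then obtain i j where x: "x = (i, j)" "i < k" "j < l" by auto
      have "(\<Sum>y\<in>?I. of_int (M x y) * v y) =
          of_int r * (\<Sum>y\<in>?I. of_int (F i (fst y) * d j (snd y)) * v y)
        + of_int s * (\<Sum>y\<in>?I. of_int (d i (fst y) * G j (snd y)) * v y)
        + of_int t * (\<Sum>y\<in>?I. of_int (F i (fst y) * G j (snd y)) * v y)"
        unfolding sum_distrib_left sum.distrib[symmetric]
        by (intro sum.cong refl) (simp add: M_def x algebra_simps)
      also have "\<dots> = ?x * v x"
        unfolding tensor F[OF x(2), symmetric] G[OF x(3), symmetric] d[OF x(2)] d[OF x(3)]
        by (simp add: v_def x algebra_simps)
      finally show "(\<Sum>y\<in>?I. of_int (M x y) * v y) = ?x * v x" .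
    next
      fix x y assume "x \<in> ?I" "y \<in> ?I"
      then have xy: "fst x < k" "fst y < k" "snd x < l" "snd y < l" by auto
      have pw: "1 \<le> B ^ h" "1 \<le> D ^ h" using k l by (simp_all add: one_le_power)
      have abs_le: "\<bar>c * (a * b)\<bar> \<le> (B * D) ^ h"
        if "c \<in> {-1,0,1}" "\<bar>a\<bar> \<le> B ^ h" "\<bar>b\<bar> \<le> D ^ h" for a b c :: int
      proof -
        have "\<bar>c * (a * b)\<bar> \<le> 1 * (\<bar>a\<bar> * \<bar>b\<bar>)"
          unfolding abs_mult using that(1) by (intro mult_right_mono) auto
        also have "\<dots> \<le> B ^ h * D ^ h"
          unfolding mult_1 by (rule mult_mono) (use that(2,3) pw in auto)
        finally show ?thesis by (simp add: power_mult_distrib)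
      qed
      have abs_add3: "\<bar>a + b + c\<bar> \<le> \<bar>a\<bar> + \<bar>b\<bar> + \<bar>c\<bar>" for a b c :: int
        by linarith
      have d1: "\<bar>d i j\<bar> \<le> B ^ h" "\<bar>d i j\<bar> \<le> D ^ h" for i j
        using pw by (auto simp: d_def)
      have "\<bar>M x y\<bar> \<le> \<bar>r * (F (fst x) (fst y) * d (snd x) (snd y))\<bar>
       + \<bar>s * (d (fst x) (fst y) * G (snd x) (snd y))\<bar>
       + \<bar>t * (F (fst x) (fst y) * G (snd x) (snd y))\<bar>"
        unfolding M_def by (rule abs_add3)
      also have "\<dots> \<le> (B * D) ^ h + (B * D) ^ h + (B * D) ^ h"
        by (intro add_mono abs_le r s t FB GB d1 xy)
      finally show "\<bar>M x y\<bar> \<le> 3 * (B * D) ^ h" by simp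
    qed (use k l in \<open>auto simp: v_def\<close>)
    then obtain q where q: "lead_coeff q = 1" "poly (map_poly of_int q) ?x = 0"
      "l1_norm q \<le> fact (k * l) * (1 + 3 * (B * D) ^ h) ^ (k * l)"
      by (auto simp: card_cartesian_product)
    have pw: "1 \<le> (B * D) ^ h" using BD by (simp add: one_le_power)
    have "(4::int) \<le> 4 ^ h"
      using h by (intro self_le_power) simp_all
    then have "4 * (B * D) ^ h \<le> 4 ^ h * (B * D) ^ h"
      using pw by (intro mult_right_mono) linarith+
    then have "4 * (B * D) ^ h \<le> (4 * (B * D)) ^ h"
      by (simp only: power_mult_distrib[of 4])
    with pw have "1 + 3 * (B * D) ^ h \<le> (4 * (B * D)) ^ h" by linarith
    then have le: "(1 + 3 * (B * D) ^ h) ^ (k * l) \<le> ((4 * (B * D)) ^ h) ^ (k * l)"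
      using pw by (intro power_mono) linarith+
    have power_commutes': "(a ^ m) ^ n = (a ^ n) ^ m" for a :: int and m n
      by (metis power_mult mult.commute)
    have "(fact (k * l) :: int) \<le> fact (k * l) ^ h"
      using h by (intro self_le_power fact_ge_1) simp
    with le have "fact (k * l) * (1 + 3 * (B * D) ^ h) ^ (k * l) \<le> fact (k * l) ^ h * ((4 * (B * D)) ^ h) ^ (k * l)"
      using pw by (intro mult_mono zero_le_power) simp_all
    also have "\<dots> = C ^ h"
      unfolding C_def power_mult_distrib[of "fact (k * l)"]
      by (rule arg_cong[OF power_commutes'])
    finally show "\<exists>q. lead_coeff q = 1 \<and> poly (map_poly of_int q) ?x = 0 \<and> l1_norm q \<le> C ^ h"
      using q by (intro exI[of _ q]) auto
  qed
qed

lemma algebraic_int_plus [intro]: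
  fixes \<alpha> \<beta> :: complex
  assumes "algebraic_int \<alpha>" "algebraic_int \<beta>"
  shows "algebraic_int (\<alpha> + \<beta>)"
proof -
  obtain q :: "int poly" where "lead_coeff q = 1"
    "poly (map_poly of_int q) (of_int 1 * \<alpha> ^ 1 + of_int 1 * \<beta> ^ 1 + of_int 0 * (\<alpha> ^ 1 * \<beta> ^ 1)) = 0"
    using two_algebraic_ints_combination[OF assms] by (metis insertCI order_refl)
  then show ?thesis unfolding algebraic_int_altdef_ipoly by auto
qed

lemma algebraic_int_times [intro]:
  fixes \<alpha> \<beta> :: complex
  assumes "algebraic_int \<alpha>" "algebraic_int \<beta>"
  shows "algebraic_int (\<alpha> * \<beta>)"
proof -
  obtain q :: "int poly" where "lead_coeff q = 1"
    "poly (map_poly of_int q) (of_int 0 * \<alpha> ^ 1 + of_int 0 * \<beta> ^ 1 + of_int 1 * (\<alpha> ^ 1 * \<beta> ^ 1)) = 0"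
    using two_algebraic_ints_combination[OF assms] by (metis insertCI order_refl)
  then show ?thesis unfolding algebraic_int_altdef_ipoly by auto
qed

lemma algebraic_int_diff [intro]:
  fixes \<alpha> \<beta> :: complex
  shows "algebraic_int \<alpha> \<Longrightarrow> algebraic_int \<beta> \<Longrightarrow> algebraic_int (\<alpha> - \<beta>)"
  using algebraic_int_plus[of \<alpha> "- \<beta>"] by simp

lemma algebraic_int_power [intro]: "algebraic_int (\<alpha> :: complex) \<Longrightarrow> algebraic_int (\<alpha> ^ n)"
  by (induction n) auto

lemma algebraic_int_sum [intro]:
  fixes f :: "'a \<Rightarrow> complex"
  shows "(\<And>i. i \<in> S \<Longrightarrow> algebraic_int (f i)) \<Longrightarrow> algebraic_int (sum f S)"
  by (induction S rule: infinite_finite_induct) auto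

lemma algebraic_int_poly:
  assumes "algebraic_int (x :: complex)"
  shows "algebraic_int (poly (map_poly of_int p) x)"
  unfolding poly_altdef
  by (intro algebraic_int_sum algebraic_int_times algebraic_int_power assms) (simp add: coeff_map_poly)

text \<open>Write q = a + X r. If \<open>a \<noteq> 0\<close>, then \<open>x\<close> times -r(x) is
  \<open>a\<close>; if \<open>a = 0\<close>, the factor \<open>x\<close> cancels and
  \<open>r\<close> takes over. Thus \<open>N\<close> is the lowest nonzero coefficient of
  \<open>q\<close>, and it stands in for the norm of \<open>x\<close>.\<close>

lemma algebraic_int_dvd_int:
  fixes x :: complex
  assumes x: "algebraic_int x" "x \<noteq> 0"
    and q: "lead_coeff q = 1" "poly (map_poly of_int q) x = 0"
  shows "\<exists>N y. N \<noteq> 0 \<and> \<bar>N\<bar> \<le> l1_norm q \<and> algebraic_int y \<and> x * y = of_int N"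
  using q
proof (induction q)
  case (pCons a r)
  have map: "map_poly of_int (pCons a r) = (pCons (of_int a) (map_poly of_int r) :: complex poly)"
    by (intro poly_eqI) (simp add: coeff_map_poly coeff_pCons split: nat.splits)
  show ?case
  proof (cases "a = 0")
    case True
    then have "poly (map_poly of_int r) x = 0" "lead_coeff r = 1"
      using pCons.prems x map by (auto split: if_splits)
    with pCons.IH obtain N y where "N \<noteq> 0" "\<bar>N\<bar> \<le> l1_norm r" "algebraic_int y" "x * y = of_int N"
      by blast
    then show ?thesis using True by auto
  next
    case False
    have "x * (- poly (map_poly of_int r) x) = of_int a"
      using pCons.prems(2) unfolding map by (simp add: add_eq_0_iff2)
    moreover have "algebraic_int (- poly (map_poly of_int r) x)"
      using algebraic_int_poly[OF x(1)] by auto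
    ultimately show ?thesis using False l1_norm_nonneg[of r]
      by (intro exI[of _ a] exI[of _ "- poly (map_poly of_int r) x"]) simp
  qed
qed auto

lemma algebraic_int_dvd_some_int:
  assumes "algebraic_int (x :: complex)" "x \<noteq> 0"
  shows "\<exists>N y. N \<noteq> 0 \<and> algebraic_int y \<and> x * y = of_int N"
proof -
  obtain q :: "int poly" where q: "poly (map_poly of_int q) x = 0" "lead_coeff q = 1"
    using assms(1) unfolding algebraic_int_altdef_ipoly by (elim exE conjE)
  from algebraic_int_dvd_int[OF assms q(2,1)] show ?thesis by (elim exE conjE) (intro exI conjI)
qed

text \<open>This is the combination with coefficients 1, -1, 0. An exponential bound on
  \<open>N\<close> means that only O(h) primes can fail to be prime to it.\<close>

lemma power_difference_dvd_int:
  fixes \<alpha> \<beta> :: complex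
  assumes "algebraic_int \<alpha>" "algebraic_int \<beta>"
  shows "\<exists>C\<ge>1. \<forall>h\<ge>1. \<alpha> ^ h \<noteq> \<beta> ^ h \<longrightarrow>
      (\<exists>N y. N \<noteq> 0 \<and> \<bar>N\<bar> \<le> C ^ h \<and> algebraic_int y \<and> (\<alpha> ^ h - \<beta> ^ h) * y = of_int N)"
proof -
  obtain C :: int where C: "C \<ge> 1" "\<forall>h\<ge>1. \<forall>r\<in>{-1,0,1}. \<forall>s\<in>{-1,0,1}. \<forall>t\<in>{-1,0,1}. \<exists>q. lead_coeff q = 1 \<and>
      poly (map_poly of_int q) (of_int r * \<alpha> ^ h + of_int s * \<beta> ^ h + of_int t * (\<alpha> ^ h * \<beta> ^ h)) = 0 \<and>
      l1_norm q \<le> C ^ h"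
    using two_algebraic_ints_combination[OF assms] by (elim exE conjE) (rule that)
  show ?thesis
  proof (rule exI[of _ C], intro conjI C(1) allI impI)
    fix h :: nat assume h: "h \<ge> 1" and ne: "\<alpha> ^ h \<noteq> \<beta> ^ h"
    from C(2)[rule_format, OF h, of 1 "-1" 0] obtain q where q: "lead_coeff q = 1"
      "poly (map_poly of_int q) (\<alpha> ^ h - \<beta> ^ h) = 0" "l1_norm q \<le> C ^ h" by auto
    have "algebraic_int (\<alpha> ^ h - \<beta> ^ h)" "\<alpha> ^ h - \<beta> ^ h \<noteq> 0"
      using assms ne by (auto intro: algebraic_int_diff algebraic_int_power)
    from algebraic_int_dvd_int[OF this q(1,2)] q(3)
    show "\<exists>N y. N \<noteq> 0 \<and> \<bar>N\<bar> \<le> C ^ h \<and> algebraic_int y \<and> (\<alpha> ^ h - \<beta> ^ h) * y = of_int N"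
      by (meson order_trans)
  qed
qed

section \<open>Exponential sums\<close>

text \<open>The field of algebraic numbers, described through integer denominators because the later
  congruences clear finitely many coefficients with one common integer.\<close>

definition alg_numbers :: "complex set" where
  "alg_numbers = {x. \<exists>N::int. N \<noteq> 0 \<and> algebraic_int (of_int N * x)}"

lemma alg_numbersI: "N \<noteq> 0 \<Longrightarrow> algebraic_int (of_int N * x) \<Longrightarrow> x \<in> alg_numbers"
  unfolding alg_numbers_def by blast

lemma algebraic_int_in_alg_numbers: "algebraic_int x \<Longrightarrow> x \<in> alg_numbers"
  by (rule alg_numbersI[of 1]) simp_all

lemma of_int_in_alg_numbers [simp]: "of_int m \<in> alg_numbers"
  by (simp add: algebraic_int_in_alg_numbers)

lemma of_nat_in_alg_numbers [simp]: "of_nat m \<in> alg_numbers"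
  by (simp add: algebraic_int_in_alg_numbers)

lemma zero_in_alg_numbers [simp]: "0 \<in> alg_numbers"
  by (simp add: algebraic_int_in_alg_numbers)

lemma one_in_alg_numbers [simp]: "1 \<in> alg_numbers"
  by (simp add: algebraic_int_in_alg_numbers)

lemma alg_numbers_mult: assumes "x \<in> alg_numbers" "y \<in> alg_numbers" shows "x * y \<in> alg_numbers"
proof -
  obtain M N :: int where M: "M \<noteq> 0" "algebraic_int (of_int M * x)" and N: "N \<noteq> 0" "algebraic_int (of_int N * y)"
    using assms unfolding alg_numbers_def by blast
  have "algebraic_int ((of_int M * x) * (of_int N * y))" using M N by (rule_tac algebraic_int_times)
  then show ?thesis using M(1) N(1) by (intro alg_numbersI[of "M * N"]) (simp_all add: mult_ac)
qed

lemma alg_numbers_add: assumes "x \<in> alg_numbers" "y \<in> alg_numbers" shows "x + y \<in> alg_numbers"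
proof -
  obtain M N :: int where M: "M \<noteq> 0" "algebraic_int (of_int M * x)" and N: "N \<noteq> 0" "algebraic_int (of_int N * y)"
    using assms unfolding alg_numbers_def by blast
  have "algebraic_int (of_int N * (of_int M * x) + of_int M * (of_int N * y))"
    by (intro M(2) N(2) algebraic_int_plus algebraic_int_times[OF algebraic_int_of_int])
  then show ?thesis using M(1) N(1) by (intro alg_numbersI[of "M * N"]) (simp_all add: algebra_simps)
qed

lemma alg_numbers_minus: "x \<in> alg_numbers \<Longrightarrow> - x \<in> alg_numbers"
  using alg_numbers_mult[OF of_int_in_alg_numbers[of "-1"]] by simp

lemma alg_numbers_diff: "x \<in> alg_numbers \<Longrightarrow> y \<in> alg_numbers \<Longrightarrow> x - y \<in> alg_numbers"
  using alg_numbers_add[of x "- y"] alg_numbers_minus[of y] by simp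

lemma alg_numbers_sum: "(\<And>i. i \<in> S \<Longrightarrow> f i \<in> alg_numbers) \<Longrightarrow> sum f S \<in> alg_numbers"
  by (induction S rule: infinite_finite_induct) (auto intro: alg_numbers_add)

text \<open>If \<open>N x\<close> is an algebraic integer and \<open>N x y = M\<close> with an
  integer \<open>M\<close>, then \<open>N y\<close> is the product of \<open>M\<close> and the
  inverse of \<open>x\<close>.\<close>

lemma alg_numbers_inverse: assumes "x \<in> alg_numbers" shows "inverse x \<in> alg_numbers"
proof (cases "x = 0")
  case False
  obtain N :: int where N: "N \<noteq> 0" "algebraic_int (of_int N * x)"
    using assms unfolding alg_numbers_def by blast
  then obtain M y where M: "M \<noteq> 0" "algebraic_int y" "(of_int N * x) * y = of_int M"
    using algebraic_int_dvd_some_int[OF N(2)] False by auto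
  have "of_int M * inverse x = of_int N * y" using M(3) False by (simp add: field_simps)
  moreover have "algebraic_int (of_int N * y)" using M(2) by (intro algebraic_int_times) simp_all
  ultimately show ?thesis using M(1) by (intro alg_numbersI[of M]) simp_all
qed simp

lemma alg_numbers_divide: "x \<in> alg_numbers \<Longrightarrow> y \<in> alg_numbers \<Longrightarrow> x / y \<in> alg_numbers"
  by (simp add: divide_inverse alg_numbers_mult alg_numbers_inverse)

lemma common_denominator:
  assumes "finite S" "S \<subseteq> alg_numbers"
  shows "\<exists>D::int. D \<noteq> 0 \<and> (\<forall>x\<in>S. algebraic_int (of_int D * x))"
  using assms
proof (induction S)
  case (insert x S)
  then obtain D :: int where D: "D \<noteq> 0" "\<forall>x\<in>S. algebraic_int (of_int D * x)" by auto
  obtain N :: int where N: "N \<noteq> 0" "algebraic_int (of_int N * x)"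
    using insert.prems unfolding alg_numbers_def by blast
  have "algebraic_int (of_int (N * D) * y)" if "y \<in> insert x S" for y
  proof (cases "y = x")
    case True
    then show ?thesis using algebraic_int_times[of "of_int D" "of_int N * x"] N by (simp add: mult_ac)
  next
    case False
    then show ?thesis using algebraic_int_times[of "of_int N" "of_int D * y"] D that by (simp add: mult_ac)
  qed
  then show ?case using D(1) N(1) by (intro exI[of _ "N * D"]) simp
qed (auto intro: exI[of _ 1])

section \<open>Polynomials in the shift operator E acting on sequences\<close>

definition shift_op :: "complex poly \<Rightarrow> (nat \<Rightarrow> complex) \<Rightarrow> nat \<Rightarrow> complex" where
  "shift_op p s n = (\<Sum>i\<le>degree p. coeff p i * s (n + i))"

lemma shift_op_altdef:
  assumes "degree p \<le> m"
  shows "shift_op p s n = (\<Sum>i\<le>m. coeff p i * s (n + i))"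
  unfolding shift_op_def using assms
  by (intro sum.mono_neutral_left) (auto simp: coeff_eq_0)

lemma shift_op_0 [simp]: "shift_op 0 s n = 0"
  by (simp add: shift_op_def)

lemma shift_op_pCons [simp]: "shift_op (pCons a p) s n = a * s n + shift_op p s (Suc n)"
proof -
  have "shift_op (pCons a p) s n = (\<Sum>i\<le>Suc (degree p). coeff (pCons a p) i * s (n + i))"
    by (rule shift_op_altdef) simp
  also have "\<dots> = a * s n + (\<Sum>i\<le>degree p. coeff p i * s (Suc n + i))"
    by (simp only: sum.atMost_Suc_shift coeff_pCons_0 coeff_pCons_Suc add_Suc_right add_Suc add_0_right)
  finally show ?thesis by (simp add: shift_op_def)
qed

lemma shift_op_add_poly: "shift_op (p + q) s n = shift_op p s n + shift_op q s n"
  by (induction p q arbitrary: n rule: poly_induct2) (simp_all add: algebra_simps)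

lemma shift_op_smult: "shift_op (Polynomial.smult c p) s n = c * shift_op p s n"
  by (induction p arbitrary: n) (simp_all add: algebra_simps)

lemma shift_op_mult: "shift_op (p * q) s n = shift_op p (shift_op q s) n"
  by (induction p arbitrary: n)
    (simp_all add: mult_pCons_left shift_op_add_poly shift_op_smult)

lemma shift_op_add: "shift_op p (\<lambda>n. s n + t n) n = shift_op p s n + shift_op p t n"
  by (induction p arbitrary: n) (simp_all add: algebra_simps)

lemma shift_op_zero_seq: "shift_op p (\<lambda>n. 0) n = 0"
  by (induction p arbitrary: n) simp_all

section \<open>Solving linear recurrences by exponential sums\<close>

definition expsum :: "complex set \<Rightarrow> (complex \<Rightarrow> complex poly) \<Rightarrow> nat \<Rightarrow> complex" where
  "expsum J P n = (\<Sum>\<alpha>\<in>J. poly (P \<alpha>) (of_nat n) * \<alpha> ^ n)"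

text \<open>The polynomial factor of (E - \<beta>) applied to P(n) \<alpha>^n, the power \<alpha>^n
  being split off.\<close>

definition twisted_diff :: "complex \<Rightarrow> complex \<Rightarrow> complex poly \<Rightarrow> complex poly" where
  "twisted_diff \<alpha> \<beta> P = Polynomial.smult \<alpha> (pcompose P [:1, 1:]) - Polynomial.smult \<beta> P"

lemma poly_twisted_diff:
  "poly (twisted_diff \<alpha> \<beta> P) x = \<alpha> * poly P (x + 1) - \<beta> * poly P x"
  by (simp add: twisted_diff_def poly_pcompose add.commute)

lemma twisted_diff_add: "twisted_diff \<alpha> \<beta> (P + Q) = twisted_diff \<alpha> \<beta> P + twisted_diff \<alpha> \<beta> Q"
  by (simp add: twisted_diff_def pcompose_add smult_add_right)

lemma coeff_twisted_diff_monom: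
  "coeff (twisted_diff \<alpha> \<beta> (monom c d)) i = c * (\<alpha> * of_nat (d choose i) - (if i = d then \<beta> else 0))"
proof -
  have "coeff ([:1, 1:] ^ d :: complex poly) i = of_nat (d choose i)"
  proof (cases "i \<le> d")
    case False
    then show ?thesis by (simp add: coeff_eq_0 degree_linear_power binomial_eq_0)
  qed (simp add: coeff_linear_poly_power)
  moreover have "pcompose (monom c d) [:1, 1:] = Polynomial.smult c ([:1, 1:] ^ d)"
  proof -
    have "pcompose (monom 1 d) [:1, 1:] = ([:1, 1:] ^ d :: complex poly)"
      by (induction d) (simp_all add: monom_Suc pcompose_pCons pcompose_1 monom_eq_1)
    then show ?thesis using pcompose_smult[of c "monom 1 d" "[:1, 1:]"] by (simp add: smult_monom)
  qed
  ultimately show ?thesis by (simp add: twisted_diff_def coeff_monom algebra_simps)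
qed

text \<open>The top coefficient is removed by the twisted difference of one monomial, and the rest
  by induction on the degree.\<close>

lemma twisted_diff_surj:
  assumes "\<alpha> \<in> alg_numbers" "\<beta> \<in> alg_numbers" "\<alpha> \<noteq> 0" "\<And>i. coeff P i \<in> alg_numbers"
  shows "\<exists>Q. (\<forall>i. coeff Q i \<in> alg_numbers) \<and> twisted_diff \<alpha> \<beta> Q = P"
proof -
  have "\<exists>Q. (\<forall>i. coeff Q i \<in> alg_numbers) \<and> twisted_diff \<alpha> \<beta> Q = P"
    if "\<forall>i\<ge>d. coeff P i = 0" "\<forall>i. coeff P i \<in> alg_numbers" for d P
    using that
  proof (induction d arbitrary: P)
    case 0
    then have "P = 0" by (simp add: poly_eq_iff)
    then show ?case by (intro exI[of _ 0]) (simp add: twisted_diff_def)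
  next
    case (Suc d)
    define c where "c = coeff P d"
    have c: "c \<in> alg_numbers" using Suc.prems by (simp add: c_def)
    \<comment> \<open>For \<alpha> \<noteq> \<beta> the degree is kept and the top coefficient is
      multiplied by \<alpha> - \<beta>. In the resonant case the degree drops by one, so the
      monomial has degree d + 1 and picks up the factor \<alpha> (d + 1).\<close>
    define Q where "Q = (if \<alpha> = \<beta> then monom (c / (\<alpha> * of_nat (Suc d))) (Suc d) else monom (c / (\<alpha> - \<beta>)) d)"
    have Q: "coeff Q i \<in> alg_numbers" for i
      using c assms by (auto simp: Q_def coeff_monom simp del: of_nat_Suc
          intro!: alg_numbers_divide alg_numbers_mult alg_numbers_diff)
    have top: "coeff (twisted_diff \<alpha> \<beta> Q) i = (if i = d then c else 0)" if "i \<ge> d" for i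
    proof (cases "i = d \<or> i = Suc d")
      case True
      then show ?thesis using assms(3)
        by (auto simp: Q_def coeff_twisted_diff_monom simp del: of_nat_Suc) (simp_all add: field_simps)
    next
      case False
      with that have "i > Suc d" by auto
      then show ?thesis using binomial_eq_0[of d i] binomial_eq_0[of "Suc d" i]
        by (simp add: Q_def coeff_twisted_diff_monom del: binomial_Suc_Suc)
    qed
    have TQ: "coeff (twisted_diff \<alpha> \<beta> Q) i \<in> alg_numbers" for i
      unfolding Q_def using c assms
      by (auto simp: coeff_twisted_diff_monom simp del: of_nat_Suc
          intro!: alg_numbers_divide alg_numbers_mult alg_numbers_diff)
    have "\<exists>R. (\<forall>i. coeff R i \<in> alg_numbers) \<and> twisted_diff \<alpha> \<beta> R = P - twisted_diff \<alpha> \<beta> Q"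
    proof (rule Suc.IH)
      show "\<forall>i\<ge>d. coeff (P - twisted_diff \<alpha> \<beta> Q) i = 0"
        using Suc.prems(1) top by (auto simp: c_def not_less_eq_eq le_Suc_eq)
      show "\<forall>i. coeff (P - twisted_diff \<alpha> \<beta> Q) i \<in> alg_numbers"
        using Suc.prems(2) TQ by (auto intro: alg_numbers_diff)
    qed
    then obtain R where "\<forall>i. coeff R i \<in> alg_numbers" "twisted_diff \<alpha> \<beta> R = P - twisted_diff \<alpha> \<beta> Q"
      by blast
    then show ?case using Q
      by (intro exI[of _ "R + Q"]) (auto simp: twisted_diff_add intro: alg_numbers_add)
  qed
  from this[of "Suc (degree P)" P] assms(4) show ?thesis
    by (auto simp: coeff_eq_0)
qed

lemma expsum_twisted_diff:
  "expsum J (\<lambda>\<alpha>. twisted_diff \<alpha> \<beta> (P \<alpha>)) n = expsum J P (Suc n) - \<beta> * expsum J P n"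
  by (simp add: expsum_def poly_twisted_diff sum_distrib_left algebra_simps flip: sum_subtractf)

text \<open>Split off a factor X - \<beta>. The sequence (E - \<beta>) s obeys the shorter
  recurrence and is an exponential sum, which twisted differences allow to be inverted term by term.
  What remains is a geometric sequence in \<beta>.\<close>

theorem linear_recurrence_imp_expsum:
  assumes "p \<noteq> 0" "\<And>z. poly p z = 0 \<Longrightarrow> z \<in> alg_numbers \<and> z \<noteq> 0"
    and "\<And>n. s n \<in> alg_numbers" "\<And>n. shift_op p s n = 0"
  shows "\<exists>J P. finite J \<and> (\<forall>\<alpha>\<in>J. \<alpha> \<noteq> 0 \<and> \<alpha> \<in> alg_numbers)
           \<and> (\<forall>\<alpha> i. coeff (P \<alpha>) i \<in> alg_numbers) \<and> (\<forall>n. s n = expsum J P n)"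
  using assms
proof (induction "degree p" arbitrary: p s)
  case 0
  then obtain c where c: "p = [:c:]" using degree_eq_zeroE by metis
  have "s n = 0" for n using "0.prems"(1) "0.prems"(4)[of n] c by simp
  then show ?case by (intro exI[of _ "{}"] exI[of _ "\<lambda>_. 0"]) (simp add: expsum_def)
next
  case (Suc d)
  obtain \<beta> where \<beta>: "poly p \<beta> = 0"
    using fundamental_theorem_of_algebra[of p] Suc.hyps(2) constant_degree[of p] by auto
  then obtain q where q: "p = [:-\<beta>, 1:] * q" unfolding poly_eq_0_iff_dvd by blast
  have q0: "q \<noteq> 0" using q Suc.prems(1) by auto
  have dq: "d = degree q" using Suc.hyps(2) q0 unfolding q by (subst (asm) degree_mult_eq) auto
  have \<beta>K: "\<beta> \<in> alg_numbers" "\<beta> \<noteq> 0" using Suc.prems(2)[OF \<beta>] by auto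
  define t where "t n = s (Suc n) - \<beta> * s n" for n
  have "shift_op q t n = 0" for n
  proof -
    have "t = shift_op [:-\<beta>, 1:] s" by (rule ext) (simp add: t_def)
    then show ?thesis using Suc.prems(4)[of n] unfolding q mult.commute[of _ q] shift_op_mult by simp
  qed
  moreover have "z \<in> alg_numbers \<and> z \<noteq> 0" if "poly q z = 0" for z
    using Suc.prems(2)[of z] that by (simp add: q)
  moreover have "t n \<in> alg_numbers" for n
    unfolding t_def using Suc.prems(3) \<beta>K by (intro alg_numbers_diff alg_numbers_mult)
  ultimately have "\<exists>J P. finite J \<and> (\<forall>\<alpha>\<in>J. \<alpha> \<noteq> 0 \<and> \<alpha> \<in> alg_numbers)
           \<and> (\<forall>\<alpha> i. coeff (P \<alpha>) i \<in> alg_numbers) \<and> (\<forall>n. t n = expsum J P n)"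
    by (intro Suc.hyps(1)[OF dq q0])
  then obtain J P where J: "finite J" "\<And>\<alpha>. \<alpha> \<in> J \<Longrightarrow> \<alpha> \<noteq> 0 \<and> \<alpha> \<in> alg_numbers"
    and P: "\<And>\<alpha> i. coeff (P \<alpha>) i \<in> alg_numbers" "\<And>n. t n = expsum J P n"
    by (elim exE conjE) blast
  \<comment> \<open>Even if \<beta> is not among the exponents of \<open>t\<close>, it is needed to
    absorb the geometric remainder; its polynomial starts as 0.\<close>
  define J' where "J' = insert \<beta> J"
  define P' where "P' \<alpha> = (if \<alpha> \<in> J then P \<alpha> else 0)" for \<alpha>
  have t': "t n = expsum J' P' n" for n
    unfolding P(2) expsum_def J'_def P'_def using J(1) by (intro sum.mono_neutral_cong_left) auto
  have "\<exists>Q. (\<forall>i. coeff Q i \<in> alg_numbers) \<and> (\<alpha> \<in> J' \<longrightarrow> twisted_diff \<alpha> \<beta> Q = P' \<alpha>)" for \<alpha>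
  proof (cases "\<alpha> \<in> J'")
    case True
    then have "\<alpha> \<in> alg_numbers" "\<alpha> \<noteq> 0" using J(2) \<beta>K by (auto simp: J'_def)
    moreover have "coeff (P' \<alpha>) i \<in> alg_numbers" for i using P(1) by (simp add: P'_def)
    ultimately have "\<exists>Q. (\<forall>i. coeff Q i \<in> alg_numbers) \<and> twisted_diff \<alpha> \<beta> Q = P' \<alpha>"
      using \<beta>K by (intro twisted_diff_surj)
    then obtain Q where "\<forall>i. coeff Q i \<in> alg_numbers" "twisted_diff \<alpha> \<beta> Q = P' \<alpha>" by blast
    then show ?thesis by (intro exI[of _ Q]) simp
  qed (auto intro: exI[of _ 0])
  then obtain Q where Q: "\<And>\<alpha> i. coeff (Q \<alpha>) i \<in> alg_numbers"
    "\<And>\<alpha>. \<alpha> \<in> J' \<Longrightarrow> twisted_diff \<alpha> \<beta> (Q \<alpha>) = P' \<alpha>" by metis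
  define r where "r n = s n - expsum J' Q n" for n
  have "expsum J' P' n = expsum J' (\<lambda>\<alpha>. twisted_diff \<alpha> \<beta> (Q \<alpha>)) n" for n
    unfolding expsum_def by (intro sum.cong) (simp_all add: Q(2))
  then have "r (Suc n) = \<beta> * r n" for n
    using t'[of n] by (simp add: r_def t_def expsum_twisted_diff algebra_simps)
  then have r: "r n = r 0 * \<beta> ^ n" for n by (induction n) simp_all
  have fJ': "finite J'" "\<beta> \<in> J'" using J by (auto simp: J'_def)
  have r0: "r 0 \<in> alg_numbers"
    unfolding r_def expsum_def using Suc.prems(3) Q(1)
    by (intro alg_numbers_diff alg_numbers_sum) (simp_all add: poly_0_coeff_0)
  define S where "S = Q(\<beta> := Q \<beta> + [:r 0:])"
  have "s n = expsum J' S n" for n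
  proof -
    have "expsum J' S n = expsum J' Q n + r 0 * \<beta> ^ n"
      unfolding expsum_def sum.remove[OF fJ'] by (simp add: S_def algebra_simps)
    moreover have "s n - expsum J' Q n = r 0 * \<beta> ^ n" using r[of n] by (simp only: r_def)
    ultimately show ?thesis by (simp add: diff_eq_eq add.commute)
  qed
  moreover have "coeff (S \<alpha>) i \<in> alg_numbers" for \<alpha> i
    using Q(1) r0 by (auto simp: S_def coeff_pCons intro!: alg_numbers_add split: nat.splits)
  moreover have "\<alpha> \<noteq> 0 \<and> \<alpha> \<in> alg_numbers" if "\<alpha> \<in> J'" for \<alpha>
    using J(2) \<beta>K that by (auto simp: J'_def)
  ultimately show ?case using fJ'(1) by (intro exI[of _ J'] exI[of _ S]) simp
qed

text \<open>Degree plus one, with 0 for the zero polynomial, so that turning a nonzero constant into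
  0 also counts as a decrease.\<close>

definition poly_size :: "complex poly \<Rightarrow> nat" where
  "poly_size P = (if P = 0 then 0 else Suc (degree P))"

lemma poly_size_eq_0 [simp]: "poly_size P = 0 \<longleftrightarrow> P = 0"
  by (simp add: poly_size_def)

lemma poly_size_le: "(\<And>i. i \<ge> n \<Longrightarrow> coeff P i = 0) \<Longrightarrow> poly_size P \<le> n"
  by (metis leading_coeff_0_iff not_less_eq_eq poly_size_def zero_le)

lemma coeff_shift_ge:
  assumes "degree P \<le> i"
  shows "coeff (pcompose P [:a, 1:]) i = (coeff P i :: complex)"
proof (cases "i = degree P")
  case True
  have "degree (pcompose P [:a, 1:]) = degree P" by (simp add: degree_pcompose)
  then show ?thesis using lead_coeff_comp[of "[:a, 1:]" P] True by simp
next
  case False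
  with assms have "degree P < i" by simp
  moreover have "degree (pcompose P [:a, 1:]) = degree P" by (simp add: degree_pcompose)
  ultimately show ?thesis by (simp add: coeff_eq_0)
qed

lemma coeff_twisted_diff_ge:
  "degree P \<le> i \<Longrightarrow> coeff (twisted_diff \<alpha> \<beta> P) i = (\<alpha> - \<beta>) * coeff P i"
  by (simp add: twisted_diff_def coeff_shift_ge algebra_simps)

lemma poly_size_twisted_diff_le: "poly_size (twisted_diff \<alpha> \<beta> P) \<le> poly_size P"
proof (cases "P = 0")
  case False
  then show ?thesis
    by (intro poly_size_le) (simp add: poly_size_def coeff_twisted_diff_ge coeff_eq_0)
qed (simp add: twisted_diff_def)

lemma poly_size_twisted_diff_same:
  assumes "P \<noteq> 0"
  shows "poly_size (twisted_diff \<alpha> \<alpha> P) < poly_size P"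
proof -
  have "poly_size (twisted_diff \<alpha> \<alpha> P) \<le> degree P"
    by (rule poly_size_le) (simp add: coeff_twisted_diff_ge)
  then show ?thesis using assms by (simp add: poly_size_def)
qed

lemma twisted_diff_eq_0:
  assumes "\<alpha> \<noteq> \<beta>" "twisted_diff \<alpha> \<beta> P = 0"
  shows "P = 0"
  using coeff_twisted_diff_ge[of P "degree P" \<alpha> \<beta>] assms by simp

text \<open>The hypothesis says P(n + 1) = P(n), so \<open>P\<close> takes one value infinitely
  often.\<close>

lemma twisted_diff_same_eq_0:
  assumes "\<alpha> \<noteq> 0" "twisted_diff \<alpha> \<alpha> P = 0"
  shows "P = [:poly P 0:]"
proof (rule ccontr)
  assume ne: "P \<noteq> [:poly P 0:]"
  have "poly P (of_nat n) = poly P 0" for n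
  proof (induction n)
    case (Suc n)
    have "poly (twisted_diff \<alpha> \<alpha> P) (of_nat n) = 0" by (simp add: assms)
    then have "poly P (of_nat n + 1) = poly P (of_nat n)"
      using assms(1) by (simp add: poly_twisted_diff)
    then show ?case using Suc by (simp add: add.commute)
  qed simp
  then have "range of_nat \<subseteq> {x. poly (P - [:poly P 0:]) x = 0}" by auto
  moreover have "finite {x. poly (P - [:poly P 0:]) x = 0}"
    using ne by (intro poly_roots_finite) simp
  ultimately have "finite (range (of_nat :: nat \<Rightarrow> complex))" by (rule finite_subset)
  then show False by (simp add: range_inj_infinite inj_of_nat)
qed

text \<open>Applying E - \<beta> with \<open>P \<beta> \<noteq> 0\<close> lowers the size of
  \<open>P \<beta>\<close> and raises no other, so by induction all twisted differences vanish. Away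
  from \<beta> this forces the polynomials to be 0; \<open>P \<beta>\<close> becomes a constant,
  whose value is read off at \<open>n0\<close>.\<close>

theorem expsum_eq_0_imp:
  assumes "finite J" "0 \<notin> J" "\<And>n. n \<ge> n0 \<Longrightarrow> expsum J P n = 0" "\<alpha> \<in> J"
  shows "P \<alpha> = 0"
  using assms(3,4)
proof (induction "\<Sum>\<alpha>\<in>J. poly_size (P \<alpha>)" arbitrary: P \<alpha> rule: less_induct)
  case less
  show ?case
  proof (cases "\<forall>\<beta>\<in>J. P \<beta> = 0")
    case False
    then obtain \<beta> where \<beta>: "\<beta> \<in> J" "P \<beta> \<noteq> 0" by blast
    define Q where "Q \<alpha> = twisted_diff \<alpha> \<beta> (P \<alpha>)" for \<alpha>
    have "(\<Sum>\<alpha>\<in>J. poly_size (Q \<alpha>)) < (\<Sum>\<alpha>\<in>J. poly_size (P \<alpha>))"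
      using assms(1) \<beta> by (intro sum_strict_mono_ex1 bexI[of _ \<beta>])
        (auto simp: Q_def poly_size_twisted_diff_le poly_size_twisted_diff_same)
    moreover have "expsum J Q n = 0" if "n \<ge> n0" for n
      using less.prems(1)[of n] less.prems(1)[of "Suc n"] that
      unfolding Q_def expsum_twisted_diff by simp
    ultimately have Q0: "Q \<gamma> = 0" if "\<gamma> \<in> J" for \<gamma>
      using less.hyps[of Q \<gamma>] that by blast
    have P0: "P \<gamma> = 0" if "\<gamma> \<in> J - {\<beta>}" for \<gamma>
      using twisted_diff_eq_0[of \<gamma> \<beta> "P \<gamma>"] Q0[of \<gamma>] that by (simp add: Q_def)
    have "expsum J P n0 = poly (P \<beta>) (of_nat n0) * \<beta> ^ n0"
      unfolding expsum_def sum.remove[OF assms(1) \<beta>(1)] using P0 by simp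
    moreover have "\<beta> \<noteq> 0" using assms(2) \<beta>(1) by auto
    ultimately have "poly (P \<beta>) (of_nat n0) = 0" using less.prems(1)[of n0] by simp
    moreover have const: "P \<beta> = [:poly (P \<beta>) 0:]"
      using Q0[OF \<beta>(1)] unfolding Q_def by (rule twisted_diff_same_eq_0[OF \<open>\<beta> \<noteq> 0\<close>])
    moreover have "poly (P \<beta>) (of_nat n0) = poly (P \<beta>) 0"
      by (subst const) simp
    ultimately have "P \<beta> = 0" by simp
    with \<beta>(2) show ?thesis by blast
  qed (use less.prems in blast)
qed

lemma expsum_shift:
  "expsum J P (n + i) = expsum J (\<lambda>\<alpha>. Polynomial.smult (\<alpha> ^ i) (pcompose (P \<alpha>) [:of_nat i, 1:])) n"
  unfolding expsum_def
  by (intro sum.cong refl) (simp add: poly_pcompose power_add algebra_simps)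

text \<open>Applying p(E) multiplies the leading coefficient of \<open>P \<alpha>\<close> by
  p(\<alpha>), and by uniqueness the result is 0. It serves for two recurrences of the same
  sequence: the integral one, which makes exponents algebraic integers, and the nondegenerate
  one.\<close>

lemma expsum_exponent_is_root:
  assumes J: "finite J" "0 \<notin> J" and "\<And>n. n \<ge> n0 \<Longrightarrow> shift_op p (expsum J P) n = 0"
    and "\<alpha> \<in> J" "P \<alpha> \<noteq> 0"
  shows "poly p \<alpha> = 0"
proof -
  define Q where "Q \<alpha> = (\<Sum>i\<le>degree p. Polynomial.smult (coeff p i * \<alpha> ^ i) (pcompose (P \<alpha>) [:of_nat i, 1:]))" for \<alpha>
  have "shift_op p (expsum J P) n = expsum J Q n" for n
  proof -
    have "shift_op p (expsum J P) n = (\<Sum>i\<le>degree p. \<Sum>\<alpha>\<in>J. coeff p i * (\<alpha> ^ i * poly (P \<alpha>) (of_nat i + of_nat n) * \<alpha> ^ n))"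
      unfolding shift_op_def expsum_shift by (simp add: expsum_def sum_distrib_left poly_pcompose)
    also have "\<dots> = expsum J Q n"
      unfolding expsum_def Q_def
      by (subst sum.swap) (simp add: poly_sum poly_pcompose sum_distrib_left sum_distrib_right mult_ac)
    finally show ?thesis .
  qed
  then have "Q \<alpha> = 0" using expsum_eq_0_imp[OF J, of n0 Q \<alpha>] assms(3,4) by simp
  then have "0 = coeff (Q \<alpha>) (degree (P \<alpha>))" by simp
  also have "\<dots> = (\<Sum>i\<le>degree p. coeff p i * \<alpha> ^ i) * lead_coeff (P \<alpha>)"
    by (simp add: Q_def coeff_sum coeff_shift_ge sum_distrib_right)
  also have "\<dots> = poly p \<alpha> * lead_coeff (P \<alpha>)" by (simp add: poly_altdef)
  finally show ?thesis using assms(5) by simp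
qed

text \<open>Each application of E - \<alpha> lowers the size of the polynomial factor.\<close>

lemma exp_monomial_annihilator:
  "\<exists>p. lead_coeff p = 1 \<and> (\<forall>n. shift_op p (\<lambda>n. poly Q (of_nat n) * \<alpha> ^ n) n = 0)"
proof (induction "poly_size Q" arbitrary: Q rule: less_induct)
  case less
  show ?case
  proof (cases "Q = 0")
    case True
    then show ?thesis by (intro exI[of _ 1]) (simp add: shift_op_zero_seq)
  next
    case False
    obtain p where p: "lead_coeff p = 1"
      "\<And>n. shift_op p (\<lambda>n. poly (twisted_diff \<alpha> \<alpha> Q) (of_nat n) * \<alpha> ^ n) n = 0"
      using less[OF poly_size_twisted_diff_same[OF False]] by blast
    have "shift_op [:-\<alpha>, 1:] (\<lambda>n. poly Q (of_nat n) * \<alpha> ^ n)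
        = (\<lambda>n. poly (twisted_diff \<alpha> \<alpha> Q) (of_nat n) * \<alpha> ^ n)"
      by (rule ext) (simp add: poly_twisted_diff algebra_simps)
    then have "shift_op (p * [:-\<alpha>, 1:]) (\<lambda>n. poly Q (of_nat n) * \<alpha> ^ n) n = 0" for n
      unfolding shift_op_mult using p(2) by simp
    moreover have "lead_coeff (p * [:-\<alpha>, 1:]) = 1"
      unfolding lead_coeff_mult p(1) by simp
    ultimately show ?thesis by blast
  qed
qed

lemma expsum_annihilator:
  assumes "finite J"
  shows "\<exists>p. lead_coeff p = 1 \<and> (\<forall>n. shift_op p (expsum J P) n = 0)"
  using assms
proof (induction J)
  case empty
  then show ?case by (intro exI[of _ 1]) (simp add: expsum_def shift_op_def)
next
  case (insert \<alpha> J)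
  obtain p where p: "lead_coeff p = 1" "\<And>n. shift_op p (expsum J P) n = 0" using insert by blast
  obtain q where q: "lead_coeff q = 1" "\<And>n. shift_op q (\<lambda>n. poly (P \<alpha>) (of_nat n) * \<alpha> ^ n) n = 0"
    using exp_monomial_annihilator by blast
  have p': "shift_op p (expsum J P) = (\<lambda>n. 0)" and q': "shift_op q (\<lambda>n. poly (P \<alpha>) (of_nat n) * \<alpha> ^ n) = (\<lambda>n. 0)"
    using p(2) q(2) by auto
  have "expsum (insert \<alpha> J) P = (\<lambda>n. poly (P \<alpha>) (of_nat n) * \<alpha> ^ n + expsum J P n)"
    by (rule ext) (simp add: expsum_def insert)
  moreover have "shift_op (p * q) (\<lambda>n. poly (P \<alpha>) (of_nat n) * \<alpha> ^ n) n = 0" for n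
    unfolding shift_op_mult q' by (rule shift_op_zero_seq)
  moreover have "shift_op (p * q) (expsum J P) n = 0" for n
    unfolding mult.commute[of p q] shift_op_mult p' by (rule shift_op_zero_seq)
  moreover have "lead_coeff (p * q) = 1"
    unfolding lead_coeff_mult p(1) q(1) by simp
  ultimately show ?case by (intro exI[of _ "p * q"]) (simp add: shift_op_add)
qed

section \<open>When the quotient of the sequence by its index is again a linear recurrence\<close>

lemma annihilator_imp_is_linear_recurrence:
  assumes "lead_coeff p = 1" "\<And>n. shift_op p w n = 0"
  shows "is_linear_recurrence w"
  unfolding is_linear_recurrence_def
proof (intro exI allI impI)
  fix n assume n: "n \<ge> degree p"
  define m where "m = degree p"
  have "0 = (\<Sum>i\<le>m. coeff p i * w (n - m + i))"
    using assms(2)[of "n - m"] by (simp add: shift_op_def m_def)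
  also have "\<dots> = w n + (\<Sum>i<m. coeff p i * w (n - m + i))"
    using assms(1) n by (simp add: m_def flip: lessThan_Suc_atMost)
  also have "(\<Sum>i<m. coeff p i * w (n - m + i)) = (\<Sum>i=1..m. coeff p (m - i) * w (n - i))"
    using n by (intro sum.reindex_bij_witness[of _ "\<lambda>i. m - i" "\<lambda>i. m - i"]) (auto simp: m_def)
  finally show "w n = (\<Sum>i=1..degree p. - coeff p (degree p - i) * w (n - i))"
    by (simp add: m_def sum_negf eq_neg_iff_add_eq_0)
qed

lemma expsum_is_linear_recurrence:
  assumes "finite J"
  shows "is_linear_recurrence (expsum J P)"
proof -
  obtain p where "lead_coeff p = 1" "\<forall>n. shift_op p (expsum J P) n = 0"
    using expsum_annihilator[OF assms] by blast
  then show ?thesis using annihilator_imp_is_linear_recurrence[of p] by blast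
qed

text \<open>Clearing the denominators \<open>n + l\<close> turns the recurrence for \<open>s n / n\<close> into the vanishing of
  an exponential sum, whose coefficients, evaluated at \<open>- (m + 1)\<close>, isolate the constant terms.\<close>

lemma quotient_recurrence_imp_constant_terms_0:
  assumes J: "finite J" "0 \<notin> J" "\<alpha> \<in> J"
    and rec: "is_linear_recurrence (\<lambda>j. expsum J P (j + 1) / of_nat (j + 1))"
  shows "poly (P \<alpha>) 0 = 0"
proof -
  define w where "w j = expsum J P (j + 1) / of_nat (j + 1)" for j
  obtain m c where c: "\<And>n. n \<ge> m \<Longrightarrow> w n = (\<Sum>i=1..m. c i * w (n - i))"
    using rec unfolding is_linear_recurrence_def w_def by blast
  define L where "L = {1..Suc m}"
  \<comment> \<open>The recurrence moved to one side and reindexed by l = m + 1 - i, so that term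
    \<open>l\<close> is, up to \<open>e l\<close>, the exponential sum at \<open>j + l\<close>
    divided by \<open>j + l\<close>.\<close>
  define e where "e l = (if l = Suc m then 1 else - c (Suc m - l))" for l
  have e_sum: "(\<Sum>l\<in>L. e l * w (j + l - 1)) = 0" for j
  proof -
    have "(\<Sum>l\<in>L. e l * w (j + l - 1)) = w (j + m) + (\<Sum>l=1..m. - (c (Suc m - l) * w (j + l - 1)))"
      by (simp add: L_def e_def)
    also have "(\<Sum>l=1..m. - (c (Suc m - l) * w (j + l - 1))) = (\<Sum>i=1..m. - (c i * w (j + m - i)))"
      by (intro sum.reindex_bij_witness[of _ "\<lambda>i. Suc m - i" "\<lambda>i. Suc m - i"]) auto
    finally show ?thesis using c[of "j + m"] by (simp add: sum_negf)
  qed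
  define Q where "Q \<alpha> = (\<Sum>l\<in>L. Polynomial.smult (e l * \<alpha> ^ l) (pcompose (P \<alpha>) [:of_nat l, 1:] * (\<Prod>l'\<in>L - {l}. [:of_nat l', 1:])))" for \<alpha>
  have "expsum J Q j = 0" for j
  proof -
    define D where "D = (\<Prod>l\<in>L. (of_nat (l + j) :: complex))"
    have "expsum J Q j = (\<Sum>l\<in>L. \<Sum>\<alpha>\<in>J. e l * \<alpha> ^ l * (poly (P \<alpha>) (of_nat l + of_nat j) * (\<Prod>l'\<in>L - {l}. of_nat l' + of_nat j)) * \<alpha> ^ j)"
      unfolding expsum_def Q_def
      by (subst sum.swap) (simp add: poly_sum poly_prod poly_pcompose sum_distrib_right)
    also have "\<dots> = (\<Sum>l\<in>L. D * (e l * w (j + l - 1)))"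
    proof (intro sum.cong refl)
      fix l assume l: "l \<in> L"
      then have l1: "l \<ge> 1" by (simp add: L_def)
      then have "w (j + l - 1) = expsum J P (j + l) / of_nat (l + j)"
        by (simp add: w_def add.commute)
      moreover have "D = of_nat (l + j) * (\<Prod>l'\<in>L - {l}. of_nat l' + of_nat j)"
        unfolding D_def using l by (subst prod.remove[of L l]) (auto simp: L_def)
      moreover have "(of_nat (l + j) :: complex) \<noteq> 0" using l1 by (simp del: of_nat_add)
      ultimately have "D * (e l * w (j + l - 1)) = e l * expsum J P (j + l) * (\<Prod>l'\<in>L - {l}. of_nat l' + of_nat j)"
        by simp
      also have "\<dots> = (\<Sum>\<alpha>\<in>J. e l * \<alpha> ^ l * (poly (P \<alpha>) (of_nat l + of_nat j) * (\<Prod>l'\<in>L - {l}. of_nat l' + of_nat j)) * \<alpha> ^ j)"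
        unfolding expsum_shift
        by (simp add: expsum_def sum_distrib_left sum_distrib_right poly_pcompose mult_ac)
      finally show "(\<Sum>\<alpha>\<in>J. e l * \<alpha> ^ l * (poly (P \<alpha>) (of_nat l + of_nat j) * (\<Prod>l'\<in>L - {l}. of_nat l' + of_nat j)) * \<alpha> ^ j) = D * (e l * w (j + l - 1))" ..
    qed
    also have "\<dots> = 0" using e_sum[of j] by (simp add: sum_distrib_left[symmetric])
    finally show ?thesis .
  qed
  then have "Q \<alpha> = 0" using expsum_eq_0_imp[OF J(1,2), of 0 Q \<alpha>] J(3) by simp
  \<comment> \<open>At -(m + 1) the factor with l' = m + 1 kills every term with l \<noteq> m + 1.
    In the surviving term the translation by m + 1 moves the argument of \<open>P \<alpha>\<close>
    to 0.\<close>
  then have "0 = poly (Q \<alpha>) (- of_nat (Suc m))" by simp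
  also have "\<dots> = (\<Sum>l\<in>L. e l * \<alpha> ^ l * (poly (P \<alpha>) (of_nat l - of_nat (Suc m)) * (\<Prod>l'\<in>L - {l}. of_nat l' - of_nat (Suc m))))"
    by (simp add: Q_def poly_sum poly_prod poly_pcompose del: of_nat_Suc)
  also have "\<dots> = (\<Sum>l\<in>L. if l = Suc m then \<alpha> ^ Suc m * (poly (P \<alpha>) 0 * (\<Prod>l'\<in>{1..m}. of_nat l' - of_nat (Suc m))) else 0)"
  proof (intro sum.cong refl)
    fix l assume l: "l \<in> L"
    have LS: "L - {Suc m} = {1..m}" by (auto simp: L_def)
    have "(\<Prod>l'\<in>L - {l}. of_nat l' - of_nat (Suc m) :: complex) = 0" if "l \<noteq> Suc m"
      using that by (intro prod_zero bexI[of _ "Suc m"]) (auto simp: L_def)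
    then show "e l * \<alpha> ^ l * (poly (P \<alpha>) (of_nat l - of_nat (Suc m)) * (\<Prod>l'\<in>L - {l}. of_nat l' - of_nat (Suc m)))
      = (if l = Suc m then \<alpha> ^ Suc m * (poly (P \<alpha>) 0 * (\<Prod>l'\<in>{1..m}. of_nat l' - of_nat (Suc m))) else 0)"
      by (cases "l = Suc m") (simp_all add: e_def LS del: of_nat_Suc power_Suc)
  qed
  also have "\<dots> = \<alpha> ^ Suc m * (poly (P \<alpha>) 0 * (\<Prod>l'\<in>{1..m}. of_nat l' - of_nat (Suc m)))"
    by (simp add: L_def)
  finally have "\<alpha> ^ Suc m * (poly (P \<alpha>) 0 * (\<Prod>l'\<in>{1..m}. of_nat l' - of_nat (Suc m))) = 0" ..
  moreover have "(\<Prod>l'\<in>{1..m}. of_nat l' - of_nat (Suc m) :: complex) \<noteq> 0"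
    by (auto simp: prod_zero_iff simp del: of_nat_Suc)
  moreover have "\<alpha> \<noteq> 0" using J by auto
  ultimately show ?thesis by simp
qed

lemma constant_terms_0_factor:
  assumes "\<And>\<alpha>. \<alpha> \<in> J \<Longrightarrow> poly (P \<alpha>) 0 = 0"
  shows "\<exists>R. (\<forall>n. expsum J P n = of_nat n * expsum J R n) \<and> (\<forall>\<alpha> i. coeff (R \<alpha>) i = coeff (P \<alpha>) (Suc i))"
proof -
  define R where "R \<alpha> = poly_shift 1 (P \<alpha>)" for \<alpha>
  have R: "coeff (R \<alpha>) i = coeff (P \<alpha>) (Suc i)" for \<alpha> i
    by (simp add: R_def coeff_poly_shift)
  have "P \<alpha> = pCons 0 (R \<alpha>)" if "\<alpha> \<in> J" for \<alpha>
    using assms[OF that] R by (intro poly_eqI) (simp add: coeff_pCons poly_0_coeff_0 split: nat.splits)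
  then have "expsum J P n = of_nat n * expsum J R n" for n
    by (simp add: expsum_def sum_distrib_left mult.assoc)
  with R show ?thesis by blast
qed

lemma constant_terms_0_imp_quotient_recurrence:
  assumes "finite J" "\<And>\<alpha>. \<alpha> \<in> J \<Longrightarrow> poly (P \<alpha>) 0 = 0"
  shows "is_linear_recurrence (\<lambda>j. expsum J P (j + 1) / of_nat (j + 1))"
proof -
  obtain R where R: "\<And>n. expsum J P n = of_nat n * expsum J R n"
    using constant_terms_0_factor[of J P] assms(2) by blast
  have "expsum J P (j + 1) / of_nat (j + 1)
      = expsum J (\<lambda>\<alpha>. Polynomial.smult (\<alpha> ^ 1) (pcompose (R \<alpha>) [:of_nat 1, 1:])) j" for j
    unfolding R expsum_shift[symmetric] by (simp del: of_nat_Suc)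
  then show ?thesis using expsum_is_linear_recurrence[OF assms(1)] by simp
qed

text \<open>With \<open>D\<close> a common denominator of the coefficients of \<open>R\<close>, the
  quotient of \<open>D * u n\<close> by \<open>n\<close> is an algebraic integer and rational, hence
  an integer.\<close>

lemma constant_terms_0_imp_finite:
  assumes J: "finite J" "\<And>\<alpha>. \<alpha> \<in> J \<Longrightarrow> algebraic_int \<alpha>"
    and P: "\<And>\<alpha> i. coeff (P \<alpha>) i \<in> alg_numbers" "\<And>\<alpha>. \<alpha> \<in> J \<Longrightarrow> poly (P \<alpha>) 0 = 0"
    and u: "\<And>n. of_int (u n) = expsum J P n"
  shows "finite {n::nat. n \<ge> 1 \<and> gcd (int n) (u n) = 1}"
proof -
  obtain R where R: "\<And>n. expsum J P n = of_nat n * expsum J R n"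
    "\<And>\<alpha> i. coeff (R \<alpha>) i = coeff (P \<alpha>) (Suc i)"
    using constant_terms_0_factor[of J P] P(2) by blast
  define S where "S = (\<Union>\<alpha>\<in>J. (\<lambda>i. coeff (R \<alpha>) i) ` {..degree (R \<alpha>)})"
  have "finite S" "S \<subseteq> alg_numbers" using J(1) P(1) R(2) by (auto simp: S_def)
  then obtain D :: int where D: "D \<noteq> 0" "\<And>x. x \<in> S \<Longrightarrow> algebraic_int (of_int D * x)"
    using common_denominator[of S] by blast
  have dvd: "int n dvd D * u n" if "n \<ge> 1" for n
  proof -
    have "of_int D * expsum J R n = (\<Sum>\<alpha>\<in>J. \<Sum>i\<le>degree (R \<alpha>). (of_int D * coeff (R \<alpha>) i) * of_nat n ^ i * \<alpha> ^ n)"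
      by (simp add: expsum_def poly_altdef sum_distrib_left sum_distrib_right mult.assoc)
    moreover have "algebraic_int \<dots>"
      by (intro algebraic_int_sum algebraic_int_times[OF algebraic_int_times[OF D(2)]] algebraic_int_power algebraic_int_of_nat J(2))
        (auto simp: S_def)
    ultimately have alg: "algebraic_int (of_int D * expsum J R n)" by simp
    have eq: "of_int D * expsum J R n = of_int (D * u n) / of_nat n"
      using that by (simp add: u R(1))
    then have "of_int D * expsum J R n \<in> \<rat>" by simp
    then have "of_int D * expsum J R n \<in> \<int>" using alg rational_algebraic_int_is_int by blast
    then obtain z where "of_int D * expsum J R n = of_int z" by (auto elim: Ints_cases)
    then have "of_int (D * u n) = (of_int (z * int n) :: complex)"
      using eq that by (simp add: field_simps)
    then have "D * u n = z * int n" by (simp only: of_int_eq_iff)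
    then show ?thesis by simp
  qed
  have "{n::nat. n \<ge> 1 \<and> gcd (int n) (u n) = 1} \<subseteq> {..nat \<bar>D\<bar>}"
  proof
    fix n assume "n \<in> {n::nat. n \<ge> 1 \<and> gcd (int n) (u n) = 1}"
    then have n: "n \<ge> 1" "coprime (int n) (u n)" by (auto simp: coprime_iff_gcd_eq_1)
    then have "int n dvd D" using dvd[of n] coprime_dvd_mult_left_iff by blast
    then have "int n \<le> \<bar>D\<bar>" using dvd_imp_le_int[OF D(1), of "int n"] by simp
    then show "n \<in> {..nat \<bar>D\<bar>}" by simp
  qed
  then show ?thesis by (rule finite_subset) simp
qed

section \<open>Zeros of power sums modulo a prime\<close>

definition dvd_alg :: "nat \<Rightarrow> complex \<Rightarrow> bool" where
  "dvd_alg p x \<longleftrightarrow> (\<exists>z. algebraic_int z \<and> x = of_nat p * z)"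

text \<open>The ring of algebraic integers modulo \<open>p\<close> has zero divisors, so
  cancellation rests on invertibility instead of nonvanishing.\<close>

definition unit_mod :: "nat \<Rightarrow> complex \<Rightarrow> bool" where
  "unit_mod p x \<longleftrightarrow> algebraic_int x \<and> (\<exists>y. algebraic_int y \<and> dvd_alg p (x * y - 1))"

lemma dvd_algI: "algebraic_int z \<Longrightarrow> x = of_nat p * z \<Longrightarrow> dvd_alg p x"
  unfolding dvd_alg_def by blast

lemma dvd_alg_0 [simp]: "dvd_alg p 0"
  by (rule dvd_algI[of 0]) simp_all

lemma dvd_alg_add: assumes "dvd_alg p x" "dvd_alg p y" shows "dvd_alg p (x + y)"
proof -
  obtain a b where "algebraic_int a" "x = of_nat p * a" "algebraic_int b" "y = of_nat p * b"
    using assms unfolding dvd_alg_def by blast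
  then show ?thesis by (intro dvd_algI[of "a + b"] algebraic_int_plus) (simp_all add: algebra_simps)
qed

lemma dvd_alg_mult_right: assumes "dvd_alg p x" "algebraic_int y" shows "dvd_alg p (x * y)"
proof -
  obtain a where "algebraic_int a" "x = of_nat p * a"
    using assms unfolding dvd_alg_def by blast
  then show ?thesis using assms(2) by (intro dvd_algI[of "a * y"] algebraic_int_times) simp_all
qed

lemma dvd_alg_mult_left: "dvd_alg p x \<Longrightarrow> algebraic_int y \<Longrightarrow> dvd_alg p (y * x)"
  using dvd_alg_mult_right[of p x y] by (simp add: mult.commute)

lemma dvd_alg_minus: "dvd_alg p x \<Longrightarrow> dvd_alg p (- x)"
  using dvd_alg_mult_right[of p x "-1"] by simp

lemma dvd_alg_diff: "dvd_alg p x \<Longrightarrow> dvd_alg p y \<Longrightarrow> dvd_alg p (x - y)"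
  using dvd_alg_add[of p x "- y"] dvd_alg_minus[of p y] by simp

lemma dvd_alg_sum: "(\<And>i. i \<in> S \<Longrightarrow> dvd_alg p (f i)) \<Longrightarrow> dvd_alg p (sum f S)"
  by (induction S rule: infinite_finite_induct) (auto intro: dvd_alg_add)

lemma not_dvd_alg_1:
  assumes "p > 1"
  shows "\<not> dvd_alg p 1"
proof
  assume "dvd_alg p 1"
  then obtain z :: complex where z: "algebraic_int z" "1 = of_nat p * z" unfolding dvd_alg_def by blast
  then have "z = 1 / of_nat p" using assms by (simp add: field_simps)
  then have "z \<in> \<rat>" by simp
  then have "z \<in> \<int>" using z(1) rational_algebraic_int_is_int by blast
  then obtain k where "z = of_int k" by (auto elim: Ints_cases)
  with z(2) have "(of_int 1 :: complex) = of_int (int p * k)" by simp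
  then have "1 = int p * k" by (simp only: of_int_eq_iff)
  then have "int p dvd 1" by (rule dvdI)
  then show False using assms by simp
qed

lemma unit_mod_cancel:
  assumes "unit_mod p x" "dvd_alg p (x * c)" "algebraic_int c"
  shows "dvd_alg p c"
proof -
  obtain y where y: "algebraic_int y" "dvd_alg p (x * y - 1)"
    using assms(1) unfolding unit_mod_def by blast
  have "dvd_alg p (y * (x * c) - (x * y - 1) * c)"
    by (rule dvd_alg_diff[OF dvd_alg_mult_left[OF assms(2) y(1)] dvd_alg_mult_right[OF y(2) assms(3)]])
  then show ?thesis by (simp add: algebra_simps)
qed

lemma unit_mod_mult:
  assumes "unit_mod p x" "unit_mod p x'"
  shows "unit_mod p (x * x')"
proof -
  obtain y where y: "algebraic_int x" "algebraic_int y" "dvd_alg p (x * y - 1)"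
    using assms(1) unfolding unit_mod_def by blast
  obtain y' where y': "algebraic_int x'" "algebraic_int y'" "dvd_alg p (x' * y' - 1)"
    using assms(2) unfolding unit_mod_def by blast
  have "dvd_alg p ((x * y - 1) * (x' * y') + (x' * y' - 1))"
    using y y' by (intro dvd_alg_add dvd_alg_mult_right algebraic_int_times)
  moreover have "(x * y - 1) * (x' * y') + (x' * y' - 1) = (x * x') * (y * y') - 1"
    by (simp add: algebra_simps)
  ultimately have "dvd_alg p ((x * x') * (y * y') - 1)" by simp
  moreover have "algebraic_int (x * x')" "algebraic_int (y * y')"
    using y y' by (simp_all add: algebraic_int_times)
  ultimately show ?thesis unfolding unit_mod_def by blast
qed

lemma unit_mod_1: "unit_mod p 1"
  unfolding unit_mod_def by (intro conjI exI[of _ 1]) simp_all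

lemma unit_mod_power: "unit_mod p x \<Longrightarrow> unit_mod p (x ^ n)"
  by (induction n) (simp_all add: unit_mod_1 unit_mod_mult)

lemma unit_mod_cong:
  assumes "unit_mod p x" "dvd_alg p (x - x')" "algebraic_int x'"
  shows "unit_mod p x'"
proof -
  obtain y where y: "algebraic_int y" "dvd_alg p (x * y - 1)"
    using assms(1) unfolding unit_mod_def by blast
  have "dvd_alg p ((x * y - 1) - (x - x') * y)"
    by (rule dvd_alg_diff[OF y(2) dvd_alg_mult_right[OF assms(2) y(1)]])
  then have "dvd_alg p (x' * y - 1)" by (simp add: algebra_simps)
  then show ?thesis using assms(3) y(1) unfolding unit_mod_def by blast
qed

text \<open>With \<open>a * N + b * int p = 1\<close> the inverse of \<open>x\<close> modulo
  \<open>p\<close> is \<open>a * y\<close>.\<close>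

lemma not_dvd_imp_unit_mod:
  assumes "prime p" "algebraic_int x" "algebraic_int y" "x * y = of_int N" "\<not> int p dvd N"
  shows "unit_mod p x"
proof -
  have "coprime N (int p)"
    using assms(1,5) prime_imp_coprime[of "int p" N] by (simp add: coprime_commute)
  then obtain a b where ab: "a * N + b * int p = 1"
    using bezout_int[of N "int p"] by auto
  have "x * (of_int a * y) - 1 = of_int (a * N - 1)"
    using assms(4) by (simp add: mult.left_commute)
  also have "a * N - 1 = int p * (- b)" using ab by (simp add: algebra_simps)
  finally have "dvd_alg p (x * (of_int a * y) - 1)"
    by (intro dvd_algI[of "of_int (- b)"]) simp_all
  moreover have "algebraic_int (of_int a * y)" using assms(3) by (simp add: algebraic_int_times)
  ultimately show ?thesis using assms(2) unfolding unit_mod_def by blast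
qed

lemma frobenius_dvd_alg:
  assumes "prime p" "algebraic_int x" "algebraic_int y"
  shows "dvd_alg p ((x + y) ^ p - (x ^ p + y ^ p))"
proof -
  let ?f = "\<lambda>k. of_nat (p choose k) * x ^ k * y ^ (p - k)"
  have p: "p > 0" using assms(1) prime_gt_0_nat by blast
  have "(x + y) ^ p = (\<Sum>k\<le>p. ?f k)" by (rule binomial_ring)
  also have "\<dots> = ?f 0 + ?f p + (\<Sum>k\<in>{..p} - {0, p}. ?f k)"
    using p sum.subset_diff[of "{0, p}" "{..p}" ?f] by (simp add: add.commute)
  finally have "(x + y) ^ p - (x ^ p + y ^ p) = (\<Sum>k\<in>{..p} - {0, p}. ?f k)"
    by simp
  moreover have "dvd_alg p (?f k)" if "k \<in> {..p} - {0, p}" for k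
  proof -
    have "p dvd (p choose k)" using that assms(1) by (intro dvd_choose_prime) auto
    then obtain q where "p choose k = p * q" by blast
    then have "dvd_alg p (of_nat (p choose k))" by (intro dvd_algI[of "of_nat q"]) simp_all
    then show ?thesis using assms by (intro dvd_alg_mult_right algebraic_int_power)
  qed
  ultimately show ?thesis by (simp only: dvd_alg_sum)
qed

text \<open>By Frobenius the new difference is congruent to the \<open>p\<close>-th power of the old
  one. The sum for \<open>u (p * m)\<close> has the bases \<alpha>^p, which vary with
  \<open>p\<close>; this brings the condition back to \<alpha> and \<beta>.\<close>

lemma unit_mod_power_diff_prime:
  assumes "prime p" "algebraic_int \<alpha>" "algebraic_int \<beta>" "unit_mod p (\<alpha> ^ h - \<beta> ^ h)"
  shows "unit_mod p ((\<alpha> ^ p) ^ h - (\<beta> ^ p) ^ h)"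
proof -
  have alg: "algebraic_int (\<alpha> ^ h)" "algebraic_int (\<beta> ^ h)"
    using assms by (simp_all add: algebraic_int_power)
  \<comment> \<open>Expanding \<alpha>^h as a sum avoids the sign of a \<open>p\<close>-th power of
    a negative, so \<open>p = 2\<close> needs no separate case.\<close>
  have "dvd_alg p (((\<alpha> ^ h - \<beta> ^ h) + \<beta> ^ h) ^ p - ((\<alpha> ^ h - \<beta> ^ h) ^ p + (\<beta> ^ h) ^ p))"
    using alg assms(1) by (intro frobenius_dvd_alg algebraic_int_diff)
  then have "dvd_alg p ((\<alpha> ^ h) ^ p - ((\<alpha> ^ h - \<beta> ^ h) ^ p + (\<beta> ^ h) ^ p))" by simp
  from dvd_alg_minus[OF this] have "dvd_alg p ((\<alpha> ^ h - \<beta> ^ h) ^ p - ((\<alpha> ^ p) ^ h - (\<beta> ^ p) ^ h))"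
    by (simp add: algebra_simps flip: power_mult) 
  then show ?thesis
    using assms by (intro unit_mod_cong[OF unit_mod_power[OF assms(4), of p]] algebraic_int_diff algebraic_int_power)
qed

section \<open>Counting zeros of a power sum by their pairwise distances\<close>

lemma card_strict_pairs:
  fixes S :: "nat set"
  assumes "finite S"
  shows "card S * card S = card S + 2 * card {(x, y). x \<in> S \<and> y \<in> S \<and> x < y}"
proof -
  let ?lt = "{(x, y). x \<in> S \<and> y \<in> S \<and> x < y}" and ?gt = "{(x, y). x \<in> S \<and> y \<in> S \<and> y < x}"
  have fin: "finite ?lt" "finite ?gt"
    by (rule finite_subset[of _ "S \<times> S"]; use assms in auto)+
  have gt: "card ?gt = card ?lt"
    by (rule bij_betw_same_card[of prod.swap]) (auto simp: bij_betw_def inj_on_def image_iff)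
  have diag: "card ((\<lambda>x. (x, x)) ` S) = card S"
    by (rule card_image) (auto simp: inj_on_def)
  have "S \<times> S = (\<lambda>x. (x, x)) ` S \<union> (?lt \<union> ?gt)" by auto
  then have "card (S \<times> S) = card ((\<lambda>x. (x, x)) ` S \<union> (?lt \<union> ?gt))" by (rule arg_cong)
  also have "\<dots> = card ((\<lambda>x. (x, x)) ` S) + card (?lt \<union> ?gt)"
    using fin assms by (intro card_Un_disjoint) auto
  also have "card (?lt \<union> ?gt) = card ?lt + card ?gt"
    using fin by (intro card_Un_disjoint) auto
  finally show ?thesis by (simp add: card_cartesian_product gt diag)
qed

text \<open>Two solutions at distance \<open>h\<close> give a solution of the shorter sum
  \<open>w (m + h) - \<beta> ^ h * w m\<close>, so the shorter sum bounds how often each distance occurs.\<close>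

lemma power_sum_zeros_in_window:
  fixes c r :: "'i \<Rightarrow> complex"
  assumes p: "p > 1" and L: "L \<ge> 1" and "finite J" "J \<noteq> {}"
    and "\<And>i. i \<in> J \<Longrightarrow> unit_mod p (c i)" "\<And>i. i \<in> J \<Longrightarrow> unit_mod p (r i)"
    and "\<And>i j h. i \<in> J \<Longrightarrow> j \<in> J \<Longrightarrow> i \<noteq> j \<Longrightarrow> h \<in> {1..L} \<Longrightarrow> unit_mod p (r i ^ h - r j ^ h)"
    and "S \<subseteq> {a..<a + L}" "\<And>m. m \<in> S \<Longrightarrow> dvd_alg p (\<Sum>i\<in>J. c i * r i ^ m)"
  shows "real (card S) \<le> 4 * real L powr (1 - 1 / 2 ^ (card J - 1))"
  using assms(3-)
proof (induction J arbitrary: c S rule: finite_ne_induct)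
  case (singleton j)
  \<comment> \<open>A single term is a product of units modulo \<open>p\<close> and has no zeros at
    all.\<close>
  have "S = {}"
  proof (rule ccontr)
    assume "S \<noteq> {}"
    then obtain m where "m \<in> S" by blast
    then have "dvd_alg p ((c j * r j ^ m) * 1)" using singleton.prems(5) by simp
    moreover have "unit_mod p (c j * r j ^ m)"
      using singleton.prems by (intro unit_mod_mult unit_mod_power) auto
    ultimately have "dvd_alg p 1" using unit_mod_cancel[of p "c j * r j ^ m" 1] by simp
    then show False using not_dvd_alg_1[OF p] by blast
  qed
  then show ?case by simp
next
  case (insert j J)
  define d where "d = card J"
  have d: "d \<ge> 1" using insert.hyps by (simp add: d_def card_gt_0_iff Suc_le_eq)
  have fS: "finite S" using insert.prems(4) finite_subset by blast
  \<comment> \<open>Left endpoints of the pairs in \<open>S\<close> at distance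
    \<open>h\<close>.\<close>
  define Sh where "Sh h = {x \<in> S. x + h \<in> S}" for h
  define T where "T = real L powr (1 - 1 / 2 ^ d)"
  have T1: "T \<ge> 1" unfolding T_def using L by (intro ge_one_powr_ge_zero) auto
  have Sh: "real (card (Sh h)) \<le> 4 * real L powr (1 - 1 / 2 ^ (d - 1))" if h: "h \<in> {1..L}" for h
    unfolding d_def
  proof (rule insert.IH[where c = "\<lambda>i. c i * (r i ^ h - r j ^ h)"])
    fix i assume i: "i \<in> J"
    then have "i \<noteq> j" using insert.hyps by blast
    then show "unit_mod p (c i * (r i ^ h - r j ^ h))"
      using i h insert.prems by (intro unit_mod_mult) auto
  next
    fix m assume "m \<in> Sh h"
    then have "dvd_alg p (\<Sum>i\<in>insert j J. c i * r i ^ (m + h))" "dvd_alg p (\<Sum>i\<in>insert j J. c i * r i ^ m)"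
      using insert.prems(5) by (auto simp: Sh_def)
    moreover have "algebraic_int (r j ^ h)"
      using insert.prems(2)[of j] unfolding unit_mod_def by (intro algebraic_int_power) simp
    ultimately have "dvd_alg p ((\<Sum>i\<in>insert j J. c i * r i ^ (m + h)) - r j ^ h * (\<Sum>i\<in>insert j J. c i * r i ^ m))"
      by (intro dvd_alg_diff dvd_alg_mult_left)
    also have "(\<Sum>i\<in>insert j J. c i * r i ^ (m + h)) - r j ^ h * (\<Sum>i\<in>insert j J. c i * r i ^ m)
       = (\<Sum>i\<in>insert j J. c i * (r i ^ h - r j ^ h) * r i ^ m)"
      unfolding sum_distrib_left sum_subtractf[symmetric]
      by (intro sum.cong refl) (simp add: power_add algebra_simps)
    also have "\<dots> = (\<Sum>i\<in>J. c i * (r i ^ h - r j ^ h) * r i ^ m)"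
      using insert.hyps by simp
    finally show "dvd_alg p (\<Sum>i\<in>J. c i * (r i ^ h - r j ^ h) * r i ^ m)" .
  qed (use insert.prems in \<open>auto simp: Sh_def\<close>)
  have "card {(x, y). x \<in> S \<and> y \<in> S \<and> x < y} \<le> card (Sigma {1..L} Sh)"
  proof (rule card_inj_on_le[of "\<lambda>(x, y). (y - x, x)"])
    show "inj_on (\<lambda>(x, y). (y - x, x)) {(x, y). x \<in> S \<and> y \<in> S \<and> x < y}"
      by (auto simp: inj_on_def)
    show "(\<lambda>(x, y). (y - x, x)) ` {(x, y). x \<in> S \<and> y \<in> S \<and> x < y} \<subseteq> Sigma {1..L} Sh"
    proof (rule image_subsetI)
      fix z assume "z \<in> {(x, y). x \<in> S \<and> y \<in> S \<and> x < y}"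
      then obtain x y where xy: "z = (x, y)" "x \<in> S" "y \<in> S" "x < y" by blast
      then have "x \<ge> a" "y < a + L" using insert.prems(4) by auto
      with xy show "(case z of (x, y) \<Rightarrow> (y - x, x)) \<in> Sigma {1..L} Sh" by (auto simp: Sh_def)
    qed
    show "finite (Sigma {1..L} Sh)" using fS by (auto simp: Sh_def)
  qed
  also have "card (Sigma {1..L} Sh) = (\<Sum>h\<in>{1..L}. card (Sh h))"
    using fS by (intro card_SigmaI) (auto simp: Sh_def)
  finally have "real (card {(x, y). x \<in> S \<and> y \<in> S \<and> x < y}) \<le> (\<Sum>h\<in>{1..L}. real (card (Sh h)))"
    by (simp only: of_nat_sum[symmetric] of_nat_le_iff)
  also have "\<dots> \<le> (\<Sum>h\<in>{1..L}. 4 * real L powr (1 - 1 / 2 ^ (d - 1)))"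
    by (intro sum_mono Sh)
  also have "\<dots> = 4 * (real L powr 1 * real L powr (1 - 1 / 2 ^ (d - 1)))" using L by simp
  \<comment> \<open>Summing over \<open>L\<close> distances adds 1 to the exponent, and half of 2 -
    1/2^(d-1) is 1 - 1/2^d: this is the halving of the saving.\<close>
  also have "real L powr 1 * real L powr (1 - 1 / 2 ^ (d - 1)) = T * T"
  proof -
    have "(2::real) ^ d = 2 * 2 ^ (d - 1)" using d by (cases d) simp_all
    then have "1 + (1 - 1 / 2 ^ (d - 1)) = (1 - 1 / 2 ^ d) + (1 - 1 / 2 ^ d :: real)"
      by (simp add: field_simps)
    then show ?thesis unfolding T_def by (simp only: powr_add[symmetric])
  qed
  finally have pairs: "real (card {(x, y). x \<in> S \<and> y \<in> S \<and> x < y}) \<le> 4 * (T * T)" .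
  have "real (card S * card S) = real (card S + 2 * card {(x, y). x \<in> S \<and> y \<in> S \<and> x < y})"
    by (simp only: card_strict_pairs[OF fS])
  with pairs have sq: "real (card S) * real (card S) \<le> real (card S) + 8 * (T * T)"
    by simp
  \<comment> \<open>The constant 4 reproduces itself: at most 4 T^2 pairs give s^2 \<le> s + 8 T^2,
    whereas s > 4 T \<ge> 4 would make s (s - 1) exceed 12 T^2.\<close>
  have "real (card S) \<le> 4 * T"
  proof (rule ccontr)
    assume "\<not> real (card S) \<le> 4 * T"
    then have gt: "real (card S) > 4 * T" by simp
    have "(real (card S) - 1) * real (card S) > (3 * T) * (4 * T)"
      using gt T1 by (intro mult_strict_mono) auto
    then have "real (card S) * real (card S) - real (card S) > 12 * (T * T)"
      by (simp add: algebra_simps)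
    moreover have "T * T \<ge> 0" using T1 by simp
    ultimately show False using sq by linarith
  qed
  then show ?case using insert.hyps by (simp add: T_def d_def)
qed

lemma algebraic_int_scaled_poly:
  assumes "\<And>i. algebraic_int (d * coeff Q i)" "algebraic_int x"
  shows "algebraic_int (d * poly Q (x :: complex))"
proof -
  have "d * poly Q x = (\<Sum>i\<le>degree Q. (d * coeff Q i) * x ^ i)"
    by (simp add: poly_altdef sum_distrib_left mult.assoc)
  also have "algebraic_int \<dots>"
    by (intro algebraic_int_sum algebraic_int_times[OF assms(1)] algebraic_int_power assms(2))
  finally show ?thesis .
qed

text \<open>A polynomial at \<open>p * m\<close> minus its value at 0 carries a factor
  \<open>p\<close>, once \<open>d\<close> has cleared the denominators; moreover \<alpha>^(pm) =
  (\<alpha>^p)^m.\<close>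

lemma expsum_at_prime_multiple:
  assumes J: "finite J" "\<And>\<alpha>. \<alpha> \<in> J \<Longrightarrow> algebraic_int \<alpha>"
    and D: "\<And>\<alpha> i. \<alpha> \<in> J \<Longrightarrow> algebraic_int (d * coeff (P \<alpha>) i)"
  shows "dvd_alg p (d * expsum J P (p * m) - (\<Sum>\<alpha>\<in>J. (d * poly (P \<alpha>) 0) * (\<alpha> ^ p) ^ m))"
proof -
  have "d * expsum J P (p * m) - (\<Sum>\<alpha>\<in>J. (d * poly (P \<alpha>) 0) * (\<alpha> ^ p) ^ m)
      = (\<Sum>\<alpha>\<in>J. (d * poly (P \<alpha>) (of_nat (p * m)) - d * poly (P \<alpha>) 0) * (\<alpha> ^ p) ^ m)"
    unfolding expsum_def sum_distrib_left sum_subtractf[symmetric] power_mult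
    by (intro sum.cong refl) (simp only: algebra_simps)
  moreover have "dvd_alg p ((d * poly (P \<alpha>) (of_nat (p * m)) - d * poly (P \<alpha>) 0) * (\<alpha> ^ p) ^ m)" if "\<alpha> \<in> J" for \<alpha>
  proof -
    define R where "R = poly_shift 1 (P \<alpha>)"
    have R: "coeff R i = coeff (P \<alpha>) (Suc i)" for i by (simp add: R_def coeff_poly_shift)
    have "P \<alpha> = pCons (poly (P \<alpha>) 0) R"
      using R by (intro poly_eqI) (simp add: coeff_pCons poly_0_coeff_0 split: nat.splits)
    then have "poly (P \<alpha>) (of_nat (p * m)) = poly (pCons (poly (P \<alpha>) 0) R) (of_nat (p * m))"
      by (rule arg_cong)
    then have eq: "d * poly (P \<alpha>) (of_nat (p * m)) - d * poly (P \<alpha>) 0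
        = of_nat p * (of_nat m * (d * poly R (of_nat (p * m))))"
      by (simp add: algebra_simps)
    have "algebraic_int (of_nat m * (d * poly R (of_nat (p * m))))"
      by (intro algebraic_int_times[OF algebraic_int_of_nat] algebraic_int_scaled_poly algebraic_int_of_nat)
        (simp add: D[OF that] R del: of_nat_mult)
    then have "dvd_alg p (d * poly (P \<alpha>) (of_nat (p * m)) - d * poly (P \<alpha>) 0)"
      using eq by (rule dvd_algI)
    then show ?thesis
      by (intro dvd_alg_mult_right algebraic_int_power J(2) that)
  qed
  ultimately show ?thesis by (simp only: dvd_alg_sum)
qed

text \<open>\<open>N h\<close> collects integer multiples of all exponents, all nonzero constant
  terms and all differences of \<open>h\<close>-th powers. If \<open>p\<close> divides none of them
  up to \<open>L\<close>, everything the zero count requires is invertible.\<close>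

theorem expsum_mod_prime_window_bound:
  assumes J: "finite J" "\<And>\<alpha>. \<alpha> \<in> J \<Longrightarrow> algebraic_int \<alpha> \<and> \<alpha> \<noteq> 0"
    and nondeg: "\<And>\<alpha> \<beta> h. \<alpha> \<in> J \<Longrightarrow> \<beta> \<in> J \<Longrightarrow> \<alpha> \<noteq> \<beta> \<Longrightarrow> h \<ge> 1 \<Longrightarrow> \<alpha> ^ h \<noteq> \<beta> ^ h"
    and P: "\<And>\<alpha> i. coeff (P \<alpha>) i \<in> alg_numbers"
    and u: "\<And>n. of_int (u n) = expsum J P n"
    and \<alpha>0: "\<alpha>0 \<in> J" "poly (P \<alpha>0) 0 \<noteq> 0"
  shows "\<exists>(N :: nat \<Rightarrow> int) (C :: int) (\<delta> :: real).
           (\<forall>h\<ge>1. N h \<noteq> 0 \<and> \<bar>N h\<bar> \<le> C ^ h) \<and> 0 < \<delta> \<and> \<delta> \<le> 1 \<and>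
           (\<forall>p L a. prime p \<longrightarrow> L \<ge> 1 \<longrightarrow> (\<forall>h\<in>{1..L}. \<not> int p dvd N h) \<longrightarrow>
              real (card {m\<in>{a..<a + L}. int p dvd u (p * m)}) \<le> 4 * real L powr (1 - \<delta>))"
proof -
  define S where "S = (\<Union>\<alpha>\<in>J. (\<lambda>i. coeff (P \<alpha>) i) ` {..degree (P \<alpha>)})"
  have "finite S" "S \<subseteq> alg_numbers" using J(1) P by (auto simp: S_def)
  then obtain D :: int where D: "D \<noteq> 0" "\<And>x. x \<in> S \<Longrightarrow> algebraic_int (of_int D * x)"
    using common_denominator[of S] by blast
  have Dc: "algebraic_int (of_int D * coeff (P \<alpha>) i)" if "\<alpha> \<in> J" for \<alpha> i
  proof (cases "i \<le> degree (P \<alpha>)")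
    case True
    then show ?thesis using D(2) that by (auto simp: S_def)
  qed (simp add: coeff_eq_0)
  define c where "c \<alpha> = of_int D * poly (P \<alpha>) 0" for \<alpha>
  \<comment> \<open>Exponents whose constant term is 0 drop out modulo \<open>p\<close>, and the
    remaining coefficients must be units; \<alpha>0 keeps the set nonempty.\<close>
  define I where "I = {\<alpha>\<in>J. c \<alpha> \<noteq> 0}"
  have I: "finite I" "I \<noteq> {}" "I \<subseteq> J"
    using J(1) \<alpha>0 D(1) by (auto simp: I_def c_def)
  have c_alg: "algebraic_int (c \<alpha>)" if "\<alpha> \<in> J" for \<alpha>
    unfolding c_def poly_0_coeff_0 by (rule Dc[OF that])
  \<comment> \<open>A multiple of the product \<alpha> c(\<alpha>) serves both factors: each is a
    unit modulo \<open>p\<close> once \<open>p\<close> does not divide \<open>M\<close>.\<close>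
  have "\<exists>M y. M \<noteq> 0 \<and> algebraic_int y \<and> \<alpha> * c \<alpha> * y = of_int M" if "\<alpha> \<in> I" for \<alpha>
    using that I(3) J(2)[of \<alpha>] c_alg[of \<alpha>] algebraic_int_dvd_some_int[of "\<alpha> * c \<alpha>"]
    by (auto simp: I_def algebraic_int_times)
  then obtain M y where M: "\<And>\<alpha>. \<alpha> \<in> I \<Longrightarrow> M \<alpha> \<noteq> 0 \<and> algebraic_int (y \<alpha>) \<and> \<alpha> * c \<alpha> * y \<alpha> = of_int (M \<alpha>)"
    by metis
  define I2 where "I2 = {(\<alpha>, \<beta>). \<alpha> \<in> I \<and> \<beta> \<in> I \<and> \<alpha> \<noteq> \<beta>}"
  have fI2: "finite I2"
    by (rule finite_subset[of _ "I \<times> I"]) (use I in \<open>auto simp: I2_def\<close>)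
  have "\<exists>K\<ge>1. \<forall>h\<ge>1. \<exists>B y. B \<noteq> 0 \<and> \<bar>B\<bar> \<le> K ^ h \<and> algebraic_int y \<and> (fst x ^ h - snd x ^ h) * y = of_int B"
    if "x \<in> I2" for x
  proof -
    from that have x: "fst x \<in> J" "snd x \<in> J" "fst x \<noteq> snd x" using I(3) by (auto simp: I2_def)
    obtain K where "K \<ge> 1" and K: "\<forall>h\<ge>1. fst x ^ h \<noteq> snd x ^ h \<longrightarrow>
      (\<exists>N y. N \<noteq> 0 \<and> \<bar>N\<bar> \<le> K ^ h \<and> algebraic_int y \<and> (fst x ^ h - snd x ^ h) * y = of_int N)"
      using power_difference_dvd_int[of "fst x" "snd x"] J(2)[OF x(1)] J(2)[OF x(2)] by blast
    then show ?thesis using nondeg[OF x] by (intro exI[of _ K]) blast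
  qed
  then have "\<forall>x\<in>I2. \<exists>K. K \<ge> 1 \<and> (\<forall>h\<ge>1. \<exists>B y. B \<noteq> 0 \<and> \<bar>B\<bar> \<le> K ^ h
      \<and> algebraic_int y \<and> (fst x ^ h - snd x ^ h) * y = of_int B)" by (rule ballI)
  from bchoice[OF this] obtain K where K: "\<forall>x\<in>I2. K x \<ge> 1 \<and> (\<forall>h\<ge>1. \<exists>B y. B \<noteq> 0 \<and> \<bar>B\<bar> \<le> K x ^ h
      \<and> algebraic_int y \<and> (fst x ^ h - snd x ^ h) * y = of_int B)" by (elim exE)
  then have "\<forall>x h. \<exists>B y. x \<in> I2 \<longrightarrow> h \<ge> 1 \<longrightarrow> B \<noteq> 0 \<and> \<bar>B\<bar> \<le> K x ^ h
      \<and> algebraic_int y \<and> (fst x ^ h - snd x ^ h) * y = of_int B" by blast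
  then obtain B z where Bz: "\<forall>x h. x \<in> I2 \<longrightarrow> h \<ge> 1 \<longrightarrow> B x h \<noteq> 0 \<and> \<bar>B x h\<bar> \<le> K x ^ h
      \<and> algebraic_int (z x h) \<and> (fst x ^ h - snd x ^ h) * z x h = of_int (B x h)"
    unfolding choice_iff by (elim exE)
  note B = Bz[rule_format]
  define M0 where "M0 = (\<Prod>\<alpha>\<in>I. M \<alpha>)"
  \<comment> \<open>The factor \<open>M0\<close> is repeated for every \<open>h\<close>, so that
    goodness at \<open>h = 1\<close> already makes exponents and coefficients units.\<close>
  define N where "N h = M0 * (\<Prod>x\<in>I2. B x h)" for h
  define C where "C = \<bar>M0\<bar> * (\<Prod>x\<in>I2. K x)"
  have M0: "M0 \<noteq> 0" using M I(1) by (auto simp: M0_def)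
  have N: "N h \<noteq> 0 \<and> \<bar>N h\<bar> \<le> C ^ h" if h: "h \<ge> 1" for h
  proof
    show "N h \<noteq> 0" using M0 B[OF _ h] fI2 by (auto simp: N_def)
    have "\<bar>M0\<bar> \<le> \<bar>M0\<bar> ^ h" using M0 h by (intro self_le_power) auto
    moreover have "(\<Prod>x\<in>I2. \<bar>B x h\<bar>) \<le> (\<Prod>x\<in>I2. K x ^ h)"
      using B[OF _ h] by (intro prod_mono) auto
    ultimately have "\<bar>M0\<bar> * (\<Prod>x\<in>I2. \<bar>B x h\<bar>) \<le> \<bar>M0\<bar> ^ h * (\<Prod>x\<in>I2. K x ^ h)"
      by (intro mult_mono prod_nonneg) auto
    then show "\<bar>N h\<bar> \<le> C ^ h"
      by (simp add: N_def C_def abs_mult abs_prod power_mult_distrib prod_power_distrib)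
  qed
  define \<delta> where "\<delta> = (1::real) / 2 ^ (card I - 1)"
  have \<delta>: "0 < \<delta>" "\<delta> \<le> 1" by (simp_all add: \<delta>_def)
  have window: "real (card {m\<in>{a..<a + L}. int p dvd u (p * m)}) \<le> 4 * real L powr (1 - \<delta>)"
    if p: "prime p" and L: "L \<ge> 1" and good: "\<forall>h\<in>{1..L}. \<not> int p dvd N h" for p L a
  proof -
    have pM: "\<not> int p dvd M \<alpha>" if "\<alpha> \<in> I" for \<alpha>
    proof
      assume "int p dvd M \<alpha>"
      then have "int p dvd M0" unfolding M0_def using I(1) that by (meson dvd_prodI dvd_trans)
      then have "int p dvd N 1" by (simp add: N_def)
      then show False using good L by auto
    qed
    have unit: "unit_mod p \<alpha>" "unit_mod p (c \<alpha>)" if "\<alpha> \<in> I" for \<alpha>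
    proof -
      have alg: "algebraic_int \<alpha>" "algebraic_int (c \<alpha>)" "algebraic_int (y \<alpha>)"
        using that I(3) J(2) c_alg M by auto
      show "unit_mod p \<alpha>"
        using not_dvd_imp_unit_mod[OF p alg(1) algebraic_int_times[OF alg(2,3)] _ pM[OF that]] M[OF that]
        by (simp add: mult.assoc)
      show "unit_mod p (c \<alpha>)"
        using not_dvd_imp_unit_mod[OF p alg(2) algebraic_int_times[OF alg(1,3)] _ pM[OF that]] M[OF that]
        by (simp add: mult_ac)
    qed
    have diff: "unit_mod p ((\<alpha> ^ p) ^ h - (\<beta> ^ p) ^ h)"
      if x: "\<alpha> \<in> I" "\<beta> \<in> I" "\<alpha> \<noteq> \<beta>" and h: "h \<in> {1..L}" for \<alpha> \<beta> h
    proof -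
      have I2: "(\<alpha>, \<beta>) \<in> I2" and h1: "h \<ge> 1" using x h by (auto simp: I2_def)
      have alg: "algebraic_int \<alpha>" "algebraic_int \<beta>" using x I(3) J(2) by auto
      have "\<not> int p dvd B (\<alpha>, \<beta>) h"
      proof
        assume "int p dvd B (\<alpha>, \<beta>) h"
        then have "int p dvd (\<Prod>x\<in>I2. B x h)" using fI2 I2 by (meson dvd_prodI dvd_trans)
        then have "int p dvd N h" by (simp add: N_def)
        then show False using good h by auto
      qed
      then have "unit_mod p (\<alpha> ^ h - \<beta> ^ h)"
        using B[OF I2 h1] alg
        by (intro not_dvd_imp_unit_mod[OF p, of _ "z (\<alpha>, \<beta>) h"])
          (simp_all add: algebraic_int_diff algebraic_int_power)
      then show ?thesis by (intro unit_mod_power_diff_prime p alg)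
    qed
    have zero: "dvd_alg p (\<Sum>\<alpha>\<in>I. c \<alpha> * (\<alpha> ^ p) ^ m)" if "int p dvd u (p * m)" for m
    proof -
      from that obtain k where "u (p * m) = int p * k" by blast
      then have "of_int D * expsum J P (p * m) = of_nat p * of_int (D * k)"
        using u[of "p * m"] by simp
      then have 1: "dvd_alg p (of_int D * expsum J P (p * m))"
        by (rule dvd_algI[rotated]) (rule algebraic_int_of_int)
      have 2: "dvd_alg p (of_int D * expsum J P (p * m) - (\<Sum>\<alpha>\<in>J. c \<alpha> * (\<alpha> ^ p) ^ m))"
        unfolding c_def using J Dc by (intro expsum_at_prime_multiple) auto
      have "dvd_alg p (\<Sum>\<alpha>\<in>J. c \<alpha> * (\<alpha> ^ p) ^ m)"
        using dvd_alg_diff[OF 1 2] by simp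
      also have "(\<Sum>\<alpha>\<in>J. c \<alpha> * (\<alpha> ^ p) ^ m) = (\<Sum>\<alpha>\<in>I. c \<alpha> * (\<alpha> ^ p) ^ m)"
        using J(1) by (intro sum.mono_neutral_right) (auto simp: I_def)
      finally show ?thesis .
    qed
    show ?thesis
      unfolding \<delta>_def
      by (rule power_sum_zeros_in_window[where c = c and r = "\<lambda>\<alpha>. \<alpha> ^ p" and J = I and p = p and a = a])
        (use prime_gt_1_nat[OF p] L I unit diff zero in \<open>auto intro: unit_mod_power\<close>)
  qed
  show ?thesis
    by (rule exI[of _ N], rule exI[of _ C], rule exI[of _ \<delta>],
        intro conjI allI impI N[THEN conjunct1] N[THEN conjunct2] \<delta> window)
qed

section \<open>Prime counting\<close>

definition prime_count :: "nat \<Rightarrow> nat" where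
  "prime_count n = card {p. prime p \<and> p \<le> n}"

lemma finite_primes_le [simp]: "finite {p::nat. prime p \<and> p \<le> n}"
  by (rule finite_subset[of _ "{..n}"]) auto

lemma prime_count_le: "prime_count n \<le> n"
proof -
  have "prime_count n \<le> card {1..n}"
    unfolding prime_count_def by (rule card_mono) (auto simp: Suc_le_eq prime_gt_0_nat)
  then show ?thesis by simp
qed

lemma prime_count_Suc: "prime_count (Suc n) = prime_count n + (if prime (Suc n) then 1 else 0)"
proof -
  have "{p. prime p \<and> p \<le> Suc n} = {p. prime p \<and> p \<le> n} \<union> (if prime (Suc n) then {Suc n} else {})"
    by (auto simp: le_Suc_eq)
  then show ?thesis by (simp add: prime_count_def)
qed

lemma prod_primes_dvd:
  assumes "finite R" "\<And>p. p \<in> R \<Longrightarrow> prime p" "\<And>p. p \<in> R \<Longrightarrow> p dvd (n::nat)"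
  shows "\<Prod>R dvd n"
  using assms
proof (induction R)
  case (insert p R)
  have "coprime p (\<Prod>R)"
    using insert by (intro prod_coprime_right) (auto intro!: primes_coprime)
  then show ?case using insert by (simp add: divides_mult)
qed simp

text \<open>Every prime in \<open>(n, 2 n]\<close> divides the binomial coefficient \<open>2 n choose n\<close>.\<close>

lemma prime_count_double:
  assumes "n \<ge> 2 ^ K"
  shows "K * prime_count (2 * n) \<le> K * prime_count n + 2 * n"
proof -
  define R where "R = {p. prime p \<and> n < p \<and> p \<le> 2 * n}"
  have fin: "finite R" by (rule finite_subset[of _ "{..2 * n}"]) (auto simp: R_def)
  have "prime_count (2 * n) = prime_count n + card R"
  proof -
    have "{p. prime p \<and> p \<le> 2 * n} = {p. prime p \<and> p \<le> n} \<union> R" by (auto simp: R_def)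
    then show ?thesis unfolding prime_count_def using fin
      by (simp add: card_Un_disjoint R_def disjoint_iff)
  qed
  moreover have "K * card R \<le> 2 * n"
  proof -
    have n: "n \<ge> 1" using assms by (metis le_trans one_le_numeral one_le_power)
    have "(\<Prod>p\<in>R. p) dvd (2 * n choose n)"
    proof (rule prod_primes_dvd[OF fin])
      fix p assume p: "p \<in> R"
      have "p dvd fact (2 * n)" using p by (simp add: R_def prime_dvd_fact_iff)
      also have "fact (2 * n) = fact n * fact n * (2 * n choose n)"
        using binomial_fact_lemma[of n "2 * n"] by simp
      finally have "p dvd fact n * fact n * (2 * n choose n)" .
      then show "p dvd (2 * n choose n)"
        using p by (auto simp: R_def prime_dvd_mult_iff prime_dvd_fact_iff)
    qed (auto simp: R_def)
    then have "(\<Prod>p\<in>R. p) \<le> (2 * n choose n)"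
      by (rule dvd_imp_le) simp
    also have "\<dots> \<le> 2 ^ (2 * n)" by (rule binomial_le_pow2)
    finally have "(\<Prod>p\<in>R. p) \<le> 2 ^ (2 * n)" .
    \<comment> \<open>All primes in \<open>R\<close> exceed n \<ge> 2^K; \<open>K\<close> is an
      integer substitute for the binary logarithm of \<open>n\<close>.\<close>
    moreover have "(\<Prod>p\<in>R. 2 ^ K) \<le> (\<Prod>p\<in>R. p)"
      using assms by (intro prod_mono) (auto simp: R_def)
    ultimately have "(2::nat) ^ (K * card R) \<le> 2 ^ (2 * n)"
      by (simp add: power_mult)
    then show ?thesis by (rule power_le_imp_le_exp[rotated]) simp
  qed
  ultimately show ?thesis by (simp add: algebra_simps)
qed

text \<open>Halve \<open>n\<close> and use the doubling estimate. With \<open>m = n div 2\<close>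
  and \<open>K \<le> m\<close> the increments add up to 3m + 2m + m = 6m \<le> 3n, which is where
  the constant 3 closes the induction.\<close>

lemma prime_count_linear_bound:
  assumes "K \<ge> 1"
  shows "K * prime_count n \<le> K * 2 ^ (K + 1) + 3 * n"
proof (induction n rule: less_induct)
  case (less n)
  show ?case
  proof (cases "n < 2 ^ (K + 1)")
    case True
    then have "K * prime_count n \<le> K * 2 ^ (K + 1)"
      using prime_count_le[of n] by (intro mult_le_mono) auto
    then show ?thesis by (rule trans_le_add1)
  next
    case False
    define m where "m = n div 2"
    have "n > 0" using False by (cases n) auto
    then have m: "m < n" "m \<ge> 2 ^ K" "2 * m \<le> n" "n \<le> 2 * m + 1" using False by (auto simp: m_def)
    have "K < 2 ^ K" by (rule less_exp)
    then have Km: "K \<le> m" using m(2) by linarith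
    have "prime_count n \<le> prime_count (2 * m) + 1"
    proof (cases "n = 2 * m")
      case False
      then have "n = Suc (2 * m)" using m(3,4) by simp
      then show ?thesis by (simp add: prime_count_Suc)
    qed simp
    then have "K * prime_count n \<le> K * prime_count (2 * m) + K"
      by (metis add_mult_distrib2 mult_le_mono2 nat_mult_1_right)
    also have "\<dots> \<le> K * prime_count m + 2 * m + K"
      using prime_count_double[OF m(2)] by simp
    also have "\<dots> \<le> K * 2 ^ (K + 1) + 3 * m + 2 * m + m"
      using less.IH[OF m(1)] Km by linarith
    also have "\<dots> \<le> K * 2 ^ (K + 1) + 3 * n" using m(3) by linarith
    finally show ?thesis .
  qed
qed

lemma prime_count_le_eps:
  assumes "\<epsilon> > 0"
  shows "\<exists>A\<ge>0. \<forall>n. real (prime_count n) \<le> A + \<epsilon> * real n"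
proof -
  obtain K0 :: nat where K0: "3 / \<epsilon> < real K0" using reals_Archimedean2 by blast
  define K where "K = Suc K0"
  have K: "K \<ge> 1" "3 \<le> \<epsilon> * real K" using K0 assms by (auto simp: K_def field_simps)
  have "real (prime_count n) \<le> 2 ^ (K + 1) + \<epsilon> * real n" for n
  proof -
    have "real (K * prime_count n) \<le> real (K * 2 ^ (K + 1) + 3 * n)"
      using prime_count_linear_bound[OF K(1), of n] by (simp only: of_nat_le_iff)
    then have "real K * real (prime_count n) \<le> real K * 2 ^ (K + 1) + 3 * real n" by simp
    also have "3 * real n \<le> (\<epsilon> * real K) * real n" using K(2) by (intro mult_right_mono) auto
    also have "real K * 2 ^ (K + 1) + (\<epsilon> * real K) * real n = real K * (2 ^ (K + 1) + \<epsilon> * real n)"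
      by (simp add: algebra_simps)
    finally have "real K * real (prime_count n) \<le> real K * (2 ^ (K + 1) + \<epsilon> * real n)" by simp
    then show ?thesis using K(1) by (simp add: mult_le_cancel_left_pos)
  qed
  then show ?thesis by (intro exI[of _ "2 ^ (K + 1)"]) simp
qed

section \<open>Reciprocal sums and Euler products over small primes\<close>

lemma prime_reciprocal_sum_partial_summation:
  "(\<Sum>p | prime p \<and> p \<le> n. 1 / real p)
     = real (prime_count n) / real (n + 1) + (\<Sum>i=1..n. real (prime_count i) / (real i * real (i + 1)))"
proof (induction n)
  case 0
  have "{p::nat. prime p \<and> p \<le> 0} = {}" by auto
  then show ?case by (simp add: prime_count_def)
next
  case (Suc n)
  have "{p. prime p \<and> p \<le> Suc n} = {p. prime p \<and> p \<le> n} \<union> (if prime (Suc n) then {Suc n} else {})"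
    by (auto simp: le_Suc_eq)
  then have lhs: "(\<Sum>p | prime p \<and> p \<le> Suc n. 1 / real p)
      = (\<Sum>p | prime p \<and> p \<le> n. 1 / real p) + (if prime (Suc n) then 1 / real (Suc n) else 0)"
    by simp
  have arith: "a / (x + 1) = (a' / (x + 2) + a' / ((x + 1) * (x + 2))) - (a' - a) / (x + 1)"
    if "x \<ge> 0" for a a' x :: real
  proof -
    have "a' / (x + 2) + a' / ((x + 1) * (x + 2)) = a' / (x + 1)"
      using that by (simp add: divide_simps) (simp add: algebra_simps)
    then show ?thesis by (simp add: diff_divide_distrib)
  qed
  have "real (prime_count (Suc n)) - real (prime_count n) = (if prime (Suc n) then 1 else 0)"
    by (simp add: prime_count_Suc)
  then show ?case
    using arith[of "real n" "real (prime_count n)" "real (prime_count (Suc n))"]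
    unfolding lhs Suc.IH by (auto simp: add.commute)
qed

lemma sum_inverse_Suc_le_ln: "(\<Sum>i=1..n. 1 / real (i + 1)) \<le> ln (real n + 1)"
proof (induction n)
  case (Suc n)
  have "ln (real n + 1) - ln (real n + 2) \<le> ((real n + 1) - (real n + 2)) / (real n + 2)"
    by (rule ln_diff_le) auto
  then have "1 / (real n + 2) \<le> ln (real n + 2) - ln (real n + 1)"
    by (simp add: field_simps)
  then show ?case using Suc by (simp add: add.commute)
qed simp

lemma sum_inverse_product_le_1: "(\<Sum>i=1..n. 1 / (real i * real (i + 1))) \<le> 1"
proof -
  have "(\<Sum>i=1..n. 1 / (real i * real (i + 1))) = 1 - 1 / real (n + 1)"
  proof (induction n)
    case (Suc n)
    have "1 / (x * (x + 1)) = 1 / x - 1 / (x + 1)" if "x > 0" for x :: real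
      using that by (simp add: field_simps)
    from this[of "real n + 1"] Suc show ?case by (simp add: add.commute)
  qed simp
  then show ?thesis by simp
qed

text \<open>Insert \<open>prime_count i \<le> A + \<epsilon> i\<close> into the summation by parts:
  the part with \<open>A\<close> telescopes, and the part with \<epsilon> is harmonic.\<close>

lemma prime_reciprocal_sum_le:
  assumes "\<epsilon> > 0"
  shows "\<exists>A. \<forall>n. (\<Sum>p | prime p \<and> p \<le> n. 1 / real p) \<le> A + \<epsilon> * ln (real n + 1)"
proof -
  obtain A where A: "A \<ge> 0" "\<And>n. real (prime_count n) \<le> A + \<epsilon> * real n"
    using prime_count_le_eps[OF assms] by blast
  have "(\<Sum>p | prime p \<and> p \<le> n. 1 / real p) \<le> (1 + A) + \<epsilon> * ln (real n + 1)" for n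
  proof -
    have "(\<Sum>i=1..n. real (prime_count i) / (real i * real (i + 1)))
      \<le> (\<Sum>i=1..n. A * (1 / (real i * real (i + 1))) + \<epsilon> * (1 / real (i + 1)))"
    proof (rule sum_mono)
      fix i assume i: "i \<in> {1..n}"
      have "real (prime_count i) / (real i * real (i + 1)) \<le> (A + \<epsilon> * real i) / (real i * real (i + 1))"
        by (intro divide_right_mono A(2)) simp
      also have "\<dots> = A * (1 / (real i * real (i + 1))) + \<epsilon> * (1 / real (i + 1))"
        using i by (simp add: add_divide_distrib)
      finally show "real (prime_count i) / (real i * real (i + 1)) \<le> A * (1 / (real i * real (i + 1))) + \<epsilon> * (1 / real (i + 1))" .
    qed
    also have "\<dots> = A * (\<Sum>i=1..n. 1 / (real i * real (i + 1))) + \<epsilon> * (\<Sum>i=1..n. 1 / real (i + 1))"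
      by (simp only: sum.distrib sum_distrib_left)
    also have "\<dots> \<le> A * 1 + \<epsilon> * ln (real n + 1)"
      using A(1) assms by (intro add_mono mult_left_mono sum_inverse_product_le_1 sum_inverse_Suc_le_ln) auto
    finally have "(\<Sum>i=1..n. real (prime_count i) / (real i * real (i + 1))) \<le> A + \<epsilon> * ln (real n + 1)"
      by simp
    moreover have "real (prime_count n) / real (n + 1) \<le> 1"
      using prime_count_le[of n] by (simp add: divide_le_eq_1)
    ultimately show ?thesis unfolding prime_reciprocal_sum_partial_summation by linarith
  qed
  then show ?thesis by blast
qed

lemma exp_neg_double_le:
  assumes "0 \<le> t" "t \<le> 1 / 2"
  shows "exp (- (2 * t)) \<le> 1 - (t::real)"
proof -
  have "1 + 2 * t \<le> exp (2 * t)" by (rule exp_ge_add_one_self)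
  moreover have "(1 - t) * (1 + 2 * t) \<ge> 1"
  proof -
    have "t * (1 - 2 * t) \<ge> 0" using assms by simp
    then show ?thesis by (simp add: algebra_simps)
  qed
  ultimately have "1 \<le> (1 - t) * exp (2 * t)"
    using assms by (intro order_trans[OF _ mult_left_mono[of "1 + 2 * t" "exp (2 * t)" "1 - t"]]) auto
  then show ?thesis by (simp add: exp_minus field_simps)
qed

text \<open>Each factor is at least exp(-2/p) since 1/p \<le> 1/2, so the reciprocal sum with
  \<epsilon> = \<eta>/2 bounds the product. Letting \<eta> be arbitrarily small allows it to beat
  any given power saving.\<close>

lemma prime_product_lower_bound:
  assumes "\<eta> > 0"
  shows "\<exists>c>0. \<forall>n. c * (real n + 1) powr (- \<eta>) \<le> (\<Prod>p | prime p \<and> p \<le> n. 1 - 1 / real p)"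
proof -
  obtain A where A: "\<And>n. (\<Sum>p | prime p \<and> p \<le> n. 1 / real p) \<le> A + (\<eta> / 2) * ln (real n + 1)"
    using prime_reciprocal_sum_le[of "\<eta> / 2"] assms by auto
  have "exp (- (2 * A)) * (real n + 1) powr (- \<eta>) \<le> (\<Prod>p | prime p \<and> p \<le> n. 1 - 1 / real p)" for n
  proof -
    have "exp (- (2 * A)) * (real n + 1) powr (- \<eta>) = exp (- (2 * (A + (\<eta> / 2) * ln (real n + 1))))"
      by (simp add: powr_def algebra_simps flip: exp_add)
    also have "\<dots> \<le> exp (- (2 * (\<Sum>p | prime p \<and> p \<le> n. 1 / real p)))"
      using A[of n] by simp
    also have "\<dots> = (\<Prod>p | prime p \<and> p \<le> n. exp (- (2 * (1 / real p))))"
      by (simp add: exp_sum sum_distrib_left flip: sum_negf)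
    also have "\<dots> \<le> (\<Prod>p | prime p \<and> p \<le> n. 1 - 1 / real p)"
    proof (intro prod_mono conjI)
      fix p assume "p \<in> {p. prime p \<and> p \<le> n}"
      then have "p \<ge> 2" using prime_ge_2_nat by blast
      then show "exp (- (2 * (1 / real p))) \<le> 1 - 1 / real p"
        by (intro exp_neg_double_le) (simp_all add: field_simps)
    qed simp
    finally show ?thesis .
  qed
  then show ?thesis by (intro exI[of _ "exp (- (2 * A))"]) simp
qed

section \<open>Densities of eventually periodic sets\<close>

definition count_upto :: "(nat \<Rightarrow> bool) \<Rightarrow> nat \<Rightarrow> nat" where
  "count_upto P X = card {n\<in>{1..X}. P n}"

lemma count_upto_Suc: "count_upto P (Suc X) = count_upto P X + (if P (Suc X) then 1 else 0)"
proof -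
  have "{n\<in>{1..Suc X}. P n} = {n\<in>{1..X}. P n} \<union> (if P (Suc X) then {Suc X} else {})"
    by (auto simp: le_Suc_eq)
  then show ?thesis by (simp add: count_upto_def)
qed

lemma count_upto_0 [simp]: "count_upto P 0 = 0"
  by (simp add: count_upto_def)

lemma count_upto_mono: "(\<And>n. n \<ge> 1 \<Longrightarrow> P n \<Longrightarrow> Q n) \<Longrightarrow> count_upto P X \<le> count_upto Q X"
  unfolding count_upto_def by (rule card_mono) auto

lemma count_upto_disj: "count_upto (\<lambda>n. P n \<or> Q n) X \<le> count_upto P X + count_upto Q X"
proof -
  have "{n\<in>{1..X}. P n \<or> Q n} = {n\<in>{1..X}. P n} \<union> {n\<in>{1..X}. Q n}" by auto
  then show ?thesis unfolding count_upto_def by (simp add: card_Un_le)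
qed

text \<open>After subtracting the linear function of slope \<open>D / T\<close>, the counting
  function is periodic from \<open>n0\<close> on, hence bounded.\<close>

lemma eventually_periodic_density:
  assumes T: "T > 0" and per: "\<And>n. n \<ge> n0 \<Longrightarrow> P (n + T) = P n"
  shows "(\<lambda>X. real (count_upto P X) / real X)
           \<longlonglongrightarrow> (real (count_upto P (n0 + T)) - real (count_upto P n0)) / real T"
proof -
  define D where "D = real (count_upto P (n0 + T)) - real (count_upto P n0)"
  define e where "e X = real (count_upto P X) - (D / real T) * real X" for X
  have diff: "real (count_upto P (n0 + i + T)) - real (count_upto P (n0 + i)) = D" for i
  proof (induction i)
    case (Suc i)
    have "P (Suc (n0 + i + T)) = P (Suc (n0 + i))" using per[of "Suc (n0 + i)"] by simp
    then show ?case using Suc count_upto_Suc[of P "n0 + i + T"] count_upto_Suc[of P "n0 + i"]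
      by (simp add: add_ac)
  qed (simp add: D_def)
  have e_per: "e (n0 + i + T) = e (n0 + i)" for i
  proof -
    have "e (n0 + i + T) - e (n0 + i) = D - (D / real T) * real T"
      using diff[of i] by (simp add: e_def algebra_simps)
    then show ?thesis using T by simp
  qed
  define B where "B = Max ((\<lambda>X. \<bar>e X\<bar>) ` {..<n0 + T})"
  have e_le: "\<bar>e X\<bar> \<le> B" for X
  proof (induction X rule: less_induct)
    case (less X)
    show ?case
    proof (cases "X < n0 + T")
      case True
      then show ?thesis unfolding B_def by (intro Max_ge) auto
    next
      case False
      define i where "i = X - n0 - T"
      have i: "X = n0 + i + T" using False by (simp add: i_def)
      then have "e X = e (n0 + i)" by (simp only: e_per)
      moreover have "n0 + i < X" using i T by simp
      ultimately show ?thesis using less by simp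
    qed
  qed
  have "(\<lambda>X. e X / real X) \<longlonglongrightarrow> 0"
  proof (rule Lim_null_comparison)
    show "\<forall>\<^sub>F X in sequentially. norm (e X / real X) \<le> B / real X"
      using e_le by (intro always_eventually allI) (auto simp: divide_right_mono)
    show "(\<lambda>X. B / real X) \<longlonglongrightarrow> 0" by (rule lim_const_over_n)
  qed
  then have "(\<lambda>X. D / real T + e X / real X) \<longlonglongrightarrow> D / real T + 0" by (intro tendsto_intros)
  moreover have "\<forall>\<^sub>F X in sequentially. D / real T + e X / real X = real (count_upto P X) / real X"
    using eventually_gt_at_top[of 0] by eventually_elim (simp add: e_def diff_divide_distrib)
  ultimately show ?thesis by (simp add: D_def Lim_transform_eventually)
qed

text \<open>The condition is coprimality to the primorial \<open>Q\<close>, which has period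
  \<open>Q\<close> and density \<phi>(Q)/Q.\<close>

lemma coprime_to_small_primes_density:
  "(\<lambda>X. real (count_upto (\<lambda>n. \<forall>p. prime p \<and> p \<le> y \<longrightarrow> \<not> p dvd n) X) / real X)
     \<longlonglongrightarrow> (\<Prod>p | prime p \<and> p \<le> y. 1 - 1 / real p)"
proof -
  define Q where "Q = \<Prod>{p::nat. prime p \<and> p \<le> y}"
  have Q0: "Q > 0" unfolding Q_def by (rule prod_pos) (auto simp: prime_gt_0_nat)
  have dvdQ: "p dvd Q" if "prime p" "p \<le> y" for p
    unfolding Q_def using that by (intro dvd_prodI) auto
  have pf: "prime_factors Q = {p. prime p \<and> p \<le> y}"
  proof (intro equalityI subsetI)
    fix p assume "p \<in> prime_factors Q"
    then have p: "prime p" "p dvd Q" by auto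
    then obtain q where "prime q" "q \<le> y" "p dvd q"
      unfolding Q_def using prime_dvd_prod_iff[of "{p::nat. prime p \<and> p \<le> y}" p "\<lambda>x. x"] by auto
    then have "p = q" using p(1) primes_dvd_imp_eq by blast
    then show "p \<in> {p. prime p \<and> p \<le> y}" using \<open>prime q\<close> \<open>q \<le> y\<close> by simp
  qed (use Q0 dvdQ in \<open>auto simp: prime_factors_dvd\<close>)
  let ?P = "\<lambda>n. \<forall>p. prime p \<and> p \<le> y \<longrightarrow> \<not> p dvd n"
  have P: "?P n \<longleftrightarrow> coprime n Q" for n
  proof
    assume P: "?P n"
    show "coprime n Q" unfolding Q_def
      using P by (intro prod_coprime_right) (metis coprime_commute mem_Collect_eq prime_imp_coprime)
  next
    assume c: "coprime n Q"
    show "?P n"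
    proof (intro allI impI notI)
      fix p assume "prime p \<and> p \<le> y" "p dvd n"
      then have "p dvd 1" using c dvdQ[of p] coprime_common_divisor[of n Q p] by blast
      then show False using \<open>prime p \<and> p \<le> y\<close> not_prime_1 by auto
    qed
  qed
  have "(\<lambda>X. real (count_upto ?P X) / real X)
           \<longlonglongrightarrow> (real (count_upto ?P (0 + Q)) - real (count_upto ?P 0)) / real Q"
    by (rule eventually_periodic_density[OF Q0]) (use dvdQ in \<open>auto simp: dvd_add_left_iff\<close>)
  moreover have "count_upto ?P Q = totient Q"
    unfolding count_upto_def P totient_def totatives_def
    by (rule arg_cong[of _ _ card]) auto
  moreover have "real (totient Q) / real Q = (\<Prod>p | prime p \<and> p \<le> y. 1 - 1 / real p)"
    using totient_formula2[of Q] Q0 unfolding pf by simp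
  ultimately show ?thesis by simp
qed

text \<open>Among the finitely many blocks of \<open>k\<close> consecutive residues two coincide,
  and the recurrence propagates the coincidence forwards.\<close>

lemma recurrence_mod_eventually_periodic:
  fixes u :: "nat \<Rightarrow> int" and a :: "nat \<Rightarrow> int"
  assumes rec: "\<And>n. n \<ge> k \<Longrightarrow> u n = (\<Sum>i=1..k. a i * u (n - i))" and Q: "Q > 0"
  shows "\<exists>n0 T. T > 0 \<and> Q dvd T \<and> (\<forall>n\<ge>n0. u (n + T) mod int Q = u n mod int Q)"
proof -
  \<comment> \<open>Blocks are sampled only at multiples of \<open>Q\<close>; this makes the period
    divisible by \<open>Q\<close>, so that \<open>n\<close> modulo \<open>Q\<close> repeats along
    with \<open>u n\<close>.\<close>
  define st where "st i = map (\<lambda>j. u (Q * i + j) mod int Q) [0..<k]" for i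
  have "range st \<subseteq> {xs. set xs \<subseteq> {0..<int Q} \<and> length xs = k}"
    using Q by (auto simp: st_def)
  then have "finite (range st)"
    by (rule finite_subset) (rule finite_lists_length_eq, simp)
  then have "\<not> inj st" using finite_imageD infinite_UNIV_nat by blast
  then obtain i i' where "st i = st i'" "i < i'"
    unfolding inj_def by (metis linorder_neqE_nat)
  define n0 T where "n0 = Q * i" and "T = Q * (i' - i)"
  have T: "T > 0" "Q dvd T" and n0T: "n0 + T = Q * i'"
    using \<open>i < i'\<close> Q by (simp_all add: T_def n0_def flip: distrib_left)
  have step: "u (n0 + j) mod int Q = u (n0 + T + j) mod int Q" for j
  proof (induction j rule: less_induct)
    case (less j)
    show ?case
    proof (cases "j < k")
      case True
      then have "st i ! j = st i' ! j" by (simp add: \<open>st i = st i'\<close>)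
      then show ?thesis using True by (simp add: st_def n0T) (simp add: n0_def)
    next
      case False
      have "[(\<Sum>l=1..k. a l * u (n0 + j - l)) = (\<Sum>l=1..k. a l * u (n0 + T + j - l))] (mod int Q)"
      proof (intro cong_sum cong_mult cong_refl)
        fix l assume l: "l \<in> {1..k}"
        then have "j - l < j" "n0 + j - l = n0 + (j - l)" "n0 + T + j - l = n0 + T + (j - l)"
          using False by auto
        then show "[u (n0 + j - l) = u (n0 + T + j - l)] (mod int Q)"
          using less[of "j - l"] by (simp add: cong_def)
      qed
      then show ?thesis using rec[of "n0 + j"] rec[of "n0 + T + j"] False by (simp add: cong_def)
    qed
  qed
  have "\<forall>n\<ge>n0. u (n + T) mod int Q = u n mod int Q"
  proof (intro allI impI)
    fix n assume "n \<ge> n0"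
    then obtain j where "n = n0 + j" using le_Suc_ex by blast
    then show "u (n + T) mod int Q = u n mod int Q" using step[of j] by (simp add: add_ac)
  qed
  then show ?thesis using T by blast
qed

text \<open>The condition depends only on \<open>n\<close> and \<open>u n\<close> modulo the
  primorial, which repeat together.\<close>

lemma no_small_common_prime_density:
  fixes u :: "nat \<Rightarrow> int" and a :: "nat \<Rightarrow> int"
  assumes rec: "\<And>n. n \<ge> k \<Longrightarrow> u n = (\<Sum>i=1..k. a i * u (n - i))"
  shows "\<exists>d. (\<lambda>X. real (count_upto (\<lambda>n. \<forall>p. prime p \<and> p \<le> y \<longrightarrow> \<not> (p dvd n \<and> int p dvd u n)) X) / real X) \<longlonglongrightarrow> d"
proof -
  define Q where "Q = \<Prod>{p::nat. prime p \<and> p \<le> y}"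
  have Q0: "Q > 0" unfolding Q_def by (rule prod_pos) (auto simp: prime_gt_0_nat)
  have dvdQ: "p dvd Q" if "prime p" "p \<le> y" for p
    unfolding Q_def using that by (intro dvd_prodI) auto
  obtain n0 T where T: "T > 0" "Q dvd T" and per: "\<And>n. n \<ge> n0 \<Longrightarrow> u (n + T) mod int Q = u n mod int Q"
    using recurrence_mod_eventually_periodic[OF rec Q0] by blast
  let ?P = "\<lambda>n. \<forall>p. prime p \<and> p \<le> y \<longrightarrow> \<not> (p dvd n \<and> int p dvd u n)"
  have "?P (n + T) = ?P n" if "n \<ge> n0" for n
  proof -
    have "(p dvd n + T \<and> int p dvd u (n + T)) = (p dvd n \<and> int p dvd u n)" if p: "prime p" "p \<le> y" for p
    proof -
      have "p dvd T" "int p dvd int Q" using dvdQ[OF p] T(2) by auto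
      have "int p dvd u (n + T) \<longleftrightarrow> int p dvd u (n + T) mod int Q"
        using \<open>int p dvd int Q\<close> by (simp add: dvd_mod_iff)
      also have "\<dots> \<longleftrightarrow> int p dvd u n"
        unfolding per[OF \<open>n \<ge> n0\<close>] using \<open>int p dvd int Q\<close> by (simp add: dvd_mod_iff)
      finally show ?thesis using \<open>p dvd T\<close> by (simp add: dvd_add_left_iff)
    qed
    then show ?thesis by blast
  qed
  from eventually_periodic_density[OF T(1), of n0 ?P, OF this] show ?thesis by blast
qed

section \<open>Large common primes\<close>

lemma powr_increment_ge:
  assumes "0 < \<delta>" "\<delta> \<le> 1" "N \<ge> 1"
  shows "\<delta> * real N powr (\<delta> - 1) \<le> real N powr \<delta> - (real N - 1) powr \<delta>"
proof (cases "N = 1")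
  case True
  then show ?thesis using assms by simp
next
  case False
  then have N: "real N - 1 > 0" using assms by simp
  have "\<exists>z. real N - 1 < z \<and> z < real N \<and>
      real N powr \<delta> - (real N - 1) powr \<delta> = (real N - (real N - 1)) * (\<delta> * z powr (\<delta> - 1))"
    by (rule MVT2) (use N in \<open>auto intro!: derivative_eq_intros\<close>)
  then obtain z where z: "real N - 1 < z" "z < real N"
    "real N powr \<delta> - (real N - 1) powr \<delta> = \<delta> * z powr (\<delta> - 1)" by auto
  have "real N powr (\<delta> - 1) \<le> z powr (\<delta> - 1)"
    using z N assms by (intro powr_mono2') auto
  then show ?thesis using z(3) assms by (simp add: mult_left_mono)
qed

text \<open>Since \<delta> - 1 \<le> 0, the sum is largest when \<open>F\<close> is an initial
  segment: the largest element is at least the cardinality \<open>N\<close>, and the increment of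
  N^\<delta> dominates its term. In this way a bound on the number of primes becomes a bound on a
  sum over them.\<close>

lemma sum_powr_le_card_powr:
  assumes \<delta>: "0 < \<delta>" "\<delta> \<le> 1" and F: "finite F" "0 \<notin> F"
  shows "\<delta> * (\<Sum>n\<in>F. real n powr (\<delta> - 1)) \<le> real (card F) powr \<delta>"
  using F
proof (induction F rule: finite_linorder_max_induct)
  case (insert b F)
  define N where "N = card (insert b F)"
  have bF: "b \<notin> F" using insert.hyps(2) by blast
  have "card F < N" using insert.hyps(1) bF by (simp add: N_def)
  have "insert b F \<subseteq> {1..b}"
  proof
    fix x assume x: "x \<in> insert b F"
    then have "x \<noteq> 0" using insert.prems by metis
    moreover have "x \<le> b" using x insert.hyps(2) by auto
    ultimately show "x \<in> {1..b}" by simp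
  qed
  from card_mono[OF _ this] have "N \<le> b" by (simp add: N_def)
  have cF: "real (card F) = real N - 1" using insert.hyps(1) bF by (simp add: N_def)
  have "real b powr (\<delta> - 1) \<le> real N powr (\<delta> - 1)"
    using \<open>N \<le> b\<close> \<open>card F < N\<close> \<delta> by (intro powr_mono2') auto
  then have "\<delta> * real b powr (\<delta> - 1) \<le> \<delta> * real N powr (\<delta> - 1)"
    using \<delta> by (intro mult_left_mono) auto
  also have "\<dots> \<le> real N powr \<delta> - (real N - 1) powr \<delta>"
    using \<open>card F < N\<close> \<delta> by (intro powr_increment_ge) auto
  finally have "\<delta> * real b powr (\<delta> - 1) \<le> real N powr \<delta> - real (card F) powr \<delta>" by (simp only: cF)
  moreover have "\<delta> * (\<Sum>n\<in>F. real n powr (\<delta> - 1)) \<le> real (card F) powr \<delta>"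
    using insert by simp
  ultimately show ?case using insert.hyps(1) bF by (simp add: N_def[symmetric] distrib_left)
qed simp

lemma prime_powr_sum_small:
  assumes \<delta>: "0 < \<delta>" "\<delta> \<le> 1" and \<epsilon>: "\<epsilon> > 0"
  shows "\<forall>\<^sub>F X in sequentially. (\<Sum>p | prime p \<and> p \<le> X. (real X / real p) powr (1 - \<delta>)) \<le> \<epsilon> * real X"
proof -
  \<comment> \<open>Chosen so that (e X)^\<delta> / \<delta> = \<epsilon> X^\<delta>; half of
    \<open>e\<close> absorbs the additive constant for large \<open>X\<close>.\<close>
  define e where "e = (\<epsilon> * \<delta>) powr (1 / \<delta>)"
  have e: "e > 0" "e powr \<delta> = \<epsilon> * \<delta>" using assms by (simp_all add: e_def powr_powr)
  obtain A where A: "A \<ge> 0" "\<And>n. real (prime_count n) \<le> A + e / 2 * real n"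
    using prime_count_le_eps[of "e / 2"] e(1) by auto
  have "\<forall>\<^sub>F X in sequentially. real X \<ge> 2 * A / e"
    using filterlim_real_sequentially unfolding filterlim_at_top by blast
  then show ?thesis using eventually_gt_at_top[of 0]
  proof eventually_elim
    case (elim X)
    let ?R = "{p. prime p \<and> p \<le> X}"
    have "real (prime_count X) \<le> e * real X"
      using A(2)[of X] elim(1) e(1) by (simp add: field_simps)
    have "(\<Sum>p\<in>?R. (real X / real p) powr (1 - \<delta>)) = (\<Sum>p\<in>?R. real X powr (1 - \<delta>) * real p powr (\<delta> - 1))"
    proof (intro sum.cong refl)
      fix p assume "p \<in> ?R"
      have "real p powr (\<delta> - 1) = inverse (real p powr (1 - \<delta>))"
        using powr_minus[of "real p" "1 - \<delta>"] by simp
      then show "(real X / real p) powr (1 - \<delta>) = real X powr (1 - \<delta>) * real p powr (\<delta> - 1)"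
        by (simp only: powr_divide of_nat_0_le_iff) (simp add: divide_inverse)
    qed
    also have "\<dots> = real X powr (1 - \<delta>) * (\<Sum>p\<in>?R. real p powr (\<delta> - 1))"
      by (simp add: sum_distrib_left)
    finally have "\<delta> * (\<Sum>p\<in>?R. (real X / real p) powr (1 - \<delta>))
        = real X powr (1 - \<delta>) * (\<delta> * (\<Sum>p\<in>?R. real p powr (\<delta> - 1)))" by simp
    also have "\<dots> \<le> real X powr (1 - \<delta>) * real (card ?R) powr \<delta>"
      by (intro mult_left_mono sum_powr_le_card_powr \<delta>) auto
    also have "\<dots> \<le> real X powr (1 - \<delta>) * (e * real X) powr \<delta>"
      using \<open>real (prime_count X) \<le> e * real X\<close> \<delta>
      by (intro mult_left_mono powr_mono2) (auto simp: prime_count_def)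
    also have "\<dots> = \<epsilon> * \<delta> * (real X powr (1 - \<delta>) * real X powr \<delta>)"
      using e by (simp add: powr_mult)
    also have "real X powr (1 - \<delta>) * real X powr \<delta> = real X"
      using elim(2) by (simp flip: powr_add)
    finally show ?case using \<delta>(1) by (simp add: mult.assoc mult.left_commute)
  qed
qed

text \<open>Half of the extra decay keeps the series convergent, the other half becomes the power of
  \<open>y\<close>.\<close>

lemma sum_powr_tail_le:
  assumes \<delta>: "\<delta> > 0" and y: "y \<ge> 1" and R: "finite R" "\<And>n. n \<in> R \<Longrightarrow> n > y"
  shows "(\<Sum>n\<in>R. real n powr (- 1 - 2 * \<delta>)) \<le> (\<Sum>n. real n powr (- 1 - \<delta>)) * real y powr (- \<delta>)"
proof -
  have "(\<Sum>n\<in>R. real n powr (- 1 - 2 * \<delta>)) \<le> (\<Sum>n\<in>R. real n powr (- 1 - \<delta>) * real y powr (- \<delta>))"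
  proof (rule sum_mono)
    fix n assume "n \<in> R"
    then have n: "real n \<ge> real y" "real y > 0" using R(2)[of n] y by auto
    have "- 1 - 2 * \<delta> = (- 1 - \<delta>) + (- \<delta>)" by simp
    then have "real n powr (- 1 - 2 * \<delta>) = real n powr (- 1 - \<delta>) * real n powr (- \<delta>)"
      by (simp only: powr_add)
    also have "\<dots> \<le> real n powr (- 1 - \<delta>) * real y powr (- \<delta>)"
      using n \<delta> by (intro mult_left_mono powr_mono2') auto
    finally show "real n powr (- 1 - 2 * \<delta>) \<le> real n powr (- 1 - \<delta>) * real y powr (- \<delta>)" .
  qed
  also have "\<dots> = (\<Sum>n\<in>R. real n powr (- 1 - \<delta>)) * real y powr (- \<delta>)"
    by (simp add: sum_distrib_right)
  also have "\<dots> \<le> (\<Sum>n. real n powr (- 1 - \<delta>)) * real y powr (- \<delta>)"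
  proof (intro mult_right_mono sum_le_suminf R)
    show "summable (\<lambda>n. real n powr (- 1 - \<delta>))" using \<delta> by (simp add: summable_real_powr_iff)
  qed auto
  finally show ?thesis .
qed

lemma card_prime_divisors_le:
  assumes "N \<noteq> 0" "\<bar>N\<bar> \<le> 2 ^ g" and R: "\<And>p. p \<in> R \<Longrightarrow> prime p \<and> int p dvd N"
  shows "finite R" "card R \<le> g"
proof -
  have dvd: "p dvd nat \<bar>N\<bar>" if "p \<in> R" for p
    using R[OF that] by (simp add: nat_dvd_iff flip: int_dvd_int_iff)
  have pos: "nat \<bar>N\<bar> > 0" using assms(1) by simp
  show fin: "finite R"
    by (rule finite_subset[of _ "{..nat \<bar>N\<bar>}"]) (use dvd_imp_le[OF dvd pos] in blast)+
  have "2 ^ card R = (\<Prod>p\<in>R. 2)" by simp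
  also have "\<dots> \<le> \<Prod>R" using R by (intro prod_mono) (auto simp: prime_ge_2_nat)
  also have "\<dots> \<le> nat \<bar>N\<bar>"
    using prod_primes_dvd[OF fin, of "nat \<bar>N\<bar>"] R dvd pos by (auto intro: dvd_imp_le)
  also have "\<dots> \<le> 2 ^ g" using assms(2) by (simp add: nat_le_iff)
  finally show "card R \<le> g" by (rule power_le_imp_le_exp[rotated]) simp
qed

lemma sum_UNION_le:
  fixes f :: "'a \<Rightarrow> real"
  assumes "finite I" "\<And>i. i \<in> I \<Longrightarrow> finite (E i)" "\<And>x. f x \<ge> 0"
  shows "sum f (\<Union>i\<in>I. E i) \<le> (\<Sum>i\<in>I. sum f (E i))"
  using assms(1,2)
proof (induction I)
  case (insert i I)
  have "sum f (E i \<union> (\<Union>i\<in>I. E i)) + sum f (E i \<inter> (\<Union>i\<in>I. E i)) = sum f (E i) + sum f (\<Union>i\<in>I. E i)"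
    using insert by (intro sum.union_inter) auto
  moreover have "sum f (E i \<inter> (\<Union>i\<in>I. E i)) \<ge> 0" by (intro sum_nonneg assms(3))
  ultimately show ?case using insert by simp
qed simp

text \<open>At most \<open>g h\<close> primes divide \<open>N h\<close>, and h^4 \<le> p gives 1/p =
  p^(-1/4) p^(-3/4) \<le> y^(-1/4) h^(-3). The sum over \<open>h\<close> is then of order h^(-2);
  the fourth power leaves room for the decay in \<open>y\<close>.\<close>

lemma exceptional_prime_sum_le:
  assumes N: "\<And>h. h \<ge> 1 \<Longrightarrow> N h \<noteq> 0 \<and> \<bar>N h\<bar> \<le> C ^ h"
  shows "\<exists>B\<ge>0. \<forall>y\<ge>1. \<forall>X. (\<Sum>p | prime p \<and> y < p \<and> p \<le> X \<and> (\<exists>h\<ge>1. h ^ 4 \<le> p \<and> int p dvd N h). 1 / real p)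
           \<le> B * real y powr (- (1 / 4))"
proof -
  \<comment> \<open>With \<open>C\<close> rounded up to a power of 2, the exponent of the bound is
    directly a bound on the number of prime divisors.\<close>
  obtain g where g: "C \<le> 2 ^ g"
  proof
    have "C \<le> int (nat C)" by simp
    also have "\<dots> \<le> int (2 ^ nat C)"
      by (simp only: of_nat_le_iff less_imp_le[OF less_exp])
    also have "\<dots> = 2 ^ nat C" by simp
    finally show "C \<le> 2 ^ nat C" .
  qed
  have C0: "C \<ge> 0" using N[of 1] by auto
  define Z where "Z = (\<Sum>n. real n powr (- 2))"
  have sm: "summable (\<lambda>n. real n powr (- 2))" by (simp add: summable_real_powr_iff)
  have Z0: "Z \<ge> 0" unfolding Z_def by (rule suminf_nonneg[OF sm]) simp
  have "(\<Sum>p | prime p \<and> y < p \<and> p \<le> X \<and> (\<exists>h\<ge>1. h ^ 4 \<le> p \<and> int p dvd N h). 1 / real p)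
           \<le> (real g * Z) * real y powr (- (1 / 4))" if y: "y \<ge> 1" for y X
  proof -
    let ?R = "{p. prime p \<and> y < p \<and> p \<le> X \<and> (\<exists>h\<ge>1. h ^ 4 \<le> p \<and> int p dvd N h)}"
    define E where "E h = {p. prime p \<and> y < p \<and> p \<le> X \<and> h ^ 4 \<le> p \<and> int p dvd N h}" for h :: nat
    have fin: "finite ?R" by (rule finite_subset[of _ "{..X}"]) auto
    have finE: "finite (E h)" for h by (rule finite_subset[of _ "{..X}"]) (auto simp: E_def)
    have "?R \<subseteq> (\<Union>h\<in>{1..X}. E h)"
    proof
      fix p assume "p \<in> ?R"
      then obtain h where h: "h \<ge> 1" "h ^ 4 \<le> p" "int p dvd N h" and p: "prime p" "y < p" "p \<le> X" by auto
      have "h \<le> h ^ 4" using h(1) by (intro self_le_power) auto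
      then have "h \<in> {1..X}" using h p by simp
      then show "p \<in> (\<Union>h\<in>{1..X}. E h)" using h p by (auto simp: E_def)
    qed
    then have "(\<Sum>p\<in>?R. 1 / real p) \<le> (\<Sum>p\<in>(\<Union>h\<in>{1..X}. E h). 1 / real p)"
      using finE by (intro sum_mono2) auto
    also have "\<dots> \<le> (\<Sum>h\<in>{1..X}. \<Sum>p\<in>E h. 1 / real p)"
      by (rule sum_UNION_le) (use finE in auto)
    also have "\<dots> \<le> (\<Sum>h\<in>{1..X}. (real g * real y powr (- (1 / 4))) * real h powr (- 2))"
    proof (rule sum_mono)
      fix h assume h: "h \<in> {1..X}"
      then have h1: "h \<ge> 1" by simp
      have "\<bar>N h\<bar> \<le> 2 ^ (g * h)"
        using N[OF h1] power_mono[OF g C0, of h] by (simp add: power_mult)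
      then have card: "card (E h) \<le> g * h"
        using N[OF h1] by (intro card_prime_divisors_le(2)[of "N h"]) (auto simp: E_def)
      have inv_le: "1 / real p \<le> real y powr (- (1 / 4)) * real h powr (- 3)" if "p \<in> E h" for p
      proof -
        have p: "real p \<ge> real y" "real p \<ge> real h ^ 4" "real p > 0"
          using that by (simp_all add: E_def prime_gt_0_nat flip: of_nat_power)
        have "1 / real p = real p powr (- (1 / 4)) * real p powr (- (3 / 4))"
          using p(3) by (simp only: powr_add[symmetric]) (simp add: powr_minus_divide)
        also have "\<dots> \<le> real y powr (- (1 / 4)) * (real h ^ 4) powr (- (3 / 4))"
          using p y h1 by (intro mult_mono powr_mono2') auto
        also have "(real h ^ 4) powr (- (3 / 4)) = real h powr (- 3)"
        proof -
          have "real h ^ 4 = real h powr 4" using h1 by simp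
          then show ?thesis by (simp only: powr_powr) simp
        qed
        finally show ?thesis .
      qed
      have "(\<Sum>p\<in>E h. 1 / real p) \<le> (\<Sum>p\<in>E h. real y powr (- (1 / 4)) * real h powr (- 3))"
        by (intro sum_mono inv_le)
      also have "\<dots> = real (card (E h)) * (real y powr (- (1 / 4)) * real h powr (- 3))" by simp
      also have "\<dots> \<le> (real g * real h) * (real y powr (- (1 / 4)) * real h powr (- 3))"
        using card by (intro mult_right_mono) (simp_all flip: of_nat_mult)
      also have "\<dots> = (real g * real y powr (- (1 / 4))) * (real h powr 1 * real h powr (- 3))"
        using h1 by simp
      also have "real h powr 1 * real h powr (- 3) = real h powr (- 2)" by (simp only: powr_add[symmetric]) simp
      finally show "(\<Sum>p\<in>E h. 1 / real p) \<le> (real g * real y powr (- (1 / 4))) * real h powr (- 2)" .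
    qed
    also have "\<dots> = (real g * real y powr (- (1 / 4))) * (\<Sum>h\<in>{1..X}. real h powr (- 2))"
      by (simp only: sum_distrib_left)
    also have "\<dots> \<le> (real g * real y powr (- (1 / 4))) * Z"
      unfolding Z_def by (intro mult_left_mono sum_le_suminf sm) auto
    finally show ?thesis by (simp add: mult_ac)
  qed
  then show ?thesis using Z0 by (intro exI[of _ "real g * Z"]) simp
qed

section \<open>The contribution of one prime and the total over all large primes\<close>

lemma card_window_cover:
  fixes H :: nat and P :: "nat \<Rightarrow> bool"
  assumes "H \<ge> 1" "\<And>a. real (card {m\<in>{a..<a + H}. P m}) \<le> B"
  shows "real (card {m\<in>{1..M}. P m}) \<le> real (M div H + 1) * B"
proof -
  have "{m\<in>{1..M}. P m} \<subseteq> (\<Union>i\<in>{..M div H}. {m\<in>{i * H..<i * H + H}. P m})"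
  proof
    fix m assume m: "m \<in> {m\<in>{1..M}. P m}"
    have "m = (m div H) * H + m mod H" by (rule div_mult_mod_eq[symmetric])
    moreover have "m mod H < H" using assms(1) by simp
    moreover have "m div H \<le> M div H" using m by (intro div_le_mono) simp
    ultimately have "m div H \<in> {..M div H}" "m \<in> {m div H * H..<m div H * H + H}"
      by (simp, metis add_less_cancel_left atLeastLessThan_iff le_add1)
    then show "m \<in> (\<Union>i\<in>{..M div H}. {m\<in>{i * H..<i * H + H}. P m})"
      using m by blast
  qed
  then have "card {m\<in>{1..M}. P m} \<le> card (\<Union>i\<in>{..M div H}. {m\<in>{i * H..<i * H + H}. P m})"
    by (intro card_mono) auto
  also have "\<dots> \<le> (\<Sum>i\<in>{..M div H}. card {m\<in>{i * H..<i * H + H}. P m})"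
    by (rule card_UN_le) simp
  finally have "real (card {m\<in>{1..M}. P m}) \<le> (\<Sum>i\<in>{..M div H}. real (card {m\<in>{i * H..<i * H + H}. P m}))"
    by (simp only: of_nat_sum[symmetric] of_nat_le_iff)
  also have "\<dots> \<le> (\<Sum>i\<in>{..M div H}. B)" by (intro sum_mono assms(2))
  finally show ?thesis by simp
qed

lemma nat_fourth_root:
  assumes "p \<ge> (1::nat)"
  obtains H where "H \<ge> 1" "H ^ 4 \<le> p" "p < (H + 1) ^ 4"
proof -
  define H where "H = Max {h. h ^ 4 \<le> p}"
  have le: "h \<le> p" if "h ^ 4 \<le> p" for h
  proof (cases "h = 0")
    case False
    then have "h \<le> h ^ 4" by (intro self_le_power) auto
    then show ?thesis using that by simp
  qed simp
  have fin: "finite {h. h ^ 4 \<le> p}" by (rule finite_subset[of _ "{..p}"]) (use le in auto)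
  have one: "1 \<in> {h. h ^ 4 \<le> p}" using assms by simp
  have "H \<in> {h. h ^ 4 \<le> p}" unfolding H_def using fin one by (intro Max_in) blast+
  moreover have "H \<ge> 1" unfolding H_def using fin one by (intro Max_ge)
  moreover have "p < (H + 1) ^ 4"
  proof (rule ccontr)
    assume "\<not> p < (H + 1) ^ 4"
    then have "H + 1 \<le> H" unfolding H_def using fin by (intro Max_ge) (auto simp: H_def)
    then show False by simp
  qed
  ultimately show ?thesis using that by simp
qed

text \<open>Windows may be as long as \<open>H\<close>, the integer part of p^(1/4). If
  \<open>X div p\<close> fits into one window, the second summand results. Otherwise at most 2M/H
  windows with 4 H^(1-\<delta>) zeros each give 8 M H^(-\<delta>), which leads to the first.\<close>

lemma prime_contribution_le:
  fixes u :: "nat \<Rightarrow> int" and N :: "nat \<Rightarrow> int"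
  assumes \<delta>: "0 < \<delta>" "\<delta> \<le> 1"
    and window: "\<And>L a. L \<ge> 1 \<Longrightarrow> (\<forall>h\<in>{1..L}. \<not> int p dvd N h) \<Longrightarrow>
        real (card {m\<in>{a..<a + L}. int p dvd u (p * m)}) \<le> 4 * real L powr (1 - \<delta>)"
    and p: "p \<ge> 1" and good: "\<And>h. h \<ge> 1 \<Longrightarrow> h ^ 4 \<le> p \<Longrightarrow> \<not> int p dvd N h"
  shows "real (card {m\<in>{1..X div p}. int p dvd u (p * m)})
      \<le> 16 * real X * real p powr (- 1 - \<delta> / 4) + 4 * (real X / real p) powr (1 - \<delta>)"
proof -
  define M where "M = X div p"
  have M: "real M \<le> real X / real p" unfolding M_def by (rule of_nat_div_le_of_nat)
  obtain H where H: "H \<ge> 1" "H ^ 4 \<le> p" "p < (H + 1) ^ 4" using nat_fourth_root[OF p] .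
  have goodH: "\<not> int p dvd N h" if "h \<in> {1..H}" for h
  proof -
    have "h ^ 4 \<le> H ^ 4" using that by (intro power_mono) auto
    then have "h ^ 4 \<le> p" using H(2) by (rule order_trans)
    then show ?thesis using good[of h] that by simp
  qed
  have nonneg: "0 \<le> 16 * real X * real p powr (- 1 - \<delta> / 4)" "0 \<le> 4 * (real X / real p) powr (1 - \<delta>)" by simp_all
  consider "M = 0" | "1 \<le> M" "M \<le> H" | "H < M" by linarith
  then have "real (card {m\<in>{1..M}. int p dvd u (p * m)})
      \<le> 16 * real X * real p powr (- 1 - \<delta> / 4) + 4 * (real X / real p) powr (1 - \<delta>)"
  proof cases
    case 1
    then show ?thesis using nonneg by simp
  next
    case 2
    have "{m\<in>{1..M}. int p dvd u (p * m)} = {m\<in>{1..<1 + M}. int p dvd u (p * m)}" by auto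
    then have "real (card {m\<in>{1..M}. int p dvd u (p * m)}) \<le> 4 * real M powr (1 - \<delta>)"
      using window[of M 1] 2 goodH by auto
    also have "\<dots> \<le> 4 * (real X / real p) powr (1 - \<delta>)"
      using M \<delta> by (intro mult_left_mono powr_mono2) auto
    finally show ?thesis using nonneg by linarith
  next
    case 3
    have "real (card {m\<in>{1..M}. int p dvd u (p * m)}) \<le> real (M div H + 1) * (4 * real H powr (1 - \<delta>))"
      using window[OF H(1)] goodH by (intro card_window_cover[OF H(1)]) auto
    also have "\<dots> \<le> (2 * (real M / real H)) * (4 * real H powr (1 - \<delta>))"
    proof (intro mult_right_mono)
      have "real (M div H) \<le> real M / real H" by (rule of_nat_div_le_of_nat)
      moreover have "1 \<le> real M / real H" using 3 H(1) by simp
      ultimately show "real (M div H + 1) \<le> 2 * (real M / real H)" by simp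
    qed simp
    also have "\<dots> = 8 * real M * (real H powr (1 - \<delta>) / real H powr 1)" using H(1) by simp
    also have "real H powr (1 - \<delta>) / real H powr 1 = real H powr (- \<delta>)"
      by (simp only: powr_diff[symmetric]) simp
    also have "8 * real M * real H powr (- \<delta>) \<le> 8 * (real X / real p) * (2 * real p powr (- \<delta> / 4))"
    proof (intro mult_mono)
      \<comment> \<open>Since H \<ge> p^(1/4) / 2, the loss is 2^\<delta> \<le> 2, turning 8 into
        16.\<close>
      have "(H + 1) ^ 4 \<le> (2 * H) ^ 4" using H(1) by (intro power_mono) auto
      then have "p \<le> (2 * H) ^ 4" using H(3) by linarith
      then have "real p \<le> (2 * real H) ^ 4" by (metis of_nat_le_iff of_nat_mult of_nat_numeral of_nat_power)
      also have "\<dots> = (2 * real H) powr 4" using H(1) by simp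
      finally have "((2 * real H) powr 4) powr (- \<delta> / 4) \<le> real p powr (- \<delta> / 4)"
        using \<delta> p by (intro powr_mono2') auto
      then have "(2 * real H) powr (- \<delta>) \<le> real p powr (- \<delta> / 4)"
        by (simp only: powr_powr) simp
      then have "2 powr (- \<delta>) * real H powr (- \<delta>) \<le> real p powr (- \<delta> / 4)"
        by (simp add: powr_mult)
      moreover have "2 powr (- 1) \<le> 2 powr (- \<delta>)" using \<delta> by (intro powr_mono) auto
      then have "1 / 2 * real H powr (- \<delta>) \<le> 2 powr (- \<delta>) * real H powr (- \<delta>)"
        by (intro mult_right_mono) (simp_all add: powr_minus_divide)
      ultimately show "real H powr (- \<delta>) \<le> 2 * real p powr (- \<delta> / 4)" by linarith
    qed (use M in auto)
    also have "\<dots> = 16 * real X * (real p powr (- \<delta> / 4) / real p powr 1)" using p by simp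
    also have "real p powr (- \<delta> / 4) / real p powr 1 = real p powr (- 1 - \<delta> / 4)"
    proof -
      have "- \<delta> / 4 - 1 = - 1 - \<delta> / 4" by simp
      then show ?thesis by (simp only: powr_diff[symmetric])
    qed
    finally show ?thesis using nonneg by linarith
  qed
  then show ?thesis by (simp only: M_def)
qed

definition large_common_prime :: "(nat \<Rightarrow> int) \<Rightarrow> nat \<Rightarrow> nat \<Rightarrow> bool" where
  "large_common_prime u y n \<longleftrightarrow> (\<exists>p. prime p \<and> y < p \<and> p dvd n \<and> int p dvd u n)"

lemma count_large_common_prime_le:
  "real (count_upto (large_common_prime u y) X)
     \<le> (\<Sum>p | prime p \<and> y < p \<and> p \<le> X. real (card {m\<in>{1..X div p}. int p dvd u (p * m)}))"
proof -
  let ?R = "{p. prime p \<and> y < p \<and> p \<le> X}"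
  have fin: "finite ?R" by (rule finite_subset[of _ "{..X}"]) auto
  have "{n\<in>{1..X}. large_common_prime u y n} \<subseteq> (\<Union>p\<in>?R. (*) p ` {m\<in>{1..X div p}. int p dvd u (p * m)})"
  proof
    fix n assume "n \<in> {n\<in>{1..X}. large_common_prime u y n}"
    then obtain p where n: "1 \<le> n" "n \<le> X" and p: "prime p" "y < p" "p dvd n" "int p dvd u n"
      by (auto simp: large_common_prime_def)
    then obtain m where m: "n = p * m" by blast
    have p0: "p > 0" using p(1) by (rule prime_gt_0_nat)
    have "p \<le> X" using dvd_imp_le[OF p(3)] n by simp
    moreover have "m \<le> X div p" using n(2) p0 by (simp add: m less_eq_div_iff_mult_less_eq mult.commute)
    moreover have "1 \<le> m" using n(1) m by (cases m) auto
    ultimately show "n \<in> (\<Union>p\<in>?R. (*) p ` {m\<in>{1..X div p}. int p dvd u (p * m)})"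
      using p m by (intro UN_I[of p]) auto
  qed
  then have "count_upto (large_common_prime u y) X
      \<le> card (\<Union>p\<in>?R. (*) p ` {m\<in>{1..X div p}. int p dvd u (p * m)})"
    unfolding count_upto_def using fin by (intro card_mono) auto
  also have "\<dots> \<le> (\<Sum>p\<in>?R. card ((*) p ` {m\<in>{1..X div p}. int p dvd u (p * m)}))"
    by (rule card_UN_le[OF fin])
  also have "\<dots> \<le> (\<Sum>p\<in>?R. card {m\<in>{1..X div p}. int p dvd u (p * m)})"
    by (intro sum_mono card_image_le) simp
  finally show ?thesis by (simp only: of_nat_sum[symmetric] of_nat_le_iff)
qed

text \<open>Exceptional primes are counted trivially by X/p, the others by their window bounds. The
  terms (X/p)^(1-\<delta>) total o(X) and go into \<epsilon>; the rest decays in \<open>y\<close>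
  with \<open>B\<close> independent of \<open>y\<close>. The exponent \<delta>/8 is half of the
  \<delta>/4 available for one prime.\<close>

lemma large_common_prime_tail:
  fixes u :: "nat \<Rightarrow> int" and N :: "nat \<Rightarrow> int"
  assumes N: "\<And>h. h \<ge> 1 \<Longrightarrow> N h \<noteq> 0 \<and> \<bar>N h\<bar> \<le> C ^ h" and \<delta>: "0 < \<delta>" "\<delta> \<le> 1"
    and window: "\<And>p L a. prime p \<Longrightarrow> L \<ge> 1 \<Longrightarrow> \<forall>h\<in>{1..L}. \<not> int p dvd N h \<Longrightarrow>
        real (card {m\<in>{a..<a + L}. int p dvd u (p * m)}) \<le> 4 * real L powr (1 - \<delta>)"
  shows "\<exists>B\<ge>0. \<forall>y\<ge>1. \<forall>\<epsilon>>0. \<forall>\<^sub>F X in sequentially.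
           real (count_upto (large_common_prime u y) X) \<le> (B * real y powr (- (\<delta> / 8)) + \<epsilon>) * real X"
proof -
  obtain B1 where B1: "B1 \<ge> 0" "\<And>y X. y \<ge> 1 \<Longrightarrow>
    (\<Sum>p | prime p \<and> y < p \<and> p \<le> X \<and> (\<exists>h\<ge>1. h ^ 4 \<le> p \<and> int p dvd N h). 1 / real p) \<le> B1 * real y powr (- (1 / 4))"
    using exceptional_prime_sum_le[of N C] N by blast
  define Z where "Z = (\<Sum>n. real n powr (- 1 - \<delta> / 8))"
  have Z: "Z \<ge> 0" unfolding Z_def
    by (rule suminf_nonneg) (use \<delta> in \<open>simp_all add: summable_real_powr_iff\<close>)
  have "\<forall>\<^sub>F X in sequentially.
           real (count_upto (large_common_prime u y) X) \<le> ((B1 + 16 * Z) * real y powr (- (\<delta> / 8)) + \<epsilon>) * real X"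
    if y: "y \<ge> 1" and \<epsilon>: "\<epsilon> > 0" for y \<epsilon>
  proof -
    have "\<forall>\<^sub>F X in sequentially. (\<Sum>p | prime p \<and> p \<le> X. (real X / real p) powr (1 - \<delta>)) \<le> (\<epsilon> / 4) * real X"
      by (rule prime_powr_sum_small[OF \<delta>]) (use \<epsilon> in simp)
    then show ?thesis
    proof eventually_elim
      case (elim X)
      define R where "R = {p. prime p \<and> y < p \<and> p \<le> X}"
      define exc where "exc p \<longleftrightarrow> (\<exists>h\<ge>1. h ^ 4 \<le> p \<and> int p dvd N h)" for p
      have fin: "finite R" unfolding R_def by (rule finite_subset[of _ "{..X}"]) auto
      have each: "real (card {m\<in>{1..X div p}. int p dvd u (p * m)})
          \<le> real X * (if exc p then 1 / real p else 0)
            + (16 * real X * real p powr (- 1 - 2 * (\<delta> / 8)) + 4 * (real X / real p) powr (1 - \<delta>))"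
        if "p \<in> R" for p
      proof (cases "exc p")
        case True
        have "card {m\<in>{1..X div p}. int p dvd u (p * m)} \<le> card {1..X div p}" by (intro card_mono) auto
        then have "real (card {m\<in>{1..X div p}. int p dvd u (p * m)}) \<le> real (X div p)" by simp
        also have "\<dots> \<le> real X / real p" by (rule of_nat_div_le_of_nat)
        finally show ?thesis using True by (simp add: add_increasing2)
      next
        case False
        have "- 1 - 2 * (\<delta> / 8) = - 1 - \<delta> / 4" by simp
        moreover have "p \<ge> 1" "prime p" using that by (auto simp: R_def Suc_le_eq prime_gt_0_nat)
        ultimately show ?thesis
          using prime_contribution_le[OF \<delta>, of p N u X] window[of p] False by (simp only: exc_def) auto
      qed
      have "real (count_upto (large_common_prime u y) X)
          \<le> (\<Sum>p\<in>R. real (card {m\<in>{1..X div p}. int p dvd u (p * m)}))"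
        unfolding R_def by (rule count_large_common_prime_le)
      also have "\<dots> \<le> (\<Sum>p\<in>R. real X * (if exc p then 1 / real p else 0)
            + (16 * real X * real p powr (- 1 - 2 * (\<delta> / 8)) + 4 * (real X / real p) powr (1 - \<delta>)))"
        by (intro sum_mono each)
      also have "\<dots> = real X * (\<Sum>p\<in>R. if exc p then 1 / real p else 0)
          + (16 * real X * (\<Sum>p\<in>R. real p powr (- 1 - 2 * (\<delta> / 8))) + 4 * (\<Sum>p\<in>R. (real X / real p) powr (1 - \<delta>)))"
        by (simp only: sum.distrib sum_distrib_left)
      also have "\<dots> \<le> real X * (B1 * real y powr (- (\<delta> / 8)))
          + (16 * real X * (Z * real y powr (- (\<delta> / 8))) + 4 * ((\<epsilon> / 4) * real X))"
      proof (intro add_mono mult_left_mono)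
        have "(\<Sum>p\<in>R. if exc p then 1 / real p else 0) = (\<Sum>p\<in>{p\<in>R. exc p}. 1 / real p)"
          using fin by (simp add: sum.inter_filter)
        also have "{p\<in>R. exc p} = {p. prime p \<and> y < p \<and> p \<le> X \<and> (\<exists>h\<ge>1. h ^ 4 \<le> p \<and> int p dvd N h)}"
          by (auto simp: R_def exc_def)
        also have "(\<Sum>p\<in>\<dots>. 1 / real p) \<le> B1 * real y powr (- (1 / 4))" by (rule B1(2)[OF y])
        also have "\<dots> \<le> B1 * real y powr (- (\<delta> / 8))"
          using y \<delta> B1(1) by (intro mult_left_mono powr_mono) auto
        finally show "(\<Sum>p\<in>R. if exc p then 1 / real p else 0) \<le> B1 * real y powr (- (\<delta> / 8))" .
        show "(\<Sum>p\<in>R. real p powr (- 1 - 2 * (\<delta> / 8))) \<le> Z * real y powr (- (\<delta> / 8))"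
          unfolding Z_def using \<delta> y fin by (intro sum_powr_tail_le) (auto simp: R_def)
        have "(\<Sum>p\<in>R. (real X / real p) powr (1 - \<delta>)) \<le> (\<Sum>p | prime p \<and> p \<le> X. (real X / real p) powr (1 - \<delta>))"
          by (rule sum_mono2) (auto simp: R_def)
        also note elim
        finally show "(\<Sum>p\<in>R. (real X / real p) powr (1 - \<delta>)) \<le> (\<epsilon> / 4) * real X" .
      qed auto
      also have "\<dots> = ((B1 + 16 * Z) * real y powr (- (\<delta> / 8)) + \<epsilon>) * real X"
        by (simp add: algebra_simps)
      finally show ?case .
    qed
  qed
  then show ?thesis using B1(1) Z by (intro exI[of _ "B1 + 16 * Z"]) simp
qed

section \<open>Density of the coprime indices\<close>

lemma coprime_iff_no_common_prime:
  "gcd (int n) z = 1 \<longleftrightarrow> \<not> (\<exists>p. prime p \<and> p dvd n \<and> int p dvd z)" if "n \<ge> 1"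
proof
  assume g: "gcd (int n) z = 1"
  show "\<not> (\<exists>p. prime p \<and> p dvd n \<and> int p dvd z)"
  proof
    assume "\<exists>p. prime p \<and> p dvd n \<and> int p dvd z"
    then obtain p where p: "prime p" "p dvd n" "int p dvd z" by blast
    then have "int p dvd gcd (int n) z" by simp
    then have "int p dvd 1" by (simp only: g)
    then show False using p(1) not_prime_1 by simp
  qed
next
  assume no: "\<not> (\<exists>p. prime p \<and> p dvd n \<and> int p dvd z)"
  show "gcd (int n) z = 1"
  proof (rule ccontr)
    define g where "g = nat (gcd (int n) z)"
    assume "gcd (int n) z \<noteq> 1"
    then have "g \<noteq> 1" by (simp add: g_def nat_eq_iff)
    then obtain p where p: "prime p" "p dvd g" using prime_factor_nat by blast
    have "int g = gcd (int n) z" by (simp add: g_def)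
    then have "int p dvd gcd (int n) z" using p(2) by (metis int_dvd_int_iff)
    then have "p dvd n" "int p dvd z" by (simp_all flip: int_dvd_int_iff)
    then show False using no p(1) by blast
  qed
qed

text \<open>Passing from integer to real cutoffs costs the factor of the integer part of
  \<open>x\<close> over \<open>x\<close>, which tends to 1.\<close>

lemma has_densityI:
  assumes "(\<lambda>X. real (count_upto (\<lambda>n. n \<in> S) X) / real X) \<longlonglongrightarrow> d"
  shows "has_density S d"
proof -
  have fl: "filterlim (\<lambda>x::real. nat \<lfloor>x\<rfloor>) sequentially at_top"
    by (rule filterlim_compose[OF filterlim_nat_sequentially filterlim_floor_sequentially])
  have "((\<lambda>x::real. real (nat \<lfloor>x\<rfloor>) / x) \<longlongrightarrow> 1) at_top"
  proof (rule tendsto_sandwich)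
    show "\<forall>\<^sub>F x::real in at_top. 1 - 1 / x \<le> real (nat \<lfloor>x\<rfloor>) / x"
      using eventually_gt_at_top[of 0]
    proof eventually_elim
      case (elim x)
      have "x - 1 \<le> real (nat \<lfloor>x\<rfloor>)" using elim by linarith
      then have "(x - 1) / x \<le> real (nat \<lfloor>x\<rfloor>) / x" using elim by (intro divide_right_mono) auto
      then show ?case using elim by (simp add: diff_divide_distrib)
    qed
    show "\<forall>\<^sub>F x::real in at_top. real (nat \<lfloor>x\<rfloor>) / x \<le> 1"
      using eventually_gt_at_top[of 0]
    proof eventually_elim
      case (elim x)
      then show ?case by (simp add: divide_le_eq_1)
    qed
    have "((\<lambda>x::real. 1 - 1 / x) \<longlongrightarrow> 1 - 0) at_top"
      by (intro tendsto_intros tendsto_divide_0[OF tendsto_const] filterlim_at_top_imp_at_infinity filterlim_ident)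
    then show "((\<lambda>x::real. 1 - 1 / x) \<longlongrightarrow> 1) at_top" by simp
  qed simp
  moreover have "((\<lambda>x::real. real (count_upto (\<lambda>n. n \<in> S) (nat \<lfloor>x\<rfloor>)) / real (nat \<lfloor>x\<rfloor>)) \<longlongrightarrow> d) at_top"
    by (rule filterlim_compose[OF assms fl])
  ultimately have "((\<lambda>x::real. real (nat \<lfloor>x\<rfloor>) / x * (real (count_upto (\<lambda>n. n \<in> S) (nat \<lfloor>x\<rfloor>)) / real (nat \<lfloor>x\<rfloor>)))
      \<longlongrightarrow> 1 * d) at_top" by (rule tendsto_mult)
  moreover have "real (nat \<lfloor>x\<rfloor>) / x * (real (count_upto (\<lambda>n. n \<in> S) (nat \<lfloor>x\<rfloor>)) / real (nat \<lfloor>x\<rfloor>))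
      = real (card (S \<inter> {1..nat \<lfloor>x\<rfloor>})) / x" for x :: real
  proof -
    have "{n\<in>{1..nat \<lfloor>x\<rfloor>}. n \<in> S} = S \<inter> {1..nat \<lfloor>x\<rfloor>}" by auto
    then show ?thesis by (cases "nat \<lfloor>x\<rfloor> = 0") (simp_all add: count_upto_def)
  qed
  ultimately show ?thesis unfolding has_density_def by simp
qed

lemma finite_imp_density_0:
  assumes "finite S"
  shows "has_density S 0"
proof (rule has_densityI, rule Lim_null_comparison)
  show "\<forall>\<^sub>F X in sequentially. norm (real (count_upto (\<lambda>n. n \<in> S) X) / real X) \<le> real (card S) / real X"
  proof (intro always_eventually allI)
    fix X
    have "count_upto (\<lambda>n. n \<in> S) X \<le> card S"
      unfolding count_upto_def by (rule card_mono[OF assms]) auto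
    then show "norm (real (count_upto (\<lambda>n. n \<in> S) X) / real X) \<le> real (card S) / real X"
      by (simp add: divide_right_mono)
  qed
  show "(\<lambda>X. real (card S) / real X) \<longlonglongrightarrow> 0" by (rule lim_const_over_n)
qed

text \<open>The frequency \<open>s\<close> lies between that of \<open>As y\<close>, which
  converges, and the same frequency minus the tail. As the tail is small for large \<open>y\<close>,
  \<open>s\<close> is Cauchy.\<close>

theorem coprime_indices_positive_density:
  fixes u :: "nat \<Rightarrow> int" and N :: "nat \<Rightarrow> int" and a :: "nat \<Rightarrow> int"
  assumes rec: "\<And>n. n \<ge> k \<Longrightarrow> u n = (\<Sum>i=1..k. a i * u (n - i))"
    and N: "\<And>h. h \<ge> 1 \<Longrightarrow> N h \<noteq> 0 \<and> \<bar>N h\<bar> \<le> C ^ h" and \<delta>: "0 < \<delta>" "\<delta> \<le> 1"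
    and window: "\<And>p L a. prime p \<Longrightarrow> L \<ge> 1 \<Longrightarrow> \<forall>h\<in>{1..L}. \<not> int p dvd N h \<Longrightarrow>
        real (card {m\<in>{a..<a + L}. int p dvd u (p * m)}) \<le> 4 * real L powr (1 - \<delta>)"
  shows "\<exists>d>0. (\<lambda>X. real (count_upto (\<lambda>n. gcd (int n) (u n) = 1) X) / real X) \<longlonglongrightarrow> d"
proof -
  define \<eta> where "\<eta> = \<delta> / 8"
  have \<eta>: "\<eta> > 0" using \<delta> by (simp add: \<eta>_def)
  obtain B where B: "B \<ge> 0" "\<And>y \<epsilon>. y \<ge> 1 \<Longrightarrow> \<epsilon> > 0 \<Longrightarrow> \<forall>\<^sub>F X in sequentially.
           real (count_upto (large_common_prime u y) X) \<le> (B * real y powr (- \<eta>) + \<epsilon>) * real X"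
    using large_common_prime_tail[OF N \<delta> window] unfolding \<eta>_def by blast
  define A where "A n \<longleftrightarrow> gcd (int n) (u n) = 1" for n
  define As where "As y n \<longleftrightarrow> (\<forall>p. prime p \<and> p \<le> y \<longrightarrow> \<not> (p dvd n \<and> int p dvd u n))" for y n :: nat
  define Bs where "Bs y n \<longleftrightarrow> (\<forall>p. prime p \<and> p \<le> y \<longrightarrow> \<not> p dvd n)" for y n :: nat
  define s where "s X = real (count_upto A X) / real X" for X
  have AAs: "As y n" if "A n" "n \<ge> 1" for y n
    using that coprime_iff_no_common_prime[of n "u n"] by (auto simp: A_def As_def)
  have AsA: "A n \<or> large_common_prime u y n" if "As y n" "n \<ge> 1" for y n
    using that coprime_iff_no_common_prime[of n "u n"] not_le
    by (auto simp: A_def As_def large_common_prime_def)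
  have powr_0: "(\<lambda>y. B * real y powr (- e)) \<longlonglongrightarrow> 0" if "e > 0" for e
  proof -
    have "(\<lambda>y. real y powr (- e)) \<longlonglongrightarrow> 0"
      using that by (intro tendsto_neg_powr filterlim_real_sequentially) simp
    from tendsto_mult[OF tendsto_const this, of B] show ?thesis by simp
  qed
  \<comment> \<open>Stated for any subfamily \<open>Q\<close> of \<open>As\<close>: taking
    \<open>As\<close> itself proves existence of the density, taking \<open>Bs\<close> proves
    positivity.\<close>
  have lower: "\<forall>\<^sub>F X in sequentially. real (count_upto (Q y) X) / real X - (B * real y powr (- \<eta>) + \<epsilon>) \<le> s X"
    if Q: "\<And>n. Q y n \<Longrightarrow> As y n" and y: "y \<ge> 1" and \<epsilon>: "\<epsilon> > 0" for Q :: "nat \<Rightarrow> nat \<Rightarrow> bool" and y \<epsilon>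
    using B(2)[OF y \<epsilon>] eventually_gt_at_top[of 0]
  proof eventually_elim
    case (elim X)
    have "count_upto (Q y) X \<le> count_upto (\<lambda>n. A n \<or> large_common_prime u y n) X"
      by (rule count_upto_mono) (use Q AsA in blast)
    also have "\<dots> \<le> count_upto A X + count_upto (large_common_prime u y) X" by (rule count_upto_disj)
    finally have "real (count_upto (Q y) X) \<le> real (count_upto A X) + (B * real y powr (- \<eta>) + \<epsilon>) * real X"
      using elim(1) by linarith
    then have "real (count_upto (Q y) X) / real X \<le> (real (count_upto A X) + (B * real y powr (- \<eta>) + \<epsilon>) * real X) / real X"
      by (rule divide_right_mono) simp
    then show ?case using elim(2) by (simp add: s_def add_divide_distrib)
  qed
  have upper: "s X \<le> real (count_upto (As y) X) / real X" for X y
    unfolding s_def by (intro divide_right_mono) (simp_all add: count_upto_mono AAs)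
  have approx: "\<exists>d. \<forall>\<^sub>F X in sequentially. \<bar>s X - d\<bar> < e" if e: "e > 0" for e
  proof -
    have "\<forall>\<^sub>F y in sequentially. B * real y powr (- \<eta>) < e / 4"
      using powr_0[OF \<eta>] e by (intro order_tendstoD(2)[of _ 0]) auto
    then have "\<forall>\<^sub>F y in sequentially. y \<ge> 1 \<and> B * real y powr (- \<eta>) < e / 4"
      using eventually_ge_at_top[of 1] by eventually_elim simp
    then obtain y where y: "y \<ge> 1" "B * real y powr (- \<eta>) < e / 4"
      using eventually_happens' sequentially_bot by blast
    obtain d where d: "(\<lambda>X. real (count_upto (As y) X) / real X) \<longlonglongrightarrow> d"
      using no_small_common_prime_density[OF rec, where y = y] unfolding As_def by blast
    have ev: "\<forall>\<^sub>F X in sequentially. \<bar>real (count_upto (As y) X) / real X - d\<bar> < e / 4"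
      using tendstoD[OF d, of "e / 4"] e by (simp add: dist_real_def)
    have low: "\<forall>\<^sub>F X in sequentially. real (count_upto (As y) X) / real X - (B * real y powr (- \<eta>) + e / 4) \<le> s X"
      by (rule lower) (use y e in auto)
    from ev low have "\<forall>\<^sub>F X in sequentially. \<bar>s X - d\<bar> < e"
    proof eventually_elim
      case (elim X)
      then show ?case using upper[of X y] y(2) by linarith
    qed
    then show ?thesis by blast
  qed
  have "Cauchy s"
  proof (rule metric_CauchyI)
    fix e :: real assume "e > 0"
    then obtain d where "\<forall>\<^sub>F X in sequentially. \<bar>s X - d\<bar> < e / 2" using approx[of "e / 2"] by auto
    then obtain M where M: "\<And>X. X \<ge> M \<Longrightarrow> \<bar>s X - d\<bar> < e / 2" unfolding eventually_sequentially by blast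
    have "dist (s m) (s n) < e" if "m \<ge> M" "n \<ge> M" for m n
      using M[OF that(1)] M[OF that(2)] unfolding dist_real_def by linarith
    then show "\<exists>M. \<forall>m\<ge>M. \<forall>n\<ge>M. dist (s m) (s n) < e" by blast
  qed
  then obtain d where d: "s \<longlonglongrightarrow> d" using Cauchy_convergent convergent_def by blast
  have d_ge: "d \<ge> (\<Prod>p | prime p \<and> p \<le> y. 1 - 1 / real p) - (B * real y powr (- \<eta>) + \<epsilon>)"
    if "y \<ge> 1" "\<epsilon> > 0" for y \<epsilon>
  proof (rule tendsto_le[OF _ d])
    show "(\<lambda>X. real (count_upto (Bs y) X) / real X - (B * real y powr (- \<eta>) + \<epsilon>))
        \<longlonglongrightarrow> (\<Prod>p | prime p \<and> p \<le> y. 1 - 1 / real p) - (B * real y powr (- \<eta>) + \<epsilon>)"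
      using coprime_to_small_primes_density[of y] unfolding Bs_def by (intro tendsto_intros)
    show "\<forall>\<^sub>F X in sequentially. real (count_upto (Bs y) X) / real X - (B * real y powr (- \<eta>) + \<epsilon>) \<le> s X"
      by (rule lower) (use that in \<open>auto simp: Bs_def As_def\<close>)
  qed simp
  \<comment> \<open>With \<eta>/2 here the product decays more slowly than the tail y^(-\<eta>), so
    some \<open>y\<close> makes the difference positive.\<close>
  obtain c where c: "c > 0" "\<And>n. c * (real n + 1) powr (- (\<eta> / 2)) \<le> (\<Prod>p | prime p \<and> p \<le> n. 1 - 1 / real p)"
    using prime_product_lower_bound[of "\<eta> / 2"] \<eta> by auto
  have "\<forall>\<^sub>F y in sequentially. B * real y powr (- (\<eta> / 2)) < c * 2 powr (- (\<eta> / 2))"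
    using powr_0[of "\<eta> / 2"] c(1) \<eta> by (intro order_tendstoD(2)[of _ 0]) auto
  then have "\<forall>\<^sub>F y in sequentially. y \<ge> 1 \<and> B * real y powr (- (\<eta> / 2)) < c * 2 powr (- (\<eta> / 2))"
    using eventually_ge_at_top[of 1] by eventually_elim simp
  then obtain y where y: "y \<ge> 1" "B * real y powr (- (\<eta> / 2)) < c * 2 powr (- (\<eta> / 2))"
    using eventually_happens' sequentially_bot by blast
  have "B * real y powr (- \<eta>) = (B * real y powr (- (\<eta> / 2))) * real y powr (- (\<eta> / 2))"
  proof -
    have "- \<eta> = - (\<eta> / 2) + - (\<eta> / 2)" by simp
    then have "real y powr (- \<eta>) = real y powr (- (\<eta> / 2)) * real y powr (- (\<eta> / 2))"
      by (simp only: powr_add)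
    then show ?thesis by simp
  qed
  also have "\<dots> < (c * 2 powr (- (\<eta> / 2))) * real y powr (- (\<eta> / 2))"
    using y by (intro mult_strict_right_mono) auto
  also have "\<dots> = c * (2 * real y) powr (- (\<eta> / 2))" by (simp add: powr_mult)
  also have "\<dots> \<le> c * (real y + 1) powr (- (\<eta> / 2))"
    using y(1) c(1) \<eta> by (intro mult_left_mono powr_mono2') auto
  also have "\<dots> \<le> (\<Prod>p | prime p \<and> p \<le> y. 1 - 1 / real p)" by (rule c(2))
  finally have pos: "(\<Prod>p | prime p \<and> p \<le> y. 1 - 1 / real p) - B * real y powr (- \<eta>) > 0" by simp
  have "d > 0"
    using d_ge[OF y(1), of "((\<Prod>p | prime p \<and> p \<le> y. 1 - 1 / real p) - B * real y powr (- \<eta>)) / 2"] pos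
    by (simp add: field_simps)
  moreover have "(\<lambda>X. real (count_upto (\<lambda>n. gcd (int n) (u n) = 1) X) / real X) \<longlonglongrightarrow> d"
    using d unfolding s_def A_def .
  ultimately show ?thesis by blast
qed

section \<open>From the integer recurrence to its exponential sum\<close>

lemma coeff_char_poly:
  "coeff (Defs.char_poly k c) j = (if j = k then 1 else 0) - (\<Sum>i=1..k. if k - i = j then c i else 0)"
  by (simp add: Defs.char_poly_def coeff_sum coeff_monom)

lemma lead_coeff_char_poly: "degree (Defs.char_poly k c) = k" "coeff (Defs.char_poly k c) k = 1"
proof -
  have zero: "(\<Sum>i=1..k. if k - i = j then c i else 0) = 0" if "j \<ge> k" for j
    using that by (intro sum.neutral) auto
  show c: "coeff (Defs.char_poly k c) k = 1" unfolding coeff_char_poly zero[OF order_refl] by simp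
  have "degree (Defs.char_poly k c) \<le> k"
    using zero by (intro degree_le) (simp add: coeff_char_poly)
  moreover have "k \<le> degree (Defs.char_poly k c)" by (rule le_degree) (simp add: c)
  ultimately show "degree (Defs.char_poly k c) = k" by simp
qed

lemma shift_op_char_poly:
  "shift_op (Defs.char_poly k c) s n = s (n + k) - (\<Sum>i=1..k. c i * s (n + k - i))"
proof -
  have monom: "shift_op (monom x d) s n = x * s (n + d)" for x d
    by (induction d arbitrary: n) (simp_all add: monom_0 monom_Suc)
  have minus: "shift_op (- p) s n = - shift_op p s n" for p
    using shift_op_smult[of "-1" p s n] by simp
  have sum: "shift_op (sum f I) s n = (\<Sum>i\<in>I. shift_op (f i) s n)" for f :: "nat \<Rightarrow> complex poly" and I
    by (induction I rule: infinite_finite_induct) (simp_all add: shift_op_add_poly)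
  have "shift_op (Defs.char_poly k c) s n = s (n + k) - (\<Sum>i=1..k. c i * s (n + (k - i)))"
    unfolding Defs.char_poly_def diff_conv_add_uminus shift_op_add_poly minus sum monom by simp
  also have "(\<Sum>i=1..k. c i * s (n + (k - i))) = (\<Sum>i=1..k. c i * s (n + k - i))"
    by (intro sum.cong) auto
  finally show ?thesis .
qed

text \<open>Two recurrences cooperate: the monic integral one makes all exponents nonzero algebraic
  integers, while the nondegenerate one, whose coefficients may be arbitrary complex numbers, keeps
  quotients of exponents from being roots of unity.\<close>

theorem integer_recurrence_expsum:
  fixes u :: "nat \<Rightarrow> int" and a :: "nat \<Rightarrow> int"
  assumes k: "k \<ge> 1" "a k \<noteq> 0" and rec: "\<forall>n\<ge>k. u n = (\<Sum>i=1..k. a i * u (n - i))"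
    and nondeg: "nondegenerate_seq (\<lambda>n. of_int (u n))"
  shows "\<exists>J P. finite J \<and> (\<forall>\<alpha>\<in>J. algebraic_int \<alpha> \<and> \<alpha> \<noteq> 0)
      \<and> (\<forall>\<alpha>\<in>J. \<forall>\<beta>\<in>J. \<forall>h\<ge>1. \<alpha> \<noteq> \<beta> \<longrightarrow> \<alpha> ^ h \<noteq> \<beta> ^ h)
      \<and> (\<forall>\<alpha> i. coeff (P \<alpha>) i \<in> alg_numbers) \<and> (\<forall>n. of_int (u n) = expsum J P n)"
proof -
  define U where "U n = (of_int (u n) :: complex)" for n
  define p where "p = Defs.char_poly k (\<lambda>i. of_int (a i))"
  have rec_p: "shift_op p U n = 0" for n
    using rec[rule_format, of "n + k"] by (simp add: p_def shift_op_char_poly U_def)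
  have p0: "p \<noteq> 0" using lead_coeff_char_poly(2)[of k "\<lambda>i. of_int (a i)"] by (auto simp: p_def)
  have coeff0: "coeff p 0 = - of_int (a k)"
  proof -
    have "(\<Sum>i=1..k. if k - i = 0 then of_int (a i) else 0 :: complex) = (\<Sum>i=1..k. if i = k then of_int (a i) else 0)"
      by (intro sum.cong) auto
    then show ?thesis using k(1) by (simp add: p_def coeff_char_poly)
  qed
  have root_p: "algebraic_int z \<and> z \<noteq> 0" if z: "poly p z = 0" for z
  proof
    have "coeff p i \<in> \<int>" for i
      unfolding p_def coeff_char_poly by (intro Ints_diff Ints_sum) auto
    moreover have "lead_coeff p = 1" by (simp add: p_def lead_coeff_char_poly)
    ultimately show "algebraic_int z" using z by (intro algebraic_int.intros[of p]) auto
    show "z \<noteq> 0"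
    proof
      assume "z = 0"
      then have "coeff p 0 = 0" using z by (simp add: poly_0_coeff_0)
      then show False using k(2) by (simp add: coeff0)
    qed
  qed
  have "\<exists>J P. finite J \<and> (\<forall>\<alpha>\<in>J. \<alpha> \<noteq> 0 \<and> \<alpha> \<in> alg_numbers)
           \<and> (\<forall>\<alpha> i. coeff (P \<alpha>) i \<in> alg_numbers) \<and> (\<forall>n. U n = expsum J P n)"
    by (rule linear_recurrence_imp_expsum[OF p0 _ _ rec_p])
      (use root_p algebraic_int_in_alg_numbers in \<open>auto simp: U_def\<close>)
  then obtain J0 P where J0: "finite J0" "\<And>\<alpha>. \<alpha> \<in> J0 \<Longrightarrow> \<alpha> \<noteq> 0"
    and P: "\<And>\<alpha> i. coeff (P \<alpha>) i \<in> alg_numbers" and U0: "\<And>n. U n = expsum J0 P n" by blast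
  \<comment> \<open>Only exponents that really occur are forced to be roots of every recurrence for
    the sequence.\<close>
  define J where "J = {\<alpha>\<in>J0. P \<alpha> \<noteq> 0}"
  have J: "finite J" "0 \<notin> J" using J0 by (auto simp: J_def)
  have U: "U n = expsum J P n" for n
    unfolding U0 expsum_def J_def using J0(1) by (intro sum.mono_neutral_right) auto
  have root: "poly q \<alpha> = 0" if "\<And>n. shift_op q U n = 0" "\<alpha> \<in> J" for q \<alpha>
  proof (rule expsum_exponent_is_root[OF J, of 0])
    have "U = expsum J P" using U by blast
    then show "shift_op q (expsum J P) n = 0" for n using that(1) by simp
  qed (use that in \<open>auto simp: J_def\<close>)
  obtain m c where mc: "\<And>n. n \<ge> m \<Longrightarrow> U n = (\<Sum>i=1..m. c i * U (n - i))" "nondegenerate_rec m c"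
    using nondeg unfolding nondegenerate_seq_def U_def by blast
  have rec_c: "shift_op (Defs.char_poly m c) U n = 0" for n
    using mc(1)[of "n + m"] by (simp add: shift_op_char_poly)
  have "\<alpha> ^ h \<noteq> \<beta> ^ h" if "\<alpha> \<in> J" "\<beta> \<in> J" "h \<ge> 1" "\<alpha> \<noteq> \<beta>" for \<alpha> \<beta> h
  proof
    assume "\<alpha> ^ h = \<beta> ^ h"
    moreover have "\<beta> \<noteq> 0" using that J by blast
    ultimately have "(\<alpha> / \<beta>) ^ h = 1" by (simp add: power_divide)
    moreover have "h > 0" using that(3) by simp
    ultimately show False
      using mc(2) root[OF rec_c that(1)] root[OF rec_c that(2)] that(4)
      unfolding nondegenerate_rec_def by blast
  qed
  moreover have "algebraic_int \<alpha> \<and> \<alpha> \<noteq> 0" if "\<alpha> \<in> J" for \<alpha>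
    by (rule root_p[OF root[OF rec_p that]])
  ultimately show ?thesis
    using J(1) P U[unfolded U_def] by (intro exI[of _ J] exI[of _ P] conjI ballI allI impI) simp_all
qed

theorem theorem1p1:
  fixes u :: "nat \<Rightarrow> int" and a :: "nat \<Rightarrow> int" and k :: nat
  assumes "k \<ge> 1"
    and "a k \<noteq> 0"
    and "\<exists>n. u n \<noteq> 0"
    and "\<forall>n\<ge>k. u n = (\<Sum>i=1..k. a i * u (n - i))"
    and "nondegenerate_seq (\<lambda>n. of_int (u n))"
  defines "A \<equiv> {n::nat. n \<ge> 1 \<and> gcd (int n) (u n) = 1}"
  shows "(\<exists>d. has_density A d)
    \<and> (\<not> is_linear_recurrence (\<lambda>j. of_int (u (j + 1)) / of_nat (j + 1)) \<longrightarrow>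
          (\<exists>d>0. has_density A d))
    \<and> (is_linear_recurrence (\<lambda>j. of_int (u (j + 1)) / of_nat (j + 1)) \<longrightarrow>
          finite A \<and> has_density A 0)"
proof -
  have rec: "\<And>n. n \<ge> k \<Longrightarrow> u n = (\<Sum>i=1..k. a i * u (n - i))" using assms(4) by blast
  from integer_recurrence_expsum[OF assms(1,2,4,5)] obtain J P
    where JP: "finite J" "\<forall>\<alpha>\<in>J. algebraic_int \<alpha> \<and> \<alpha> \<noteq> 0"
      "\<forall>\<alpha>\<in>J. \<forall>\<beta>\<in>J. \<forall>h\<ge>1. \<alpha> \<noteq> \<beta> \<longrightarrow> \<alpha> ^ h \<noteq> \<beta> ^ h"
      "\<forall>\<alpha> i. coeff (P \<alpha>) i \<in> alg_numbers" "\<forall>n. of_int (u n) = expsum J P n"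
    by (elim exE conjE) (rule that)
  note J = JP(1) JP(2)[rule_format] and P = JP(4)[rule_format] and u = JP(5)[rule_format]
  have ratio: "\<alpha> ^ h \<noteq> \<beta> ^ h" if "\<alpha> \<in> J" "\<beta> \<in> J" "\<alpha> \<noteq> \<beta>" "h \<ge> 1" for \<alpha> \<beta> h
    by (rule JP(3)[rule_format, OF that(1,2,4,3)])
  have J0: "0 \<notin> J" using J(2) by blast
  show ?thesis
  \<comment> \<open>This alternative coincides with whether the quotient sequence is a linear
    recurrence, so in each case one of the two implications is vacuous.\<close>
  proof (cases "\<forall>\<alpha>\<in>J. poly (P \<alpha>) 0 = 0")
    case True
    then have "is_linear_recurrence (\<lambda>j. of_int (u (j + 1)) / of_nat (j + 1))"
      unfolding u using J(1) by (intro constant_terms_0_imp_quotient_recurrence) auto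
    moreover have "finite A"
      unfolding A_def using J True P u by (intro constant_terms_0_imp_finite[of J P]) auto
    ultimately show ?thesis using finite_imp_density_0 by blast
  next
    case False
    then obtain \<alpha>0 where \<alpha>0: "\<alpha>0 \<in> J" "poly (P \<alpha>0) 0 \<noteq> 0" by blast
    then have "\<not> is_linear_recurrence (\<lambda>j. of_int (u (j + 1)) / of_nat (j + 1))"
      unfolding u using quotient_recurrence_imp_constant_terms_0[OF J(1) J0] by blast
    moreover have "\<exists>(N :: nat \<Rightarrow> int) (C :: int) (\<delta> :: real).
           (\<forall>h\<ge>1. N h \<noteq> 0 \<and> \<bar>N h\<bar> \<le> C ^ h) \<and> 0 < \<delta> \<and> \<delta> \<le> 1 \<and>
           (\<forall>p L a. prime p \<longrightarrow> L \<ge> 1 \<longrightarrow> (\<forall>h\<in>{1..L}. \<not> int p dvd N h) \<longrightarrow>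
              real (card {m\<in>{a..<a + L}. int p dvd u (p * m)}) \<le> 4 * real L powr (1 - \<delta>))"
      by (rule expsum_mod_prime_window_bound[OF J(1) _ _ P u \<alpha>0]) (fact J ratio)+
    then obtain N C \<delta> where N: "\<forall>h\<ge>1. N h \<noteq> 0 \<and> \<bar>N h\<bar> \<le> C ^ h" "0 < \<delta>" "\<delta> \<le> (1::real)"
      and window: "\<forall>p L a. prime p \<longrightarrow> L \<ge> 1 \<longrightarrow> (\<forall>h\<in>{1..L}. \<not> int p dvd N h) \<longrightarrow>
              real (card {m\<in>{a..<a + L}. int p dvd u (p * m)}) \<le> 4 * real L powr (1 - \<delta>)"
      by (elim exE conjE) (rule that)
    have "\<exists>d>0. (\<lambda>X. real (count_upto (\<lambda>n. gcd (int n) (u n) = 1) X) / real X) \<longlonglongrightarrow> d"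
    proof (rule coprime_indices_positive_density)
      show "N h \<noteq> 0 \<and> \<bar>N h\<bar> \<le> C ^ h" if "h \<ge> 1" for h by (rule N(1)[rule_format, OF that])
      show "real (card {m\<in>{a..<a + L}. int p dvd u (p * m)}) \<le> 4 * real L powr (1 - \<delta>)"
        if "prime p" "L \<ge> 1" "\<forall>h\<in>{1..L}. \<not> int p dvd N h" for p L a
        by (rule window[rule_format, OF that(1,2)]) (rule that(3)[rule_format])
    qed (fact rec N)+
    then obtain d where d: "d > 0" "(\<lambda>X. real (count_upto (\<lambda>n. gcd (int n) (u n) = 1) X) / real X) \<longlonglongrightarrow> d"
      by blast
    have "count_upto (\<lambda>n. n \<in> A) = count_upto (\<lambda>n. gcd (int n) (u n) = 1)"
      by (rule ext, unfold count_upto_def, rule arg_cong[of _ _ card]) (auto simp: A_def)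
    then have "has_density A d" using d(2) by (intro has_densityI) simp
    ultimately show ?thesis using d(1) by blast
  qed
qed

end
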